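(* Let $1\le r<\infty$ and let $\alpha$ be a $C^r$-differential structure on the orbifold $X$. For every $s$ with $r<s\le\infty$, there exists a compatible $C^s$-differential structure $\beta\subset\alpha$ on $X$.
   Context: Orbifolds. Let $X$ be a topological space and $n>0$. An $n$-dimensional orbifold chart for an open subset $V\subset X$ is a triple $(\tilde V,G,\varphi)$ where $\tilde V$ is a connected open subset of $\mathbb{R}^n$, $G$ is a finite group acting on $\tilde V$ by homeomorphisms (not necessarily effectively; $\ker(G)$ denotes the subgroup acting trivially), and $\varphi\colon\tilde V\to V$ is a $G$-invariant map inducing a homeomorphism $\tilde V/G\to V$. If $V_i\subset V_j$, an embedding $(\lambda_{ij},h_{ij})\colon(\tilde V_i,G_i,\varphi_i)\to(\tilde V_j,G_j,\varphi_j)$ consists of an injective homomorphism $h_{ij}\colon G_i\to G_j$ restricting to an isomorphism $\ker(G_i)\to\ker(G_j)$ and an embedding $\lambda_{ij}\colon\tilde V_i\to\tilde V_j$ with $\lambda_{ij}(gx)=h_{ij}(g)\lambda_{ij}(x)$ and $\varphi_j\circ\lambda_{ij}=\varphi_i$. An orbifold atlas on $X$ is a family of charts whose images $V_i$ cover $X$ and such that for any two charts with images $V_i,V_j$ and any $x\in V_i\cap V_j$ there is a chart with image $V_k$, $x\in V_k\subset V_i\cap V_j$, that embeds into both charts. An atlas refines another if each of its charts embeds into some chart of the other; two atlases are equivalent if they have a common refinement. An $n$-dimensional orbifold is a paracompact Hausdorff space with an equivalence class of $n$-dimensional orbifold atlases. All orbifolds are assumed to have only countably many connected components (hence are second countable).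 Differential structures. An atlas is a $C^r$-atlas if all groups $G_i$ act by $C^r$-diffeomorphisms and all $\lambda_{ij}$ are $C^r$-embeddings. A $C^r$-differential structure on $X$ is a maximal $C^r$-atlas $\alpha$ on $X$. A $C^s$-differential structure $\beta$ on $X$, $s>r$, is called compatible with $\alpha$ if $\beta\subset\alpha$, i.e. every chart in $\beta$ is a chart in $\alpha$. $C^\infty$ means smooth. *)

theory Defs
  imports "HOL-Analysis.Analysis" "HOL-Algebra.Group_Action" "HOL-Library.Extended_Nat"
begin

section \<open>Maps of class C^r between open sets\<close>

text \<open>
  For open S this is continuous differentiability of order k: in finite dimensions the derivative
  is of class C^k iff all directional derivatives are.
\<close>
primrec Ck_on :: "nat \<Rightarrow> ('a::euclidean_space \<Rightarrow> 'b::euclidean_space) \<Rightarrow> 'a set \<Rightarrow> bool" where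
  "Ck_on 0 f S \<longleftrightarrow> continuous_on S f"
| "Ck_on (Suc k) f S \<longleftrightarrow>
     (\<forall>x\<in>S. f differentiable (at x)) \<and> (\<forall>v. Ck_on k (\<lambda>x. frechet_derivative f (at x) v) S)"

definition Cr_on :: "enat \<Rightarrow> ('a::euclidean_space \<Rightarrow> 'b::euclidean_space) \<Rightarrow> 'a set \<Rightarrow> bool" where
  "Cr_on r f S \<longleftrightarrow> (\<forall>k. enat k \<le> r \<longrightarrow> Ck_on k f S)"

definition Cr_diffeomorphism ::
    "enat \<Rightarrow> 'a::euclidean_space set \<Rightarrow> 'a set \<Rightarrow> ('a \<Rightarrow> 'a) \<Rightarrow> bool" where
  "Cr_diffeomorphism r S T f \<longleftrightarrow>
     (\<exists>g. homeomorphism S T f g \<and> Cr_on r f S \<and> Cr_on r g T)"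

text \<open>
  Source and target are open subsets of the same Euclidean space, so the image of an embedding is
  open and an embedding is a diffeomorphism onto an open subset.
\<close>
definition Cr_embedding ::
    "enat \<Rightarrow> 'a::euclidean_space set \<Rightarrow> 'a set \<Rightarrow> ('a \<Rightarrow> 'a) \<Rightarrow> bool" where
  "Cr_embedding r S T f \<longleftrightarrow> f ` S \<subseteq> T \<and> open (f ` S) \<and> Cr_diffeomorphism r S (f ` S) f"


section \<open>Orbifold charts\<close>

text \<open>
  Every finite group is isomorphic to one whose carrier consists of natural numbers, so the type of
  group elements is no restriction. Values of the chart map and of embeddings outside the chart
  domain are irrelevant to all notions below.
\<close>
record ('a, 'x) orbifold_chart =
  chart_dom :: "'a set"
  chart_group :: "nat monoid"
  chart_action :: "nat \<Rightarrow> 'a \<Rightarrow> 'a"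
  chart_map :: "'a \<Rightarrow> 'x"

definition chart_image :: "('a, 'x) orbifold_chart \<Rightarrow> 'x set" where
  "chart_image c = chart_map c ` chart_dom c"

definition chart_kernel :: "('a, 'x) orbifold_chart \<Rightarrow> nat set" where
  "chart_kernel c = {g \<in> carrier (chart_group c). \<forall>x\<in>chart_dom c. chart_action c g x = x}"

definition chart_orbit :: "('a, 'x) orbifold_chart \<Rightarrow> 'a \<Rightarrow> 'a set" where
  "chart_orbit c = orbit (chart_group c) (chart_action c)"

definition orbit_space :: "('a::topological_space, 'x) orbifold_chart \<Rightarrow> 'a set topology" where
  "orbit_space c = topology (\<lambda>\<U>. \<U> \<subseteq> chart_orbit c ` chart_dom c \<and>
     openin (top_of_set (chart_dom c)) {x \<in> chart_dom c. chart_orbit c x \<in> \<U>})"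

lemma openin_orbit_space:
  "openin (orbit_space c) \<U> \<longleftrightarrow> \<U> \<subseteq> chart_orbit c ` chart_dom c \<and>
     openin (top_of_set (chart_dom c)) {x \<in> chart_dom c. chart_orbit c x \<in> \<U>}"
proof -
  let ?T = "top_of_set (chart_dom c)"
  let ?P = "\<lambda>\<U>. {x \<in> chart_dom c. chart_orbit c x \<in> \<U>}"
  let ?Q = "\<lambda>\<U>. \<U> \<subseteq> chart_orbit c ` chart_dom c \<and> openin ?T (?P \<U>)"
  have 1: "?Q (S \<inter> S')" if "?Q S" "?Q S'" for S S'
  proof -
    have "?P (S \<inter> S') = ?P S \<inter> ?P S'" by blast
    then show ?thesis using that openin_Int[of ?T "?P S" "?P S'"] by auto
  qed
  have 2: "?Q (\<Union>\<K>)" if "\<forall>K\<in>\<K>. ?Q K" for \<K>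
  proof -
    have "?P (\<Union>\<K>) = (\<Union>K\<in>\<K>. ?P K)" by auto
    moreover have "openin ?T (\<Union>K\<in>\<K>. ?P K)"
      by (rule openin_Union) (use that in auto)
    moreover have "\<Union>\<K> \<subseteq> chart_orbit c ` chart_dom c"
      using that by (simp add: Sup_le_iff)
    ultimately show ?thesis by simp
  qed
  have "istopology ?Q"
    unfolding istopology_def
  proof (rule conjI)
    show "\<forall>S T. ?Q S \<longrightarrow> ?Q T \<longrightarrow> ?Q (S \<inter> T)" using 1 by iprover
    show "\<forall>\<K>. (\<forall>K\<in>\<K>. ?Q K) \<longrightarrow> ?Q (\<Union>\<K>)" using 2 by iprover
  qed
  then show ?thesis
    unfolding orbit_space_def by (simp only: topology_inverse')
qed

text \<open>
  The last conjunct says that the chart map factors through the orbit map (in particular is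
  invariant) and that the induced map is a homeomorphism onto the image.
\<close>
definition orbifold_chart ::
    "'x topology \<Rightarrow> ('a::euclidean_space, 'x) orbifold_chart \<Rightarrow> bool" where
  "orbifold_chart X c \<longleftrightarrow>
     open (chart_dom c) \<and> connected (chart_dom c) \<and>
     openin X (chart_image c) \<and>
     finite (carrier (chart_group c)) \<and>
     group_action (chart_group c) (chart_dom c) (chart_action c) \<and>
     (\<forall>g \<in> carrier (chart_group c).
        homeomorphic_map (top_of_set (chart_dom c)) (top_of_set (chart_dom c))
          (chart_action c g)) \<and>
     (\<exists>q. homeomorphic_map (orbit_space c) (subtopology X (chart_image c)) q \<and>
          (\<forall>x \<in> chart_dom c. q (chart_orbit c x) = chart_map c x))"

definition chart_embedding ::
    "('a::euclidean_space, 'x) orbifold_chart \<Rightarrow> ('a, 'x) orbifold_chart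
       \<Rightarrow> ('a \<Rightarrow> 'a) \<Rightarrow> (nat \<Rightarrow> nat) \<Rightarrow> bool" where
  "chart_embedding c d l h \<longleftrightarrow>
     h \<in> hom (chart_group c) (chart_group d) \<and>
     inj_on h (carrier (chart_group c)) \<and>
     h \<in> iso ((chart_group c)\<lparr>carrier := chart_kernel c\<rparr>)
             ((chart_group d)\<lparr>carrier := chart_kernel d\<rparr>) \<and>
     embedding_map (top_of_set (chart_dom c)) (top_of_set (chart_dom d)) l \<and>
     (\<forall>g \<in> carrier (chart_group c). \<forall>x \<in> chart_dom c.
        l (chart_action c g x) = chart_action d (h g) (l x)) \<and>
     (\<forall>x \<in> chart_dom c. chart_map d (l x) = chart_map c x)"

definition embeds_into ::
    "('a::euclidean_space, 'x) orbifold_chart \<Rightarrow> ('a, 'x) orbifold_chart \<Rightarrow> bool" where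
  "embeds_into c d \<longleftrightarrow> (\<exists>l h. chart_embedding c d l h)"


section \<open>Atlases and orbifolds\<close>

definition orbifold_atlas ::
    "'x topology \<Rightarrow> ('a::euclidean_space, 'x) orbifold_chart set \<Rightarrow> bool" where
  "orbifold_atlas X A \<longleftrightarrow>
     (\<forall>c\<in>A. orbifold_chart X c) \<and>
     (\<Union>c\<in>A. chart_image c) = topspace X \<and>
     (\<forall>c\<in>A. \<forall>d\<in>A. \<forall>x \<in> chart_image c \<inter> chart_image d.
        \<exists>e\<in>A. x \<in> chart_image e \<and> chart_image e \<subseteq> chart_image c \<inter> chart_image d \<and>
               embeds_into e c \<and> embeds_into e d)"

definition refines ::
    "('a::euclidean_space, 'x) orbifold_chart set \<Rightarrow> ('a, 'x) orbifold_chart set \<Rightarrow> bool" where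
  "refines B A \<longleftrightarrow> (\<forall>c\<in>B. \<exists>d\<in>A. embeds_into c d)"

definition atlas_equivalence ::
    "'x topology \<Rightarrow>
       (('a::euclidean_space, 'x) orbifold_chart set \<times> ('a, 'x) orbifold_chart set) set" where
  "atlas_equivalence X = {(A, B). orbifold_atlas X A \<and> orbifold_atlas X B \<and>
     (\<exists>C. orbifold_atlas X C \<and> refines C A \<and> refines C B)}"

definition paracompact_space :: "'x topology \<Rightarrow> bool" where
  "paracompact_space X \<longleftrightarrow>
     (\<forall>\<U>. (\<forall>U\<in>\<U>. openin X U) \<and> \<Union>\<U> = topspace X \<longrightarrow>
       (\<exists>\<V>. (\<forall>V\<in>\<V>. openin X V) \<and> \<Union>\<V> = topspace X \<and>
             (\<forall>V\<in>\<V>. \<exists>U\<in>\<U>. V \<subseteq> U) \<and> locally_finite_in X \<V>))"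

text \<open>
  The second argument is the orbifold structure, an equivalence class of atlases; the dimension
  is that of the Euclidean space containing the chart domains.
\<close>
definition orbifold ::
    "'x topology \<Rightarrow> ('a::euclidean_space, 'x) orbifold_chart set set \<Rightarrow> bool" where
  "orbifold X \<O> \<longleftrightarrow>
     paracompact_space X \<and> Hausdorff_space X \<and> countable (connected_components_of X) \<and>
     \<O> \<in> {A. orbifold_atlas X A} // atlas_equivalence X"


section \<open>Differential structures\<close>

definition Cr_atlas ::
    "enat \<Rightarrow> 'x topology \<Rightarrow> ('a::euclidean_space, 'x) orbifold_chart set \<Rightarrow> bool" where
  "Cr_atlas r X A \<longleftrightarrow>
     orbifold_atlas X A \<and>
     (\<forall>c\<in>A. \<forall>g \<in> carrier (chart_group c).
        Cr_diffeomorphism r (chart_dom c) (chart_dom c) (chart_action c g)) \<and>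
     (\<forall>c\<in>A. \<forall>d\<in>A. \<forall>l h. chart_embedding c d l h \<longrightarrow>
        Cr_embedding r (chart_dom c) (chart_dom d) l)"

text \<open>Maximality is with respect to inclusion of sets of charts.\<close>
definition differential_structure ::
    "enat \<Rightarrow> 'x topology \<Rightarrow> ('a::euclidean_space, 'x) orbifold_chart set set
       \<Rightarrow> ('a, 'x) orbifold_chart set \<Rightarrow> bool" where
  "differential_structure r X \<O> \<alpha> \<longleftrightarrow>
     \<alpha> \<in> \<O> \<and> Cr_atlas r X \<alpha> \<and> (\<forall>\<gamma>. Cr_atlas r X \<gamma> \<and> \<alpha> \<subseteq> \<gamma> \<longrightarrow> \<gamma> = \<alpha>)"

end

theory Submission
  imports Defs
begin

text \<open>
  Two facts carry the proof. The first says that a smooth structure is determined by germs: two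
  lifts of the same map between quotients of smooth finite group actions differ, near every point,
  only by group elements (\<open>lifts_differ\<close>). Hence one smooth lift between two charts makes every
  chart embedding between them smooth, and it is enough to find a family of charts inside \<open>\<alpha>\<close> that
  covers the space, has C^s actions and is pairwise C^s-compatible
  (\<open>compatible_structure_from_cover\<close>): the set of all charts compatible with such a family is then
  a C^s-atlas, it is maximal, it lies in \<open>\<alpha>\<close>, and it stays in the given equivalence class of atlases.

  The second fact is local smoothing. Bochner's averaging trick puts a linear chart around each
  point. If a C^s structure is already given on an open set, then in a linear chart it is a C^s
  structure on an open subset of Euclidean space that is only C^r-related to the standard one.
  Adding a vector field of compact support and small Lipschitz constant to the identity gives a C^r
  diffeomorphism; by convolution the vector field can be chosen so that, on a neighbourhood of a
  prescribed compact set, the diffeomorphism becomes C^s for the given structure. Averaging over the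
  linear group makes it equivariant without spoiling these properties (\<open>equivariant_smoothing\<close>).
  Composing the chart map with its inverse yields a chart of \<open>\<alpha>\<close> that is C^s-compatible with the
  given structure near the compact set, so the structure extends over that chart after it has been
  shrunk away from a compact set (\<open>extend_partial_structure\<close>).

  Paracompactness and the countability of the set of components give countably many compact pieces of
  linear charts whose interiors cover the space. Extending the structure over one piece at a time
  never changes it on the pieces already treated, so the successive structures agree in the limit
  (\<open>exists_compatible_cover\<close>).
\<close>

section \<open>Maps of class C^r\<close>

lemma has_derivative_cong_open:
  assumes "open S" "x \<in> S" "\<And>y. y \<in> S \<Longrightarrow> f y = g y"
  shows "(f has_derivative D) (at x) \<longleftrightarrow> (g has_derivative D) (at x)"
proof
  show "(g has_derivative D) (at x)" if "(f has_derivative D) (at x)"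
    by (rule has_derivative_transform_within_open[OF that assms])
  show "(f has_derivative D) (at x)" if "(g has_derivative D) (at x)"
    by (rule has_derivative_transform_within_open[OF that assms(1,2)]) (simp add: assms(3))
qed

lemma Ck_on_cong:
  assumes "open S" "\<And>x. x \<in> S \<Longrightarrow> f x = g x"
  shows "Ck_on k f S \<longleftrightarrow> Ck_on k g S"
  using assms(2)
proof (induction k arbitrary: f g)
  case 0
  then show ?case by (simp cong: continuous_on_cong)
next
  case (Suc k)
  have D: "(f has_derivative D) (at x) \<longleftrightarrow> (g has_derivative D) (at x)" if "x \<in> S" for x D
    by (rule has_derivative_cong_open[OF assms(1) that]) (simp add: Suc.prems)
  have 1: "f differentiable (at x) \<longleftrightarrow> g differentiable (at x)" if "x \<in> S" for x
    unfolding differentiable_def using D[OF that] by blast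
  have 2: "frechet_derivative f (at x) = frechet_derivative g (at x)" if "x \<in> S" for x
    unfolding frechet_derivative_def D[OF that] ..
  have 3: "Ck_on k (\<lambda>x. frechet_derivative f (at x) v) S \<longleftrightarrow> Ck_on k (\<lambda>x. frechet_derivative g (at x) v) S" for v
    by (rule Suc.IH) (simp add: 2)
  show ?case unfolding Ck_on.simps using 1 3 by blast
qed

lemma Ck_on_subset: "Ck_on k f S \<Longrightarrow> T \<subseteq> S \<Longrightarrow> Ck_on k f T"
  by (induction k arbitrary: f) (auto intro: continuous_on_subset)

lemma Ck_on_SucD: "Ck_on (Suc k) f S \<Longrightarrow> Ck_on k f S"
proof (induction k arbitrary: f)
  case 0
  then show ?case
    by (auto intro!: continuous_at_imp_continuous_on differentiable_imp_continuous_within)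
qed auto

lemma Ck_on_mono: "Ck_on k f S \<Longrightarrow> j \<le> k \<Longrightarrow> Ck_on j f S"
  by (induction k) (auto simp: le_Suc_eq simp del: Ck_on.simps dest: Ck_on_SucD)

lemma Ck_on_has_derivative:
  "Ck_on (Suc k) f S \<Longrightarrow> x \<in> S \<Longrightarrow> (f has_derivative frechet_derivative f (at x)) (at x)"
  using frechet_derivative_works by auto

lemma Ck_on_SucI:
  assumes "open S" "\<And>x. x \<in> S \<Longrightarrow> (f has_derivative f' x) (at x)"
    and "\<And>v. Ck_on k (\<lambda>x. f' x v) S"
  shows "Ck_on (Suc k) f S"
proof -
  have "f' x = frechet_derivative f (at x)" if "x \<in> S" for x
    using frechet_derivative_at assms(2) that by blast
  then have "Ck_on k (\<lambda>x. frechet_derivative f (at x) v) S" for v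
    using Ck_on_cong[OF assms(1), of "\<lambda>x. f' x v" "\<lambda>x. frechet_derivative f (at x) v"] assms(3) by auto
  then show ?thesis using assms(2) by (auto simp: differentiable_def)
qed

lemma Ck_on_Union:
  assumes "\<And>T. T \<in> \<T> \<Longrightarrow> open T" "\<And>T. T \<in> \<T> \<Longrightarrow> Ck_on k f T"
  shows "Ck_on k f (\<Union>\<T>)"
  using assms(2)
proof (induction k arbitrary: f)
  case 0
  then show ?case using continuous_on_open_Union[of \<T> f] assms(1) by simp
qed auto

lemma Ck_on_const: "Ck_on k (\<lambda>x. c) S"
  by (induction k arbitrary: c) (auto simp: frechet_derivative_const)

lemma Ck_on_bounded_linear:
  assumes "bounded_linear L" shows "open S \<Longrightarrow> Ck_on k L S"
proof (induction k)
  case 0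
  then show ?case using assms by (simp add: linear_continuous_on)
next
  case (Suc k)
  show ?case
    by (rule Ck_on_SucI[of _ _ "\<lambda>x. L"])
      (use assms Suc in \<open>auto intro: bounded_linear_imp_has_derivative Ck_on_const\<close>)
qed

lemma Ck_on_linear_comp:
  assumes L: "bounded_linear L" and S: "open S"
  shows "Ck_on k f S \<Longrightarrow> Ck_on k (\<lambda>x. L (f x)) S"
proof (induction k arbitrary: f)
  case 0
  then show ?case using L by (simp add: bounded_linear.continuous_on)
next
  case (Suc k)
  show ?case
    by (rule Ck_on_SucI[OF S, of _ "\<lambda>x v. L (frechet_derivative f (at x) v)"])
      (use Suc Ck_on_has_derivative[OF Suc.prems] in \<open>auto intro!: bounded_linear.has_derivative[OF L]\<close>)
qed

lemma Ck_on_add: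
  assumes S: "open S"
  shows "Ck_on k f S \<Longrightarrow> Ck_on k g S \<Longrightarrow> Ck_on k (\<lambda>x. f x + g x) S"
proof (induction k arbitrary: f g)
  case 0
  then show ?case by (simp add: continuous_on_add)
next
  case (Suc k)
  show ?case
    by (rule Ck_on_SucI[OF S, of _ "\<lambda>x v. frechet_derivative f (at x) v + frechet_derivative g (at x) v"])
      (use Suc Ck_on_has_derivative[OF Suc.prems(1)] Ck_on_has_derivative[OF Suc.prems(2)] in
        \<open>auto intro: has_derivative_add\<close>)
qed

lemma Ck_on_scaleR:
  fixes p :: "'a::euclidean_space \<Rightarrow> real"
  assumes S: "open S"
  shows "Ck_on k p S \<Longrightarrow> Ck_on k f S \<Longrightarrow> Ck_on k (\<lambda>x. p x *\<^sub>R f x) S"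
proof (induction k arbitrary: p f)
  case 0
  then show ?case by (simp add: continuous_on_scaleR)
next
  case (Suc k)
  show ?case
    by (rule Ck_on_SucI[OF S, of _ "\<lambda>x v. p x *\<^sub>R frechet_derivative f (at x) v + frechet_derivative p (at x) v *\<^sub>R f x"])
      (use Suc Ck_on_has_derivative[OF Suc.prems(1)] Ck_on_has_derivative[OF Suc.prems(2)]
        Ck_on_SucD[OF Suc.prems(1)] Ck_on_SucD[OF Suc.prems(2)] in
        \<open>auto intro!: has_derivative_scaleR Ck_on_add[OF S]\<close>)
qed

lemma Ck_on_sum:
  assumes S: "open S"
  shows "(\<And>i. i \<in> I \<Longrightarrow> Ck_on k (f i) S) \<Longrightarrow> Ck_on k (\<lambda>x. \<Sum>i\<in>I. f i x) S"
  by (induction I rule: infinite_finite_induct) (auto intro: Ck_on_const Ck_on_add[OF S])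

lemma Ck_on_compose:
  assumes S: "open S" and T: "open T"
  shows "Ck_on k f S \<Longrightarrow> Ck_on k g T \<Longrightarrow> f ` S \<subseteq> T \<Longrightarrow> Ck_on k (\<lambda>x. g (f x)) S"
proof (induction k arbitrary: g)
  case 0
  then show ?case using continuous_on_compose2 by auto
next
  case (Suc k)
  note df = Ck_on_has_derivative[OF Suc.prems(1)] and dg = Ck_on_has_derivative[OF Suc.prems(2)]
  let ?Df = "\<lambda>x. frechet_derivative f (at x)" and ?Dg = "\<lambda>x. frechet_derivative g (at x)"
  have 1: "((\<lambda>x. g (f x)) has_derivative (\<lambda>v. \<Sum>b\<in>Basis. (?Df x v \<bullet> b) *\<^sub>R ?Dg (f x) b)) (at x)"
    if "x \<in> S" for x
  proof -
    have d: "(g has_derivative ?Dg (f x)) (at (f x))" using dg Suc.prems(3) that by blast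
    then have l: "linear (?Dg (f x))" by (simp add: has_derivative_bounded_linear bounded_linear.linear)
    have "?Dg (f x) (?Df x v) = (\<Sum>b\<in>Basis. (?Df x v \<bullet> b) *\<^sub>R ?Dg (f x) b)" for v
      by (subst euclidean_representation[symmetric, of "?Df x v"])
        (simp add: linear_sum[OF l] linear_cmul[OF l])
    then show ?thesis
      using has_derivative_compose[OF df[OF that] d] by simp
  qed
  have "Ck_on k (\<lambda>x. (?Df x v \<bullet> b) *\<^sub>R ?Dg (f x) b) S" for v b
  proof (rule Ck_on_scaleR[OF S])
    show "Ck_on k (\<lambda>x. ?Df x v \<bullet> b) S"
      using Ck_on_linear_comp[OF bounded_linear_inner_left S, of k "\<lambda>x. ?Df x v" b] Suc.prems(1) by auto
    show "Ck_on k (\<lambda>x. ?Dg (f x) b) S"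
      using Suc.IH[of "\<lambda>x. ?Dg x b"] Ck_on_SucD[OF Suc.prems(1)] Suc.prems by auto
  qed
  then show ?case
    by (intro Ck_on_SucI[OF S 1] Ck_on_sum[OF S])
qed

lemma Ck_on_componentwise:
  assumes S: "open S" and "\<And>b. b \<in> Basis \<Longrightarrow> Ck_on k (\<lambda>x. f x \<bullet> b) S"
  shows "Ck_on k f S"
proof -
  have "Ck_on k (\<lambda>x. \<Sum>b\<in>Basis. (f x \<bullet> b) *\<^sub>R b) S"
    by (intro Ck_on_sum[OF S] Ck_on_scaleR[OF S] Ck_on_const assms)
  then show ?thesis by (simp add: euclidean_representation)
qed

lemma Ck_on_vec:
  fixes f :: "'a::euclidean_space \<Rightarrow> real ^ 'n"
  assumes "open S" "\<And>i. Ck_on k (\<lambda>x. f x $ i) S"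
  shows "Ck_on k f S"
  by (rule Ck_on_componentwise[OF assms(1)]) (use assms(2) in \<open>auto simp: Basis_vec_def inner_axis\<close>)

lemma Ck_on_nth:
  fixes f :: "'a::euclidean_space \<Rightarrow> real ^ 'n"
  assumes "open S" "Ck_on k f S" shows "Ck_on k (\<lambda>x. f x $ i) S"
  using Ck_on_linear_comp[OF bounded_linear_vec_nth assms] .

lemma Ck_on_mult:
  fixes f g :: "'a::euclidean_space \<Rightarrow> real"
  assumes "open S" "Ck_on k f S" "Ck_on k g S" shows "Ck_on k (\<lambda>x. f x * g x) S"
  using Ck_on_scaleR[OF assms] by simp

lemma Ck_on_prod:
  fixes f :: "'i \<Rightarrow> 'a::euclidean_space \<Rightarrow> real"
  assumes S: "open S"
  shows "(\<And>i. i \<in> I \<Longrightarrow> Ck_on k (f i) S) \<Longrightarrow> Ck_on k (\<lambda>x. \<Prod>i\<in>I. f i x) S"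
  by (induction I rule: infinite_finite_induct) (auto intro: Ck_on_const Ck_on_mult[OF S])

lemma Ck_on_inverse_real: "Ck_on k (inverse :: real \<Rightarrow> real) (- {0})"
proof (induction k)
  case 0
  then show ?case by (auto intro!: continuous_intros)
next
  case (Suc k)
  have S: "open (- {0::real})" by (simp add: open_Compl)
  show ?case
  proof (rule Ck_on_SucI[OF S, of _ "\<lambda>x v. - (inverse x * v * inverse x)"])
    show "(inverse has_derivative (\<lambda>v. - (inverse x * v * inverse x))) (at x)" if "x \<in> - {0}" for x :: real
      using has_derivative_inverse'[of x UNIV] that by simp
    have "Ck_on k (\<lambda>x. (- v) * (inverse x * inverse x)) (- {0::real})" for v
      by (intro Ck_on_mult[OF S] Ck_on_const Suc)
    then show "Ck_on k (\<lambda>x. - (inverse x * v * inverse x)) (- {0::real})" for v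
      by (simp add: mult_ac)
  qed
qed

lemma Ck_on_divide:
  fixes f g :: "'a::euclidean_space \<Rightarrow> real"
  assumes "open S" "Ck_on k f S" "Ck_on k g S" "\<And>x. x \<in> S \<Longrightarrow> g x \<noteq> 0"
  shows "Ck_on k (\<lambda>x. f x / g x) S"
proof -
  have "Ck_on k (\<lambda>x. inverse (g x)) S"
    by (rule Ck_on_compose[OF assms(1) _ assms(3) Ck_on_inverse_real]) (use assms(4) in \<open>auto intro: open_Compl\<close>)
  then show ?thesis
    using Ck_on_mult[OF assms(1,2)] by (simp add: divide_inverse)
qed

lemma Ck_on_det:
  fixes A :: "'a::euclidean_space \<Rightarrow> real ^ 'n ^ 'n"
  assumes S: "open S" "\<And>i j. Ck_on k (\<lambda>x. A x $ i $ j) S"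
  shows "Ck_on k (\<lambda>x. det (A x)) S"
  unfolding det_def by (intro Ck_on_sum[OF S(1)] Ck_on_mult[OF S(1)] Ck_on_prod[OF S(1)] Ck_on_const S(2))

text \<open>
  The derivative of the inverse at \<open>y\<close> is the inverse of the matrix of the derivative of \<open>f\<close> at
  \<open>g y\<close>. By Cramer's rule its entries are rational functions of the entries of that matrix, so if
  \<open>g\<close> is of class C^j, then so is its derivative, and \<open>g\<close> is of class C^(j+1) as long as j < k.
\<close>

lemma Ck_on_inverse:
  fixes f :: "real ^ 'n \<Rightarrow> real ^ 'n"
  assumes S: "open S" "open T" and h: "homeomorphism S T f g" and f: "Ck_on k f S"
    and g: "\<And>y. y \<in> T \<Longrightarrow> g differentiable (at y)"
  shows "Ck_on k g T"
proof -
  have "j \<le> k \<Longrightarrow> Ck_on j g T" for j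
  proof (induction j)
    case 0
    then show ?case using h by (simp add: homeomorphism_def)
  next
    case (Suc j)
    then obtain k' where k: "k = Suc k'" "j \<le> k'" by (metis Suc_le_D Suc_le_mono)
    have gj: "Ck_on j g T" using Suc by simp
    let ?Df = "\<lambda>x. frechet_derivative f (at x)" and ?Dg = "\<lambda>x. frechet_derivative g (at x)"
    have df: "(f has_derivative ?Df x) (at x)" if "x \<in> S" for x
      using f k Ck_on_has_derivative that by blast
    have dg: "(g has_derivative ?Dg y) (at y)" if "y \<in> T" for y
      using g that frechet_derivative_works by blast
    have gT: "g y \<in> S" and fg: "f (g y) = y" if "y \<in> T" for y
      using h that by (auto simp: homeomorphism_def)
    define A where "A y = matrix (?Df (g y))" for y
    have A: "A y *v (?Dg y v) = v" "det (A y) \<noteq> 0" if "y \<in> T" for y v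
    proof -
      have l: "linear (?Df (g y))" "linear (?Dg y)"
        using df[OF gT[OF that]] dg[OF that] by (simp_all add: has_derivative_bounded_linear bounded_linear.linear)
      have "((\<lambda>y. f (g y)) has_derivative (\<lambda>v. ?Df (g y) (?Dg y v))) (at y)"
        using has_derivative_compose[OF dg[OF that] df[OF gT[OF that]]] .
      then have "((\<lambda>y. y) has_derivative (\<lambda>v. ?Df (g y) (?Dg y v))) (at y)"
        by (subst has_derivative_cong_open[OF S(2) that]) (auto simp: fg)
      then have *: "?Df (g y) (?Dg y v) = v" for v
        by (metis has_derivative_ident has_derivative_unique)
      then show "A y *v (?Dg y v) = v" using l by (simp add: A_def)
      have "A y ** matrix (?Dg y) = mat 1"
        unfolding A_def using l * by (simp add: matrix_compose[symmetric] o_def matrix_id_mat_1[unfolded id_def])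
      then show "det (A y) \<noteq> 0"
        by (metis det_I det_mul mult_zero_left zero_neq_one)
    qed
    have Aj: "Ck_on j (\<lambda>y. A y $ i $ l) T" for i l
    proof -
      have "Ck_on k' (\<lambda>x. ?Df x (axis l 1)) S" using f k by simp
      then have "Ck_on j (\<lambda>x. ?Df x (axis l 1)) S" using k Ck_on_mono by blast
      from Ck_on_nth[OF S(2) Ck_on_compose[OF S(2,1) gj this]] gT
      show ?thesis by (auto simp: A_def matrix_def)
    qed
    have "Ck_on j (\<lambda>y. ?Dg y v) T" for v
    proof (rule Ck_on_vec[OF S(2)])
      fix i
      have eq: "?Dg y v $ i = det (\<chi> a b. if b = i then v $ a else A y $ a $ b) / det (A y)" if "y \<in> T" for y
      proof -
        have "?Dg y v = (\<chi> k. det (\<chi> a b. if b = k then v $ a else A y $ a $ b) / det (A y))"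
          using cramer[OF A(2)[OF that], of "?Dg y v" v] A(1)[OF that, of v] by blast
        from arg_cong[OF this, of "\<lambda>w. w $ i"] show ?thesis by simp
      qed
      have e: "Ck_on j (\<lambda>y. if b = i then v $ a else A y $ a $ b) T" for a b
        by (cases "b = i") (auto intro: Aj Ck_on_const)
      have "Ck_on j (\<lambda>y. det (\<chi> a b. if b = i then v $ a else A y $ a $ b) / det (A y)) T"
        by (intro Ck_on_divide[OF S(2)] Ck_on_det[OF S(2)]) (use Aj A e in auto)
      then show "Ck_on j (\<lambda>y. ?Dg y v $ i) T"
        by (subst Ck_on_cong[OF S(2) eq])
    qed
    then show ?case by (intro Ck_on_SucI[OF S(2) dg])
  qed
  then show ?thesis by blast
qed

lemma Cr_on_cong:
  "open S \<Longrightarrow> (\<And>x. x \<in> S \<Longrightarrow> f x = g x) \<Longrightarrow> Cr_on r f S \<longleftrightarrow> Cr_on r g S"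
  unfolding Cr_on_def by (simp add: Ck_on_cong[of S f g])

lemma Cr_on_subset: "Cr_on r f S \<Longrightarrow> T \<subseteq> S \<Longrightarrow> Cr_on r f T"
  unfolding Cr_on_def using Ck_on_subset by blast

lemma Cr_on_mono: "Cr_on s f S \<Longrightarrow> r \<le> s \<Longrightarrow> Cr_on r f S"
  unfolding Cr_on_def using order_trans by blast

lemma Cr_on_Union:
  "(\<And>T. T \<in> \<T> \<Longrightarrow> open T) \<Longrightarrow> (\<And>T. T \<in> \<T> \<Longrightarrow> Cr_on r f T) \<Longrightarrow> Cr_on r f (\<Union>\<T>)"
  unfolding Cr_on_def by (simp add: Ck_on_Union)

lemma Cr_on_local:
  assumes "\<And>x. x \<in> S \<Longrightarrow> \<exists>T. open T \<and> x \<in> T \<and> Cr_on r f T"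
  shows "Cr_on r f S"
proof -
  have "Cr_on r f (\<Union>{T. open T \<and> Cr_on r f T})" by (rule Cr_on_Union) auto
  then show ?thesis by (rule Cr_on_subset) (use assms in blast)
qed

lemma Cr_on_Un: "open S \<Longrightarrow> open T \<Longrightarrow> Cr_on r f S \<Longrightarrow> Cr_on r f T \<Longrightarrow> Cr_on r f (S \<union> T)"
  by (rule Cr_on_local) auto

lemma Cr_on_const: "Cr_on r (\<lambda>x. c) S"
  by (simp add: Cr_on_def Ck_on_const)

lemma Cr_on_linear: "linear L \<Longrightarrow> open S \<Longrightarrow> Cr_on r L S"
  by (simp add: Cr_on_def Ck_on_bounded_linear linear_conv_bounded_linear)

lemma Cr_on_id: "open S \<Longrightarrow> Cr_on r (\<lambda>x. x) S"
  by (rule Cr_on_linear) (auto simp: linear_id[unfolded id_def])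

lemma Cr_on_add: "open S \<Longrightarrow> Cr_on r f S \<Longrightarrow> Cr_on r g S \<Longrightarrow> Cr_on r (\<lambda>x. f x + g x) S"
  by (simp add: Cr_on_def Ck_on_add)

lemma Cr_on_scaleR:
  "open S \<Longrightarrow> Cr_on r p S \<Longrightarrow> Cr_on r f S \<Longrightarrow> Cr_on r (\<lambda>x. p x *\<^sub>R f x) S"
  by (simp add: Cr_on_def Ck_on_scaleR)

lemma Cr_on_diff: "open S \<Longrightarrow> Cr_on r f S \<Longrightarrow> Cr_on r g S \<Longrightarrow> Cr_on r (\<lambda>x. f x - g x) S"
  using Cr_on_add[of S r f "\<lambda>x. (-1) *\<^sub>R g x"] Cr_on_scaleR[of S r "\<lambda>_. -1" g]
    Cr_on_const[of r "-1::real" S]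
  by simp

lemma Cr_on_sum:
  "open S \<Longrightarrow> (\<And>i. i \<in> I \<Longrightarrow> Cr_on r (f i) S) \<Longrightarrow> Cr_on r (\<lambda>x. \<Sum>i\<in>I. f i x) S"
  by (simp add: Cr_on_def Ck_on_sum)

lemma Cr_on_compose:
  "Cr_on r f S \<Longrightarrow> Cr_on r g T \<Longrightarrow> open S \<Longrightarrow> open T \<Longrightarrow> f ` S \<subseteq> T \<Longrightarrow> Cr_on r (\<lambda>x. g (f x)) S"
  unfolding Cr_on_def using Ck_on_compose by blast

lemma Cr_on_linear_comp:
  "linear L \<Longrightarrow> open S \<Longrightarrow> Cr_on r f S \<Longrightarrow> Cr_on r (\<lambda>x. L (f x)) S"
  by (simp add: Cr_on_def Ck_on_linear_comp linear_conv_bounded_linear)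

lemma Cr_on_divide:
  fixes f g :: "'a::euclidean_space \<Rightarrow> real"
  shows "open S \<Longrightarrow> Cr_on r f S \<Longrightarrow> Cr_on r g S \<Longrightarrow> (\<And>x. x \<in> S \<Longrightarrow> g x \<noteq> 0) \<Longrightarrow> Cr_on r (\<lambda>x. f x / g x) S"
  by (simp add: Cr_on_def Ck_on_divide)

lemma Cr_on_continuous: "Cr_on r f S \<Longrightarrow> continuous_on S f"
  unfolding Cr_on_def by (metis Ck_on.simps(1) zero_enat_def zero_le)

lemma Cr_on_has_derivative:
  "Cr_on r f S \<Longrightarrow> 1 \<le> r \<Longrightarrow> x \<in> S \<Longrightarrow> (f has_derivative frechet_derivative f (at x)) (at x)"
  unfolding Cr_on_def using Ck_on_has_derivative[of 0 f S x] by (metis One_nat_def one_enat_def)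

lemma Cr_on_frechet_continuous:
  "Cr_on r f S \<Longrightarrow> 1 \<le> r \<Longrightarrow> continuous_on S (\<lambda>x. frechet_derivative f (at x) v)"
  unfolding Cr_on_def by (metis Ck_on.simps One_nat_def one_enat_def)

text \<open>
  Global injectivity is assumed, so invariance of domain already gives an open image and a continuous
  inverse; the derivative only enters to make the inverse differentiable.
\<close>

lemma Cr_on_inverse:
  fixes f :: "real ^ 'n \<Rightarrow> real ^ 'n"
  assumes "open S" "Cr_on s f S" "1 \<le> s" "inj_on f S"
    and inj: "\<And>x v. x \<in> S \<Longrightarrow> frechet_derivative f (at x) v = 0 \<Longrightarrow> v = 0"
  shows "open (f ` S)" "homeomorphism S (f ` S) f (inv_into S f)" "Cr_on s (inv_into S f) (f ` S)"
proof -
  have c: "continuous_on S f" using assms(2) by (rule Cr_on_continuous)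
  show o: "open (f ` S)" using invariance_of_domain[OF c assms(1,4)] .
  have "continuous_on (f ` S) (inv_into S f)"
    using continuous_on_inverse_open[OF assms(1) c, of "inv_into S f"] assms(4) by simp
  then show h: "homeomorphism S (f ` S) f (inv_into S f)"
    using c assms(4) by (auto simp: homeomorphism_def inv_into_f_f inv_into_into f_inv_into_f image_comp)
  have d: "inv_into S f differentiable (at y)" if y: "y \<in> f ` S" for y
  proof -
    obtain x where x: "x \<in> S" "y = f x" using y by blast
    let ?D = "frechet_derivative f (at x)"
    have D: "(f has_derivative ?D) (at x)" using Cr_on_has_derivative assms x by blast
    then have l: "linear ?D" by (simp add: has_derivative_bounded_linear bounded_linear.linear)
    then have "inj ?D" using inj[OF x(1)] by (simp add: linear_injective_0)
    from linear_injective_isomorphism[OF l this] obtain D' where "\<forall>x. ?D (D' x) = x"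
      by blast
    then have D': "?D \<circ> D' = id" by (simp add: fun_eq_iff)
    have "(inv_into S f has_derivative D') (at (f x))"
      by (rule has_derivative_inverse_strong[OF assms(1) x(1) c _ D D']) (simp add: assms(4))
    then show ?thesis unfolding differentiable_def x(2) by blast
  qed
  show "Cr_on s (inv_into S f) (f ` S)"
    using assms(2) unfolding Cr_on_def by (metis Ck_on_inverse[OF assms(1) o h _ d])
qed

lemma Cr_on_mult:
  fixes f g :: "'a::euclidean_space \<Rightarrow> real"
  shows "open S \<Longrightarrow> Cr_on r f S \<Longrightarrow> Cr_on r g S \<Longrightarrow> Cr_on r (\<lambda>x. f x * g x) S"
  by (simp add: Cr_on_def Ck_on_mult)

lemma Cr_on_frechet: "Cr_on \<infinity> f S \<Longrightarrow> Cr_on \<infinity> (\<lambda>x. frechet_derivative f (at x) v) S"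
  unfolding Cr_on_def by (metis Ck_on.simps(2) enat_ord_code(3))

lemma Cr_on_transform:
  "Cr_on s f S \<Longrightarrow> open S \<Longrightarrow> (\<And>x. x \<in> S \<Longrightarrow> g x = f x) \<Longrightarrow> Cr_on s g S"
  using Cr_on_cong[of S g f s] by blast

lemma Cr_on_empty: "Cr_on s f {}"
  by (rule Cr_on_local) auto

lemma Cr_diffeomorphism_mono: "Cr_diffeomorphism s S T f \<Longrightarrow> r \<le> s \<Longrightarrow> Cr_diffeomorphism r S T f"
  unfolding Cr_diffeomorphism_def using Cr_on_mono by blast

lemma Cr_embedding_iff:
  assumes S: "open S"
  shows "Cr_embedding s S T f \<longleftrightarrow>
    f ` S \<subseteq> T \<and> inj_on f S \<and> Cr_on s f S \<and> open (f ` S) \<and> Cr_on s (inv_into S f) (f ` S)"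
proof
  assume "Cr_embedding s S T f"
  then obtain g where f: "f ` S \<subseteq> T" "open (f ` S)" "homeomorphism S (f ` S) f g" "Cr_on s f S" "Cr_on s g (f ` S)"
    by (auto simp: Cr_embedding_def Cr_diffeomorphism_def)
  have gf: "g (f x) = x" if "x \<in> S" for x using f(3) that by (simp add: homeomorphism_def)
  then have inj: "inj_on f S" by (rule inj_on_inverseI)
  have "inv_into S f y = g y" if "y \<in> f ` S" for y using that gf inj by auto
  then have "Cr_on s (inv_into S f) (f ` S)" using Cr_on_transform[OF f(5,2)] by blast
  then show "f ` S \<subseteq> T \<and> inj_on f S \<and> Cr_on s f S \<and> open (f ` S) \<and> Cr_on s (inv_into S f) (f ` S)"
    using f inj by blast
next
  assume f: "f ` S \<subseteq> T \<and> inj_on f S \<and> Cr_on s f S \<and> open (f ` S) \<and> Cr_on s (inv_into S f) (f ` S)"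
  then have "homeomorphism S (f ` S) f (inv_into S f)"
    by (auto intro!: homeomorphismI Cr_on_continuous simp: inv_into_into f_inv_into_f)
  then show "Cr_embedding s S T f" using f by (auto simp: Cr_embedding_def Cr_diffeomorphism_def)
qed

lemma Cr_embeddingI:
  assumes "open P" "Cr_on s f P" "f ` P \<subseteq> T" "open (f ` P)" "Cr_on s k (f ` P)" "\<And>z. z \<in> P \<Longrightarrow> k (f z) = z"
  shows "Cr_embedding s P T f"
proof -
  have inj: "inj_on f P" using assms(6) by (rule inj_on_inverseI)
  then have "inv_into P f y = k y" if "y \<in> f ` P" for y using assms(6) that by auto
  then have "Cr_on s (inv_into P f) (f ` P)" using Cr_on_transform[OF assms(5,4)] by blast
  then show ?thesis unfolding Cr_embedding_iff[OF assms(1)] using assms inj by blast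
qed

lemma Cr_embedding_mono: "Cr_embedding s S T f \<Longrightarrow> r \<le> s \<Longrightarrow> Cr_embedding r S T f"
  unfolding Cr_embedding_def using Cr_diffeomorphism_mono by blast

text \<open>
  The inverse is C^1, so the chain rule makes the derivative of \<open>f\<close> injective, and then the inverse
  is as smooth as \<open>f\<close>. A C^r-diffeomorphism of class C^s is therefore a C^s-diffeomorphism.
\<close>

lemma inverse_smooth_upgrade:
  fixes f :: "real^'n \<Rightarrow> real^'n"
  assumes S: "open S" and f: "Cr_on s f S" "1 \<le> s" and k: "open (f ` S)" "Cr_on r k (f ` S)" "1 \<le> r"
    "\<And>x. x \<in> S \<Longrightarrow> k (f x) = x"
  shows "Cr_on s k (f ` S)"
proof -
  have inj: "inj_on f S" using k(4) by (rule inj_on_inverseI)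
  have "v = 0" if x: "x \<in> S" and v: "frechet_derivative f (at x) v = 0" for x v
  proof -
    have "((\<lambda>x. k (f x)) has_derivative (\<lambda>v. frechet_derivative k (at (f x)) (frechet_derivative f (at x) v))) (at x)"
      using has_derivative_compose[OF Cr_on_has_derivative[OF f x] Cr_on_has_derivative[OF k(2,3), of "f x"]] x by simp
    then have "((\<lambda>x. x) has_derivative (\<lambda>v. frechet_derivative k (at (f x)) (frechet_derivative f (at x) v))) (at x)"
      by (rule has_derivative_transform_within_open[OF _ S x]) (rule k(4))
    from frechet_derivative_at[OF this] frechet_derivative_at[OF has_derivative_ident[of "at x"]]
    have "frechet_derivative k (at (f x)) (frechet_derivative f (at x) v) = v" by metis
    moreover have "linear (frechet_derivative k (at (f x)))"
      using Cr_on_has_derivative[OF k(2,3), of "f x"] x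
      by (simp add: has_derivative_bounded_linear bounded_linear.linear)
    ultimately show ?thesis using v linear_0 by metis
  qed
  then have "Cr_on s (inv_into S f) (f ` S)" using Cr_on_inverse(3)[OF S f inj] by blast
  then show ?thesis by (rule Cr_on_transform[OF _ k(1)]) (use k(4) inj in auto)
qed

section \<open>Bump functions and smooth approximation\<close>

lemma linear_bound_Basis:
  fixes L :: "'a::euclidean_space \<Rightarrow> 'b::real_normed_vector"
  assumes L: "linear L" and b: "\<And>b. b \<in> Basis \<Longrightarrow> norm (L b) \<le> e / real DIM('a)"
  shows "norm (L v) \<le> e * norm v"
proof -
  have "L v = (\<Sum>b\<in>Basis. (v \<bullet> b) *\<^sub>R L b)"
    by (subst euclidean_representation[symmetric, of v]) (simp add: linear_sum[OF L] linear_cmul[OF L])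
  also have "norm \<dots> \<le> (\<Sum>b\<in>(Basis::'a set). norm v * (e / real DIM('a)))"
    by (rule sum_norm_le) (use b Basis_le_norm in \<open>auto simp del: times_divide_eq_right intro!: mult_mono\<close>)
  also have "\<dots> = e * norm v" by simp
  finally show ?thesis .
qed

text \<open>
  The family in \<open>m\<close> is closed under differentiation up to linear combinations, which turns the
  smoothness of \<open>exp (-1/x)\<close> into a simple induction.
\<close>

definition flat_exp :: "nat \<Rightarrow> real \<Rightarrow> real" where
  "flat_exp m x = (if x > 0 then exp (- inverse x) / x ^ m else 0)"

lemma flat_exp_nonneg: "0 \<le> flat_exp m x"
  by (simp add: flat_exp_def)

lemma flat_exp_pos_iff: "0 < flat_exp m x \<longleftrightarrow> 0 < x"
  by (simp add: flat_exp_def)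

lemma flat_exp_tendsto_0: "(flat_exp m \<longlongrightarrow> 0) (at 0)"
proof -
  have "((\<lambda>x. inverse x ^ m / exp (inverse x)) \<longlongrightarrow> 0) (at_right (0::real))"
    using filterlim_compose[OF tendsto_power_div_exp_0 filterlim_inverse_at_top_right] .
  then have "(flat_exp m \<longlongrightarrow> 0) (at_right 0)"
    by (rule Lim_transform_eventually)
      (auto simp: eventually_at_filter flat_exp_def exp_minus field_simps power_inverse)
  moreover have "(flat_exp m \<longlongrightarrow> 0) (at_left 0)"
    by (rule Lim_transform_eventually[OF tendsto_const]) (auto simp: eventually_at_filter flat_exp_def)
  ultimately show ?thesis by (simp add: filterlim_split_at)
qed

lemma flat_exp_deriv:
  "(flat_exp m has_real_derivative (flat_exp (m + 2) x - m * flat_exp (m + 1) x)) (at x)"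
proof (cases x "0::real" rule: linorder_cases)
  case less
  have "((\<lambda>x. 0) has_real_derivative 0) (at x)" by simp
  then have "(flat_exp m has_real_derivative 0) (at x)"
    by (rule has_field_derivative_transform_within_open[of _ _ _ "{..<0}"]) (use less in \<open>auto simp: flat_exp_def\<close>)
  then show ?thesis using less by (simp add: flat_exp_def)
next
  case equal
  have "((\<lambda>h. (flat_exp m (0 + h) - flat_exp m 0) / h) \<longlongrightarrow> 0) (at 0)"
    by (rule Lim_transform_eventually[OF flat_exp_tendsto_0[of "m + 1"]])
      (auto simp: eventually_at_filter flat_exp_def)
  then show ?thesis using equal by (simp add: DERIV_def flat_exp_def)
next
  case greater
  have 1: "((\<lambda>x. exp (- inverse x)) has_real_derivative exp (- inverse x) * inverse (x\<^sup>2)) (at x)"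
    using greater by (auto intro!: derivative_eq_intros simp: power2_eq_square)
  have 2: "((\<lambda>x. inverse (x ^ m)) has_real_derivative - (m * inverse (x ^ (m + 1)))) (at x)"
  proof (cases m)
    case (Suc j)
    have "((\<lambda>x. x ^ m) has_real_derivative m * x ^ j) (at x)"
      using DERIV_pow[of m x] Suc by simp
    from DERIV_inverse_fun[OF this] show ?thesis
      by (rule DERIV_cong) (use greater Suc in \<open>simp_all add: field_simps\<close>)
  qed simp
  have "((\<lambda>x. exp (- inverse x) * inverse (x ^ m)) has_real_derivative
     (exp (- inverse x) / x ^ (m + 2) - m * (exp (- inverse x) / x ^ (m + 1)))) (at x)"
    by (rule DERIV_cong[OF DERIV_mult[OF 1 2]])
      (use greater in \<open>simp add: field_simps power2_eq_square\<close>)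
  then have "(flat_exp m has_real_derivative
     (exp (- inverse x) / x ^ (m + 2) - m * (exp (- inverse x) / x ^ (m + 1)))) (at x)"
    by (rule has_field_derivative_transform_within_open[of _ _ _ "{0<..}"])
      (use greater in \<open>auto simp: flat_exp_def divide_inverse\<close>)
  then show ?thesis using greater by (simp add: flat_exp_def)
qed

lemma Ck_on_flat_exp: "Ck_on k (flat_exp m) UNIV"
proof (induction k arbitrary: m)
  case 0
  show ?case
    using flat_exp_deriv by (auto intro!: continuous_at_imp_continuous_on DERIV_isCont)
next
  case (Suc k)
  show ?case
  proof (rule Ck_on_SucI[of _ _ "\<lambda>x v. (flat_exp (m + 2) x - m * flat_exp (m + 1) x) * v"])
    show "(flat_exp m has_derivative (\<lambda>v. (flat_exp (m + 2) x - m * flat_exp (m + 1) x) * v)) (at x)" for x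
      using flat_exp_deriv[of m x] by (simp add: has_field_derivative_def)
    have "Ck_on k (\<lambda>x. v * flat_exp (m + 2) x + (- m * v) * flat_exp (m + 1) x) UNIV" for v :: real
      by (intro Ck_on_add Ck_on_mult Ck_on_const Suc) auto
    then show "Ck_on k (\<lambda>x. (flat_exp (m + 2) x - m * flat_exp (m + 1) x) * v) UNIV" for v
      by (simp add: algebra_simps)
  qed simp
qed

lemma Cr_on_flat_exp: "Cr_on s (flat_exp m) UNIV"
  by (simp add: Cr_on_def Ck_on_flat_exp)

lemma Cr_on_norm_square: "Cr_on s (\<lambda>x::'a::euclidean_space. (norm (x - c))\<^sup>2) UNIV"
proof -
  have "Cr_on s (\<lambda>x::'a. (x - c) \<bullet> b) UNIV" for b
    using Cr_on_linear_comp[of "\<lambda>y. y \<bullet> b" UNIV s "\<lambda>x. x - c"]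
      Cr_on_diff[OF open_UNIV Cr_on_id[OF open_UNIV] Cr_on_const, of s c]
    by (simp add: bounded_linear_inner_left bounded_linear.linear)
  then have "Cr_on s (\<lambda>x::'a. \<Sum>b\<in>Basis. ((x - c) \<bullet> b) * ((x - c) \<bullet> b)) UNIV"
    by (intro Cr_on_sum Cr_on_mult) auto
  then show ?thesis by (simp add: power2_norm_eq_inner euclidean_inner[symmetric])
qed

lemma smooth_step:
  obtains h :: "real \<Rightarrow> real" where "\<And>s. Cr_on s h UNIV" "\<And>t. t \<le> 0 \<Longrightarrow> h t = 0"
    "\<And>t. 1 \<le> t \<Longrightarrow> h t = 1" "\<And>t. 0 \<le> h t" "\<And>t. h t \<le> 1"
proof
  let ?d = "\<lambda>t. flat_exp 0 t + flat_exp 0 (1 - t)"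
  let ?h = "\<lambda>t. flat_exp 0 t / ?d t"
  have pos: "0 < ?d t" for t
    using flat_exp_pos_iff[of 0 t] flat_exp_pos_iff[of 0 "1 - t"] flat_exp_nonneg[of 0 t]
      flat_exp_nonneg[of 0 "1 - t"] by (cases "t > 0") auto
  have "Cr_on s (\<lambda>t. flat_exp 0 (1 - t)) UNIV" for s
    by (rule Cr_on_compose[OF Cr_on_diff[OF _ Cr_on_const Cr_on_id] Cr_on_flat_exp]) auto
  then show "Cr_on s ?h UNIV" for s
    by (intro Cr_on_divide Cr_on_add Cr_on_flat_exp) (use less_imp_neq[OF pos] in force)+
  show "?h t = 0" if "t \<le> 0" for t using that by (simp add: flat_exp_def)
  show "?h t = 1" if "1 \<le> t" for t using that by (simp add: flat_exp_def)
  show "0 \<le> ?h t" for t by (simp add: flat_exp_nonneg)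
  show "?h t \<le> 1" for t using pos[of t] flat_exp_nonneg[of 0 "1 - t"] by (simp add: divide_le_eq_1_pos)
qed

text \<open>
  A sum of bumps at the centres of a finite cover of \<open>K\<close> by balls is positive on \<open>K\<close>, hence bounded
  below there; a smooth step function makes it constant where it exceeds half that bound.
\<close>

lemma smooth_bump:
  fixes K U :: "'a::euclidean_space set"
  assumes K: "compact K" and U: "open U" "K \<subseteq> U"
  obtains \<zeta> :: "'a \<Rightarrow> real" and W P where "\<And>s. Cr_on s \<zeta> UNIV" "open W" "K \<subseteq> W" "W \<subseteq> P" "compact P" "P \<subseteq> U"
    "\<And>x. x \<in> W \<Longrightarrow> \<zeta> x = 1" "\<And>x. x \<notin> P \<Longrightarrow> \<zeta> x = 0" "\<And>x. 0 \<le> \<zeta> x" "\<And>x. \<zeta> x \<le> 1"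
proof (cases "K = {}")
  case True
  show ?thesis by (rule that[of "\<lambda>x. 0" "{}" "{}"]) (use True in \<open>auto simp: Cr_on_const\<close>)
next
  case False
  have "\<forall>c\<in>K. \<exists>r>0. cball c r \<subseteq> U" using U open_contains_cball by blast
  then obtain r where r: "\<And>c. c \<in> K \<Longrightarrow> r c > 0" "\<And>c. c \<in> K \<Longrightarrow> cball c (r c) \<subseteq> U" by metis
  obtain C where C: "C \<subseteq> K" "finite C" "K \<subseteq> (\<Union>c\<in>C. ball c (r c))"
    by (rule compactE_image[OF K, of K "\<lambda>c. ball c (r c)"]) (use r in auto)
  define P where "P = (\<Union>c\<in>C. cball c (r c))"
  define \<psi> where "\<psi> x = (\<Sum>c\<in>C. flat_exp 0 ((r c)\<^sup>2 - (norm (x - c))\<^sup>2))" for x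
  have \<psi>: "Cr_on s \<psi> UNIV" for s
    unfolding \<psi>_def
    by (intro Cr_on_sum Cr_on_compose[OF Cr_on_diff[OF _ Cr_on_const Cr_on_norm_square] Cr_on_flat_exp]) auto
  have nn: "0 \<le> \<psi> x" for x by (simp add: \<psi>_def sum_nonneg flat_exp_nonneg)
  have pos: "0 < \<psi> x" if x: "x \<in> K" for x
  proof -
    obtain c where c: "c \<in> C" "x \<in> ball c (r c)" using C x by blast
    then have "norm (x - c) < r c" by (simp add: dist_norm norm_minus_commute)
    then have "(norm (x - c))\<^sup>2 < (r c)\<^sup>2" by (simp add: power_strict_mono)
    then show ?thesis unfolding \<psi>_def
      by (intro sum_pos2[OF C(2) c(1)]) (auto simp: flat_exp_pos_iff flat_exp_nonneg)
  qed
  have zero: "\<psi> x = 0" if "x \<notin> P" for x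
  proof -
    have "(r c)\<^sup>2 \<le> (norm (x - c))\<^sup>2" if "c \<in> C" for c
      using that \<open>x \<notin> P\<close> r(1)[of c] C(1)
      by (intro power_mono) (auto simp: P_def dist_norm norm_minus_commute)
    then show ?thesis by (auto simp: \<psi>_def flat_exp_def not_less[symmetric] intro!: sum.neutral)
  qed
  have cont: "continuous_on UNIV \<psi>" using \<psi>[of 0] by (rule Cr_on_continuous)
  obtain x0 where x0: "x0 \<in> K" "\<And>x. x \<in> K \<Longrightarrow> \<psi> x0 \<le> \<psi> x"
    using continuous_attains_inf[OF K False, of \<psi>] continuous_on_subset[OF cont] by blast
  define m where "m = \<psi> x0 / 2"
  have m: "m > 0" "\<And>x. x \<in> K \<Longrightarrow> m < \<psi> x"
    using pos[OF x0(1)] x0(2) by (force simp: m_def)+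
  obtain h :: "real \<Rightarrow> real" where h: "\<And>s. Cr_on s h UNIV" "\<And>t. t \<le> 0 \<Longrightarrow> h t = 0"
    "\<And>t. 1 \<le> t \<Longrightarrow> h t = 1" "\<And>t. 0 \<le> h t" "\<And>t. h t \<le> 1"
    using smooth_step by blast
  show ?thesis
  proof (rule that[of "\<lambda>x. h (\<psi> x / m)" "{x. m < \<psi> x}" P])
    show "Cr_on s (\<lambda>x. h (\<psi> x / m)) UNIV" for s
      by (rule Cr_on_compose[OF Cr_on_divide[OF _ \<psi> Cr_on_const] h(1)]) (use m in auto)
    show "open {x. m < \<psi> x}" using cont by (intro open_Collect_less) auto
    show "K \<subseteq> {x. m < \<psi> x}" using m by auto
    show "{x. m < \<psi> x} \<subseteq> P" using zero m by fastforce
    show "compact P" using C by (auto simp: P_def)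
    show "P \<subseteq> U" unfolding P_def using C(1) r(2) by blast
  qed (use zero m h in auto)
qed

text \<open>
  Differentiating under the integral sign moves the derivative to the kernel and gives an integral of
  the same kind.
\<close>

lemma Ck_on_convolution:
  fixes \<kappa> :: "'a::euclidean_space \<Rightarrow> real" and F :: "'a \<Rightarrow> 'b::euclidean_space"
  assumes F: "continuous_on (cbox a b) F"
  shows "Cr_on \<infinity> \<kappa> UNIV \<Longrightarrow> Ck_on k (\<lambda>x. integral (cbox a b) (\<lambda>z. \<kappa> (x - z) *\<^sub>R F z)) UNIV"
proof (induction k arbitrary: \<kappa>)
  case 0
  have c: "continuous_on UNIV \<kappa>" using Cr_on_continuous[OF 0] .
  have "continuous_on UNIV (\<lambda>x. integral (cbox a b) (\<lambda>z. \<kappa> (x - z) *\<^sub>R F z))"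
    by (rule integral_continuous_on_param)
      (auto simp: split_beta intro!: continuous_intros continuous_on_compose2[OF c] continuous_on_compose2[OF F])
  then show ?case by simp
next
  case (Suc k)
  let ?D = "\<lambda>x. frechet_derivative \<kappa> (at x)"
  have D: "(\<kappa> has_derivative ?D x) (at x)" for x
    using Cr_on_has_derivative[OF Suc.prems] by simp
  have Dc: "continuous_on UNIV (\<lambda>x. ?D x v)" for v
    using Cr_on_continuous[OF Cr_on_frechet[OF Suc.prems]] .
  have c: "continuous_on UNIV \<kappa>" using Cr_on_continuous[OF Suc.prems] .
  define B where "B x z = Blinfun (\<lambda>v. ?D (x - z) v *\<^sub>R F z)" for x z
  have B: "blinfun_apply (B x z) = (\<lambda>v. ?D (x - z) v *\<^sub>R F z)" for x z
    unfolding B_def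
    by (intro bounded_linear_Blinfun_apply bounded_linear_scaleR_const has_derivative_bounded_linear[OF D])
  have Bc: "continuous_on (UNIV \<times> cbox a b) (\<lambda>(x, z). B x z)"
    by (rule continuous_on_blinfun_componentwise)
      (auto simp: split_beta B intro!: continuous_intros continuous_on_compose2[OF Dc] continuous_on_compose2[OF F])
  show ?case
  proof (rule Ck_on_SucI[OF open_UNIV, of _ "\<lambda>x v. integral (cbox a b) (\<lambda>z. ?D (x - z) v *\<^sub>R F z)"])
    fix x :: 'a
    have d: "((\<lambda>x. \<kappa> (x - z) *\<^sub>R F z) has_derivative blinfun_apply (B x z)) (at x within UNIV)" for x z
    proof -
      have "((\<lambda>x. x - z) has_derivative (\<lambda>v. v)) (at x)" by (auto intro!: derivative_eq_intros)
      from has_derivative_compose[OF this D]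
      have "((\<lambda>x. \<kappa> (x - z)) has_derivative ?D (x - z)) (at x)" .
      from has_derivative_scaleR_left[OF this, of "F z"] show ?thesis by (simp add: B)
    qed
    have "((\<lambda>x. integral (cbox a b) (\<lambda>z. \<kappa> (x - z) *\<^sub>R F z)) has_derivative blinfun_apply (integral (cbox a b) (B x)))
      (at x within UNIV)"
      by (rule leibniz_rule[OF d _ Bc])
        (auto intro!: integrable_continuous continuous_intros continuous_on_compose2[OF c] continuous_on_compose2[OF F])
    moreover have Bint: "B x integrable_on cbox a b"
    proof (rule integrable_continuous)
      show "continuous_on (cbox a b) (B x)"
        unfolding B_def Blinfun_inverse
        by (rule continuous_on_blinfun_componentwise)
          (auto simp: B[unfolded B_def] intro!: continuous_intros continuous_on_compose2[OF Dc] continuous_on_compose2[OF F])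
    qed
    moreover from Bint have "blinfun_apply (integral (cbox a b) (B x)) =
      (\<lambda>v. integral (cbox a b) (\<lambda>z. ?D (x - z) v *\<^sub>R F z))"
      by (simp add: blinfun_apply_integral B fun_eq_iff)
    ultimately show "((\<lambda>x. integral (cbox a b) (\<lambda>z. \<kappa> (x - z) *\<^sub>R F z)) has_derivative
      (\<lambda>v. integral (cbox a b) (\<lambda>z. ?D (x - z) v *\<^sub>R F z))) (at x)"
      by simp
  next
    show "Ck_on k (\<lambda>x. integral (cbox a b) (\<lambda>z. ?D (x - z) v *\<^sub>R F z)) UNIV" for v
      by (rule Suc.IH[OF Cr_on_frechet[OF Suc.prems]])
  qed
qed

lemma frechet_derivative_bound_compact:
  fixes f :: "'a::euclidean_space \<Rightarrow> 'b::euclidean_space"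
  assumes "Cr_on r f S" "1 \<le> r" "compact P" "P \<subseteq> S"
  obtains M where "M > 0" "\<And>x v. x \<in> P \<Longrightarrow> norm (frechet_derivative f (at x) v) \<le> M * norm v"
proof -
  let ?D = "\<lambda>x. frechet_derivative f (at x)"
  have "\<exists>B. \<forall>x\<in>P. norm (?D x b) \<le> B" for b
  proof -
    have "compact ((\<lambda>x. ?D x b) ` P)"
      using compact_continuous_image[OF continuous_on_subset[OF Cr_on_frechet_continuous[OF assms(1,2)] assms(4)] assms(3)] .
    then show ?thesis using compact_imp_bounded by (fastforce simp: bounded_iff)
  qed
  then obtain B where B: "\<And>b x. x \<in> P \<Longrightarrow> norm (?D x b) \<le> B b" by metis
  define M where "M = (\<Sum>b\<in>Basis. \<bar>B b\<bar>) + 1"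
  show ?thesis
  proof
    show "M > 0" by (simp add: M_def sum_nonneg add_nonneg_pos)
    fix x v assume x: "x \<in> P"
    then have l: "linear (?D x)"
      using Cr_on_has_derivative[OF assms(1,2), of x] assms(4) by (auto simp: has_derivative_bounded_linear bounded_linear.linear)
    have "?D x v = (\<Sum>b\<in>Basis. (v \<bullet> b) *\<^sub>R ?D x b)"
      by (subst euclidean_representation[symmetric, of v]) (simp add: linear_sum[OF l] linear_cmul[OF l])
    also have "norm \<dots> \<le> (\<Sum>b\<in>Basis. norm v * \<bar>B b\<bar>)"
    proof (rule sum_norm_le)
      fix b :: 'a assume b: "b \<in> Basis"
      have "norm (?D x b) \<le> \<bar>B b\<bar>" using B[OF x, of b] by linarith
      then show "norm ((v \<bullet> b) *\<^sub>R ?D x b) \<le> norm v * \<bar>B b\<bar>"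
        using Basis_le_norm[OF b, of v] by (auto intro!: mult_mono)
    qed
    also have "\<dots> \<le> M * norm v" by (simp add: M_def sum_distrib_left[symmetric] algebra_simps)
    finally show "norm (?D x v) \<le> M * norm v" .
  qed
qed

lemma frechet_derivative_bounded_by_lipschitz:
  fixes f :: "'a::euclidean_space \<Rightarrow> 'b::euclidean_space"
  assumes D: "(f has_derivative D) (at x)" and L: "\<And>x y. norm (f x - f y) \<le> L * norm (x - y)"
  shows "norm (D v) \<le> L * norm v"
proof (cases "v = 0")
  case True
  then show ?thesis using D by (simp add: has_derivative_def bounded_linear.linear linear_0)
next
  case False
  have l: "linear D" using D by (simp add: has_derivative_bounded_linear bounded_linear.linear)
  have "norm (D v) \<le> (L + e) * norm v" if e: "e > 0" for e
  proof -
    obtain d where d: "d > 0" "\<And>y. norm (y - x) < d \<Longrightarrow> norm (f y - f x - D (y - x)) \<le> e * norm (y - x)"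
      using D e unfolding has_derivative_at_alt by blast
    define t where "t = d / (2 * norm v)"
    have t: "t > 0" "norm (t *\<^sub>R v) < d" using d(1) False by (auto simp: t_def)
    have "norm (f (x + t *\<^sub>R v) - f x - D (t *\<^sub>R v)) \<le> e * norm (t *\<^sub>R v)"
      using d(2)[of "x + t *\<^sub>R v"] t by simp
    moreover have "norm (f (x + t *\<^sub>R v) - f x) \<le> L * norm (t *\<^sub>R v)"
      using L[of "x + t *\<^sub>R v" x] by simp
    ultimately have "norm (D (t *\<^sub>R v)) \<le> (L + e) * norm (t *\<^sub>R v)"
      using norm_triangle_ineq4[of "f (x + t *\<^sub>R v) - f x" "f (x + t *\<^sub>R v) - f x - D (t *\<^sub>R v)"]
      by (simp add: algebra_simps)
    then show ?thesis using t(1) by (simp add: linear_cmul[OF l] mult.left_commute)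
  qed
  then have "norm (D v) \<le> L * norm v + e" if "e > 0" for e
    using that False spec[of "\<lambda>e. e > 0 \<longrightarrow> norm (D v) \<le> (L + e) * norm v" "e / norm v"]
    by (simp add: algebra_simps)
  then show ?thesis by (rule field_le_epsilon)
qed

lemma uniformly_continuous_compact_support:
  fixes F :: "'a::euclidean_space \<Rightarrow> 'b::real_normed_vector"
  assumes F: "continuous_on UNIV F" and P: "compact P" "\<And>x. x \<notin> P \<Longrightarrow> F x = 0" and e: "e > 0"
  obtains d where "d > 0" "\<And>x y. norm (x - y) < d \<Longrightarrow> norm (F x - F y) < e"
proof -
  obtain c where c: "P \<subseteq> cball 0 c"
    using compact_imp_bounded[OF P(1)] by (auto simp: bounded_iff subset_eq)
  have "uniformly_continuous_on (cball 0 (c + 1)) F"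
    by (rule compact_uniformly_continuous[OF continuous_on_subset[OF F]]) auto
  then obtain d where d: "d > 0"
    "\<And>x y. x \<in> cball 0 (c + 1) \<Longrightarrow> y \<in> cball 0 (c + 1) \<Longrightarrow> dist y x < d \<Longrightarrow> dist (F y) (F x) < e"
    using e unfolding uniformly_continuous_on_def by metis
  show ?thesis
  proof (rule that[of "min d 1"])
    show "min d 1 > 0" using d by simp
    fix x y :: 'a assume xy: "norm (x - y) < min d 1"
    show "norm (F x - F y) < e"
    proof (cases "x \<in> cball 0 (c + 1) \<and> y \<in> cball 0 (c + 1)")
      case True
      then show ?thesis using d(2)[of y x] xy by (simp add: dist_norm)
    next
      case False
      have "norm x \<le> norm y + norm (x - y)" "norm y \<le> norm x + norm (x - y)"
        using norm_triangle_sub[of x y] norm_triangle_sub[of y x] by (simp_all add: norm_minus_commute)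
      then have "x \<notin> cball 0 c" "y \<notin> cball 0 c" using False xy by auto
      then show ?thesis using P(2) c e by (metis diff_self norm_zero subsetD)
    qed
  qed
qed

text \<open>
  Convolution with a bump of small support. The increments of the error are averages of increments of
  \<open>F (x - y) - F x\<close> over small \<open>y\<close>, and the derivative of that function of \<open>x\<close> is small because the
  derivative of \<open>F\<close> is uniformly continuous. So the error is small in the Lipschitz sense, which is
  what the perturbation argument below needs.
\<close>

lemma smooth_approximation:
  fixes F :: "'a::euclidean_space \<Rightarrow> 'b::euclidean_space"
  assumes F: "Cr_on r F UNIV" "1 \<le> r" and P: "compact P" "\<And>x. x \<notin> P \<Longrightarrow> F x = 0" and e: "e > 0"
  obtains g where "Cr_on \<infinity> g UNIV" "\<And>x. norm (g x - F x) \<le> e"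
    "\<And>x y. norm ((g x - F x) - (g y - F y)) \<le> e * norm (x - y)"
proof -
  have Fc: "continuous_on S F" for S using Cr_on_continuous[OF F(1)] continuous_on_subset by blast
  let ?D = "\<lambda>x. frechet_derivative F (at x)"
  have D: "(F has_derivative ?D x) (at x)" for x using Cr_on_has_derivative[OF F] by simp
  have lin: "linear (?D x)" for x using D[of x] by (simp add: has_derivative_bounded_linear bounded_linear.linear)
  have D0: "?D x v = 0" if x: "x \<notin> P" for x v
  proof -
    have o: "open (- P)" using P(1) by (simp add: compact_imp_closed open_Compl)
    have "(F has_derivative (\<lambda>v. 0)) (at x)"
      by (rule has_derivative_transform_within_open[OF has_derivative_const[of 0] o]) (use x P in auto)
    then show ?thesis using D[of x] has_derivative_unique by metis
  qed
  define N where "N = real DIM('a)"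
  have N: "N > 0" by (simp add: N_def)
  have "\<exists>d>0. \<forall>x y. norm (x - y) < d \<longrightarrow> norm (?D x b - ?D y b) < e / N" for b
  proof (rule uniformly_continuous_compact_support[of "\<lambda>x. ?D x b" P "e / N"])
    show "continuous_on UNIV (\<lambda>x. ?D x b)" using Cr_on_frechet_continuous[OF F] .
  qed (use P D0 e N in auto)
  then obtain d where d: "\<And>b. d b > 0" "\<And>b x y. norm (x - y) < d b \<Longrightarrow> norm (?D x b - ?D y b) < e / N"
    by metis
  obtain d0 where d0: "d0 > 0" "\<And>x y. norm (x - y) < d0 \<Longrightarrow> norm (F x - F y) < e"
    using uniformly_continuous_compact_support[OF Fc P e] by blast
  define \<delta> where "\<delta> = Min (insert d0 (d ` Basis))"
  have \<delta>: "\<delta> > 0" "\<delta> \<le> d0" "\<And>b. b \<in> Basis \<Longrightarrow> \<delta> \<le> d b"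
    using d d0 by (auto simp: \<delta>_def intro: min.coboundedI2)
  have DD: "norm (?D (x - y) v - ?D x v) \<le> e * norm v" if y: "norm y < \<delta>" for x y v
  proof (rule linear_bound_Basis[of "\<lambda>v. ?D (x - y) v - ?D x v"])
    show "linear (\<lambda>v. ?D (x - y) v - ?D x v)" by (intro linear_compose_sub lin)
    show "norm (?D (x - y) b - ?D x b) \<le> e / real DIM('a)" if "b \<in> Basis" for b
      using d(2)[of "x - y" x b] y \<delta>(3)[OF that] by (simp add: N_def less_imp_le)
  qed
  have FL: "norm ((F (x - y) - F x) - (F (x' - y) - F x')) \<le> e * norm (x - x')" if y: "norm y < \<delta>" for x x' y
  proof -
    have "((\<lambda>x. F (x - y) - F x) has_derivative (\<lambda>v. ?D (x - y) v - ?D x v)) (at x)" for x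
    proof -
      have "((\<lambda>x. x - y) has_derivative (\<lambda>v. v)) (at x)" by (auto intro!: derivative_eq_intros)
      from has_derivative_compose[OF this D] have "((\<lambda>x. F (x - y)) has_derivative ?D (x - y)) (at x)" .
      then show ?thesis by (rule has_derivative_diff) (rule D)
    qed
    then show ?thesis
      using DD[OF y] e
      by (intro differentiable_bound[of UNIV "\<lambda>x. F (x - y) - F x" "\<lambda>x v. ?D (x - y) v - ?D x v"])
        (auto intro!: onorm_le)
  qed
  obtain \<rho> :: "'a \<Rightarrow> real" and W Q where \<rho>: "\<And>s. Cr_on s \<rho> UNIV" "open W" "{0} \<subseteq> W" "compact Q" "Q \<subseteq> ball 0 \<delta>"
    "\<And>x. x \<in> W \<Longrightarrow> \<rho> x = 1" "\<And>x. x \<notin> Q \<Longrightarrow> \<rho> x = 0" "\<And>x. 0 \<le> \<rho> x"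
    using smooth_bump[of "{0::'a}" "ball 0 \<delta>"] \<delta>(1) by (metis compact_sing centre_in_ball empty_subsetI insert_subset open_ball)
  have \<rho>c: "continuous_on S \<rho>" for S using Cr_on_continuous[OF \<rho>(1)[of 0]] continuous_on_subset by blast
  have \<rho>0: "\<rho> 0 = 1" using \<rho> by auto
  obtain A where A: "Q \<subseteq> box (- A) A"
    using bounded_subset_box_symmetric[OF compact_imp_bounded[OF \<rho>(4)]] by blast
  define I where "I = integral (cbox (- A) A) \<rho>"
  have int0: "(\<rho> has_integral I) (cbox (- A) A)"
    unfolding I_def by (intro integrable_integral integrable_continuous \<rho>c)
  have int\<rho>: "(\<rho> has_integral I) UNIV"
    by (rule has_integral_on_superset[OF int0]) (use A \<rho>(7) box_subset_cbox in \<open>blast+\<close>)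
  have I: "I > 0"
  proof -
    have 0: "0 \<in> box (- A) A" using \<rho>(7)[of 0] \<rho>0 A by auto
    have "I \<ge> 0" using has_integral_nonneg[OF int0] \<rho>(8) by blast
    moreover have "I \<noteq> 0"
      using has_integral_0_cbox_imp_0[OF \<rho>c _ _ _ subsetD[OF box_subset_cbox 0]] int0 0 \<rho>(8) \<rho>0
      by fastforce
    ultimately show ?thesis by simp
  qed
  obtain a b where ab: "P \<subseteq> cbox a b"
    using bounded_subset_cbox_symmetric[OF compact_imp_bounded[OF P(1)]] by metis
  define g where "g x = integral (cbox a b) (\<lambda>z. \<rho> (x - z) *\<^sub>R F z)" for x
  have g: "((\<lambda>y. \<rho> y *\<^sub>R F (x - y)) has_integral g x) UNIV" for x
  proof -
    have "((\<lambda>z. \<rho> (x - z) *\<^sub>R F z) has_integral g x) (cbox a b)"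
      unfolding g_def
      by (intro integrable_integral integrable_continuous continuous_intros Fc continuous_on_compose2[OF \<rho>c[of UNIV]]) auto
    from has_integral_affinity[OF this, of "-1" x]
    have "((\<lambda>y. \<rho> y *\<^sub>R F (x - y)) has_integral g x) ((\<lambda>z. - z + x) ` cbox a b)"
      by simp
    then show ?thesis
    proof (rule has_integral_on_superset)
      fix y assume "y \<notin> (\<lambda>z. - z + x) ` cbox a b"
      then have "x - y \<notin> cbox a b" by (auto simp: image_iff)
      then show "\<rho> y *\<^sub>R F (x - y) = 0" using ab P(2) by auto
    qed auto
  qed
  define G where "G x = (1 / I) *\<^sub>R g x" for x
  have dif: "((\<lambda>y. \<rho> y *\<^sub>R (F (x - y) - F x)) has_integral I *\<^sub>R (G x - F x)) UNIV" for x
    using has_integral_diff[OF g[of x] has_integral_scaleR_left[OF int\<rho>, of "F x"]] I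
    by (simp add: G_def scaleR_diff_right)
  have int_const: "integral UNIV (\<lambda>y. \<rho> y *\<^sub>R t) = I * t" for t :: real
    using integral_unique[OF has_integral_scaleR_left[OF int\<rho>, of t]] unfolding real_scaleR_def .
  have bound: "norm (I *\<^sub>R w) \<le> I * c \<Longrightarrow> norm w \<le> c" for w :: 'b and c
    using I by simp
  show ?thesis
  proof (rule that[of G])
    show "Cr_on \<infinity> G UNIV"
    proof -
      have "Cr_on \<infinity> g UNIV"
        unfolding Cr_on_def g_def using Ck_on_convolution[OF Fc \<rho>(1)] by blast
      then show ?thesis unfolding G_def by (intro Cr_on_scaleR Cr_on_const) auto
    qed
    fix x
    have "norm (integral UNIV (\<lambda>y. \<rho> y *\<^sub>R (F (x - y) - F x))) \<le> integral UNIV (\<lambda>y. \<rho> y *\<^sub>R e)"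
    proof (rule integral_norm_bound_integral)
      show "(\<lambda>y. \<rho> y *\<^sub>R (F (x - y) - F x)) integrable_on UNIV" by (rule has_integral_integrable[OF dif])
      show "(\<lambda>y. \<rho> y *\<^sub>R e) integrable_on UNIV" 
        by (rule has_integral_integrable[OF has_integral_scaleR_left[OF int\<rho>]])
      fix y
      have "norm (F (x - y) - F x) \<le> e" if "y \<in> Q"
        using d0(2)[of "x - y" x] that \<rho>(5) \<delta>(2) by fastforce
      then show "norm (\<rho> y *\<^sub>R (F (x - y) - F x)) \<le> \<rho> y *\<^sub>R e"
        using \<rho>(7,8)[of y] by (cases "y \<in> Q") (auto intro!: mult_left_mono)
    qed
    then have "norm (I *\<^sub>R (G x - F x)) \<le> I * e"
      unfolding int_const integral_unique[OF dif] .
    then show "norm (G x - F x) \<le> e" by (rule bound)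
    fix x'
    let ?h = "\<lambda>y. \<rho> y *\<^sub>R (F (x - y) - F x) - \<rho> y *\<^sub>R (F (x' - y) - F x')"
    let ?c = "e * norm (x - x')"
    have h: "(?h has_integral I *\<^sub>R (G x - F x) - I *\<^sub>R (G x' - F x')) UNIV"
      by (rule has_integral_diff[OF dif dif])
    have "norm (integral UNIV ?h) \<le> integral UNIV (\<lambda>y. \<rho> y *\<^sub>R ?c)"
    proof (rule integral_norm_bound_integral)
      show "?h integrable_on UNIV" by (rule has_integral_integrable[OF h])
      show "(\<lambda>y. \<rho> y *\<^sub>R ?c) integrable_on UNIV" 
        by (rule has_integral_integrable[OF has_integral_scaleR_left[OF int\<rho>]])
      fix y
      have "norm ((F (x - y) - F x) - (F (x' - y) - F x')) \<le> ?c" if "y \<in> Q"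
        using FL[of y x x'] that \<rho>(5) by fastforce
      then show "norm (?h y) \<le> \<rho> y *\<^sub>R ?c"
        using \<rho>(7,8)[of y]
        by (cases "y \<in> Q") (auto simp: scaleR_diff_right[symmetric] intro!: mult_left_mono)
    qed
    then have "norm (I *\<^sub>R ((G x - F x) - (G x' - F x'))) \<le> I * ?c"
      unfolding int_const integral_unique[OF h] by (simp only: scaleR_diff_right)
    then show "norm ((G x - F x) - (G x' - F x')) \<le> ?c" by (rule bound)
  qed
qed

section \<open>Finite linear groups\<close>

lemma open_contains_shift:
  fixes w v :: "'a::real_normed_vector"
  assumes "open U" "w \<in> U"
  obtains t where "t > 0" "w + t *\<^sub>R v \<in> U"
proof -
  obtain e where e: "e > 0" "ball w e \<subseteq> U" using assms open_contains_ball by blast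
  define t where "t = e / (2 * (norm v + 1))"
  have t: "t > 0" using e by (simp add: t_def add_nonneg_pos)
  have "norm (t *\<^sub>R v) = e / 2 * (norm v / (norm v + 1))" using e by (simp add: t_def)
  also have "\<dots> \<le> e / 2 * 1" using e by (intro mult_left_mono) (auto simp: divide_le_eq_1 add_nonneg_pos)
  also have "\<dots> < e" using e by simp
  finally have "w + t *\<^sub>R v \<in> ball w e" by (simp add: dist_norm)
  then show ?thesis using that t e(2) by blast
qed

lemma linear_eq_on_open:
  fixes S T :: "'a::real_normed_vector \<Rightarrow> 'b::real_vector"
  assumes "linear S" "linear T" "open U" "U \<noteq> {}" "\<And>z. z \<in> U \<Longrightarrow> S z = T z"
  shows "S = T"
proof
  fix v
  obtain w where w: "w \<in> U" using assms(4) by blast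
  obtain t where t: "t > 0" "w + t *\<^sub>R v \<in> U" using open_contains_shift[OF assms(3) w] by blast
  then have "S (w + t *\<^sub>R v) = T (w + t *\<^sub>R v)" "S w = T w" using assms(5) w t by blast+
  then show "S v = T v"
    using t(1) by (simp add: linear_add[OF assms(1)] linear_add[OF assms(2)] linear_cmul[OF assms(1)] linear_cmul[OF assms(2)])
qed

text \<open>
  The finite case of Baire's theorem. If at every point some element of a finite group has a
  closed property, then a single element has it on an open set.
\<close>

lemma finite_closed_cover_interior:
  assumes "finite I" "open U" "U \<noteq> {}" "U \<subseteq> (\<Union>i\<in>I. F i)"
    and "\<And>i. i \<in> I \<Longrightarrow> closedin (top_of_set U) (U \<inter> F i)"
  obtains i V where "i \<in> I" "open V" "V \<noteq> {}" "V \<subseteq> U" "V \<subseteq> F i"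
proof -
  have "\<exists>i\<in>I. \<exists>V. open V \<and> V \<noteq> {} \<and> V \<subseteq> U \<and> V \<subseteq> F i"
    using assms
  proof (induction I arbitrary: U rule: finite_induct)
    case (insert j I)
    show ?case
    proof (cases "U - F j = {}")
      case True
      then show ?thesis using insert.prems by blast
    next
      case False
      let ?U = "U - F j"
      have "?U = U - U \<inter> F j" by blast
      then have o: "open ?U"
        using insert.prems(1) insert.prems(4)[of j] openin_open_trans by (metis insertI1 openin_diff openin_subtopology_self)
      have "closedin (top_of_set ?U) (?U \<inter> F i)" if "i \<in> I" for i
      proof -
        have "closedin (top_of_set U) (U \<inter> F i)" using insert.prems(4) that by blast
        then obtain C where "closed C" "U \<inter> F i = C \<inter> U" by (auto simp: closedin_closed)
        then show ?thesis by (auto simp: closedin_closed intro!: exI[of _ C])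
      qed
      then have "\<exists>i\<in>I. \<exists>V. open V \<and> V \<noteq> {} \<and> V \<subseteq> ?U \<and> V \<subseteq> F i"
        by (intro insert.IH o False) (use insert.prems(3) in auto)
      then show ?thesis by blast
    qed
  qed auto
  then show ?thesis using that by blast
qed

locale finite_linear_group =
  fixes \<T> :: "('a::euclidean_space \<Rightarrow> 'a) set"
  assumes fin: "finite \<T>" and id_mem: "id \<in> \<T>"
    and lin: "\<And>T. T \<in> \<T> \<Longrightarrow> linear T"
    and comp_mem: "\<And>S T. S \<in> \<T> \<Longrightarrow> T \<in> \<T> \<Longrightarrow> S \<circ> T \<in> \<T>"
    and inverse_ex: "\<And>T. T \<in> \<T> \<Longrightarrow> \<exists>S\<in>\<T>. S \<circ> T = id \<and> T \<circ> S = id"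
begin

text \<open>
  These sets play the role of balls for an invariant norm: they are convex, open and invariant, and
  form a neighbourhood basis of 0.
\<close>

definition polyball :: "real \<Rightarrow> 'a set" where
  "polyball \<rho> = {z. \<forall>T\<in>\<T>. norm (T z) < \<rho>}"

lemma continuous_mem: "T \<in> \<T> \<Longrightarrow> continuous_on A T"
  using lin linear_continuous_on linear_conv_bounded_linear by blast

lemma open_polyball: "open (polyball \<rho>)"
proof -
  have "polyball \<rho> = (\<Inter>T\<in>\<T>. {z. norm (T z) < \<rho>})" by (auto simp: polyball_def)
  moreover have "open {z. norm (T z) < \<rho>}" if "T \<in> \<T>" for T
    using continuous_mem[OF that] by (intro open_Collect_less continuous_intros) auto
  ultimately show ?thesis using fin by auto
qed

lemma convex_polyball: "convex (polyball \<rho>)"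
proof -
  have "polyball \<rho> = (\<Inter>T\<in>\<T>. T -` ball 0 \<rho>)" by (auto simp: polyball_def)
  then show ?thesis by (auto intro!: convex_INT convex_linear_vimage lin)
qed

lemma zero_in_polyball: "\<rho> > 0 \<Longrightarrow> 0 \<in> polyball \<rho>"
  by (simp add: polyball_def linear_0[OF lin])

lemma polyball_subset: "polyball \<rho> \<subseteq> ball 0 \<rho>"
  using id_mem by (auto simp: polyball_def)

lemma polyball_invariant: "T \<in> \<T> \<Longrightarrow> z \<in> polyball \<rho> \<Longrightarrow> T z \<in> polyball \<rho>"
  using comp_mem[of _ T] by (force simp: polyball_def)

text \<open>
  An inner product that is invariant under the group.
\<close>

definition B :: "'a \<Rightarrow> 'a \<Rightarrow> real" where "B v w = (\<Sum>T\<in>\<T>. T v \<bullet> T w)"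

lemma B_commute: "B v w = B w v" by (simp add: B_def inner_commute)

lemma B_add: "B (u + v) w = B u w + B v w" and B_diff: "B (u - v) w = B u w - B v w"
  and B_scale: "B (c *\<^sub>R v) w = c * B v w"
  by (simp_all add: B_def linear_add[OF lin] linear_diff[OF lin] linear_cmul[OF lin] inner_add_left inner_diff_left
      sum.distrib sum_subtractf sum_distrib_left)

lemma B_add_right: "B w (u + v) = B w u + B w v" and B_diff_right: "B w (u - v) = B w u - B w v"
  and B_scale_right: "B w (c *\<^sub>R v) = c * B w v"
  by (simp_all add: B_commute[of w] B_add B_diff B_scale)

lemma B_nonneg: "0 \<le> B v v" by (simp add: B_def sum_nonneg)

lemma B_zero: assumes "B v v = 0" shows "v = 0"
proof -
  have "id v \<bullet> id v \<le> B v v"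
    unfolding B_def by (rule member_le_sum[OF id_mem]) (auto simp: fin)
  then have "v \<bullet> v = 0" using assms inner_ge_zero[of v] by simp
  then show ?thesis by simp
qed

lemma B_invariant: assumes S: "S \<in> \<T>" shows "B (S v) (S w) = B v w"
proof -
  obtain R where R: "R \<in> \<T>" "R \<circ> S = id" "S \<circ> R = id" using inverse_ex[OF S] by blast
  show ?thesis
    unfolding B_def
    by (rule sum.reindex_bij_witness[of _ "\<lambda>T. T \<circ> R" "\<lambda>T. T \<circ> S"])
      (use S R comp_mem in \<open>auto simp: o_assoc[symmetric]\<close>)
qed

text \<open>
  A substitute for the Cauchy-Schwarz inequality that is just strong enough for the next lemma.
\<close>

lemma two_B_le: "2 * \<bar>B v w\<bar> \<le> B v v + B w w"
  using B_nonneg[of "v - w"] B_nonneg[of "v + w"]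
  by (simp add: B_add B_diff B_add_right B_diff_right B_commute[of w v])

definition selection :: "real \<Rightarrow> ('a \<Rightarrow> 'a) \<Rightarrow> bool" where
  "selection \<rho> f \<longleftrightarrow> continuous_on (polyball \<rho>) f \<and> (\<forall>z\<in>polyball \<rho>. \<exists>T\<in>\<T>. f z = T z)"

text \<open>
  On the segment from \<open>y\<close> to \<open>x\<close> the function \<open>B w (f z)\<close>, with \<open>w\<close> the increment of \<open>f\<close>, is
  piecewise one of finitely many affine functions, each Lipschitz with the constant
  \<open>(B w w + B v v) / 2\<close>. A continuous function with this property has the same Lipschitz constant, so
  \<open>B w w\<close> is at most that number.
\<close>

lemma selection_contracts:
  assumes f: "selection \<rho> f" and x: "x \<in> polyball \<rho>" and y: "y \<in> polyball \<rho>"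
  shows "B (f x - f y) (f x - f y) \<le> B (x - y) (x - y)"
proof -
  define v where "v = x - y"
  define w where "w = f x - f y"
  define \<gamma> where "\<gamma> t = y + t *\<^sub>R v" for t
  have \<gamma>: "\<gamma> t \<in> polyball \<rho>" if "t \<in> {0..1}" for t
  proof -
    have "(1 - t) *\<^sub>R y + t *\<^sub>R x \<in> polyball \<rho>"
      using convexD[OF convex_polyball y x, of "1 - t" t] that by auto
    then show ?thesis by (simp add: \<gamma>_def v_def algebra_simps)
  qed
  have \<gamma>c: "continuous_on {0..1} \<gamma>" unfolding \<gamma>_def by (intro continuous_intros)
  have f\<gamma>: "continuous_on {0..1} (\<lambda>t. f (\<gamma> t))"
    by (rule continuous_on_compose2[OF _ \<gamma>c]) (use f \<gamma> in \<open>auto simp: selection_def\<close>)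
  define M where "M = (B w w + B v v) / 2"
  have M: "M \<ge> 0" using B_nonneg by (simp add: M_def)
  define A where "A T = {t\<in>{0..1}. f (\<gamma> t) = T (\<gamma> t)}" for T
  have "closed (A T)" if T: "T \<in> \<T>" for T
  proof -
    have "continuous_on {0..1} (\<lambda>t. T (\<gamma> t))"
      by (rule continuous_on_compose2[OF continuous_mem[OF T, of UNIV] \<gamma>c]) auto
    then have "continuous_on {0..1} (\<lambda>t. f (\<gamma> t) - T (\<gamma> t))" by (intro continuous_on_diff f\<gamma>)
    then have "closed {t\<in>{0..1}. f (\<gamma> t) - T (\<gamma> t) = 0}" by (rule continuous_closed_preimage_constant) auto
    then show ?thesis by (simp add: A_def)
  qed
  moreover have "M-lipschitz_on (A T) (\<lambda>t. B w (f (\<gamma> t)))" if T: "T \<in> \<T>" for T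
  proof (rule lipschitz_onI[OF _ M])
    fix a b assume ab: "a \<in> A T" "b \<in> A T"
    have "B w (f (\<gamma> a)) - B w (f (\<gamma> b)) = (a - b) * B w (T v)"
      using ab by (simp add: A_def \<gamma>_def linear_add[OF lin[OF T]] linear_cmul[OF lin[OF T]] B_add_right B_scale_right algebra_simps)
    moreover have "\<bar>B w (T v)\<bar> \<le> M"
      using two_B_le[of w "T v"] B_invariant[OF T, of v v] by (simp add: M_def)
    ultimately show "dist (B w (f (\<gamma> a))) (B w (f (\<gamma> b))) \<le> M * dist a b"
      by (simp add: dist_real_def abs_mult mult.commute[of M] mult_left_mono)
  qed
  moreover have "{0..1} \<subseteq> (\<Union>T\<in>\<T>. A T)" using f \<gamma> unfolding selection_def A_def by fastforce
  ultimately have "M-lipschitz_on {0..1} (\<lambda>t. B w (f (\<gamma> t)))"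
    using lipschitz_on_closed_Union[of \<T> M A "\<lambda>t. B w (f (\<gamma> t))" 0 1] fin M by blast
  from lipschitz_onD[OF this, of 1 0] have "\<bar>B w (f (\<gamma> 1)) - B w (f (\<gamma> 0))\<bar> \<le> M"
    by (simp add: dist_real_def)
  moreover have "B w (f (\<gamma> 1)) - B w (f (\<gamma> 0)) = B w w"
    by (simp add: \<gamma>_def v_def w_def B_diff_right)
  ultimately show ?thesis by (simp add: M_def v_def w_def)
qed

text \<open>
  An injective selection permutes every finite orbit, so its inverse is a selection too, and both
  contract: \<open>f\<close> is an isometry for \<open>B\<close>. It agrees with one group element on an open set, and an
  isometry of a convex set that fixes an open set is the identity.
\<close>

lemma injective_selection_eq:
  assumes f: "selection \<rho> f" and inj: "inj_on f (polyball \<rho>)" and \<rho>: "\<rho> > 0"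
  obtains T where "T \<in> \<T>" "\<And>z. z \<in> polyball \<rho> \<Longrightarrow> f z = T z"
proof -
  let ?D = "polyball \<rho>"
  have fD: "f z \<in> ?D" if "z \<in> ?D" for z
    using f that polyball_invariant unfolding selection_def by metis
  have cf: "continuous_on ?D f" using f by (simp add: selection_def)
  have surj: "f ` ?D = ?D"
  proof
    show "?D \<subseteq> f ` ?D"
    proof
      fix y assume y: "y \<in> ?D"
      let ?O = "(\<lambda>T. T y) ` \<T>"
      have OD: "?O \<subseteq> ?D" using y polyball_invariant by blast
      have "f ` ?O \<subseteq> ?O"
      proof (clarify)
        fix T assume T: "T \<in> \<T>"
        then obtain S where S: "S \<in> \<T>" "f (T y) = S (T y)" using f OD unfolding selection_def by blast
        then show "f (T y) \<in> ?O" using comp_mem[OF S(1) T] by (auto intro!: image_eqI[of _ _ "S \<circ> T"])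
      qed
      then have "f ` ?O = ?O" using endo_inj_surj[of ?O f] fin inj_on_subset[OF inj OD] by simp
      moreover have "y \<in> ?O" using imageI[OF id_mem, of "\<lambda>T. T y"] by simp
      ultimately show "y \<in> f ` ?D" using OD by blast
    qed
  qed (use fD in blast)
  define g where "g = inv_into ?D f"
  have g: "g z \<in> ?D" "f (g z) = z" if "z \<in> ?D" for z
    using that surj by (auto simp: g_def f_inv_into_f inv_into_into)
  have gf: "g (f z) = z" if "z \<in> ?D" for z using that inj by (simp add: g_def)
  have "selection \<rho> g"
    unfolding selection_def
  proof
    show "continuous_on ?D g"
      using continuous_on_inverse_open[OF open_polyball cf _, of g] gf surj by auto
    show "\<forall>z\<in>?D. \<exists>T\<in>\<T>. g z = T z"
    proof
      fix z assume z: "z \<in> ?D"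
      then obtain T where T: "T \<in> \<T>" "z = T (g z)" using f g unfolding selection_def by metis
      then obtain S where "S \<in> \<T>" "S \<circ> T = id" using inverse_ex by blast
      then show "\<exists>T\<in>\<T>. g z = T z" using T by (metis comp_apply id_apply)
    qed
  qed
  then have iso: "B (f x - f y) (f x - f y) = B (x - y) (x - y)" if "x \<in> ?D" "y \<in> ?D" for x y
    using selection_contracts[OF f that] selection_contracts[of \<rho> g "f x" "f y"] fD that gf by fastforce
  obtain T V where T: "T \<in> \<T>" and V: "open V" "V \<noteq> {}" "V \<subseteq> ?D" "V \<subseteq> {z \<in> ?D. f z = T z}"
  proof (rule finite_closed_cover_interior[OF fin open_polyball[of \<rho>], of "\<lambda>T. {z \<in> ?D. f z = T z}"])
    show "?D \<noteq> {}" using zero_in_polyball[OF \<rho>] by blast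
    show "?D \<subseteq> (\<Union>T\<in>\<T>. {z \<in> ?D. f z = T z})" using f by (auto simp: selection_def)
    fix T assume T: "T \<in> \<T>"
    have "closedin (top_of_set ?D) {z \<in> ?D. f z - T z = 0}"
      by (intro continuous_closedin_preimage_constant continuous_on_diff cf continuous_mem T)
    moreover have "{z \<in> ?D. f z - T z = 0} = ?D \<inter> {z \<in> ?D. f z = T z}" by auto
    ultimately show "closedin (top_of_set ?D) (?D \<inter> {z \<in> ?D. f z = T z})" by simp
  qed blast
  obtain S where S: "S \<in> \<T>" "S \<circ> T = id" "T \<circ> S = id" using inverse_ex[OF T] by blast
  have ST: "S (T z) = z" "T (S z) = z" for z using S by (auto simp: fun_eq_iff)
  obtain w0 where w0: "w0 \<in> V" using V(2) by blast
  have "S (f z) = z" if z: "z \<in> ?D" for z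
  proof -
    define a where "a = S (f z)"
    have eq: "B (a - w) (a - w) = B (z - w) (z - w)" if w: "w \<in> V" for w
    proof -
      have wD: "w \<in> ?D" "f w = T w" using w V by auto
      have "B (a - w) (a - w) = B (S (f z - f w)) (S (f z - f w))"
        by (simp add: a_def wD(2) ST linear_diff[OF lin[OF S(1)]])
      also have "\<dots> = B (z - w) (z - w)" using iso[OF z wD(1)] by (simp add: B_invariant[OF S(1)])
      finally show ?thesis .
    qed
    define u where "u = a - z"
    obtain t where t: "t > 0" "w0 + t *\<^sub>R u \<in> V" using open_contains_shift[OF V(1) w0] by blast
    from eq[OF t(2)] eq[OF w0] have "t * B u u = 0"
      by (simp add: u_def B_add B_diff B_scale B_add_right B_diff_right B_scale_right B_commute algebra_simps)
    then have "u = 0" using t(1) B_zero by simp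
    then show ?thesis by (simp add: u_def a_def)
  qed
  then have "f z = T z" if "z \<in> ?D" for z using that ST by metis
  then show ?thesis using that T by blast
qed

end

section \<open>Smoothing by small equivariant perturbations\<close>

lemma lipschitz_from_frechet:
  fixes f :: "'a::euclidean_space \<Rightarrow> 'b::euclidean_space"
  assumes "\<And>x. (f has_derivative D x) (at x)" "\<And>x v. norm (D x v) \<le> L * norm v"
  shows "norm (f x - f y) \<le> L * norm (x - y)"
  by (rule differentiable_bound[of UNIV f D]) (use assms in \<open>auto intro!: onorm_le\<close>)

text \<open>
  The pairs in \<open>\<Lambda>\<close> are the inverses of charts of a C^s structure on \<open>N\<close> that is C^r-compatible with
  the standard structure.
\<close>

locale smooth_patches =
  fixes r s :: enat and N :: "(real^'n) set" and \<Lambda> :: "((real^'n) set \<times> (real^'n \<Rightarrow> real^'n)) set"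
  assumes r: "1 \<le> r"
    and patch: "\<And>D l. (D, l) \<in> \<Lambda> \<Longrightarrow> open D \<and> Cr_embedding r D N l"
    and trans: "\<And>D l D' l'. (D, l) \<in> \<Lambda> \<Longrightarrow> (D', l') \<in> \<Lambda> \<Longrightarrow>
      Cr_on s (\<lambda>x. inv_into D' l' (l x)) (D \<inter> l -` (l' ` D'))"
    and cover: "N \<subseteq> (\<Union>(D, l)\<in>\<Lambda>. l ` D)"
begin

lemma patchD:
  assumes "(D, l) \<in> \<Lambda>"
  shows "open D" "inj_on l D" "l ` D \<subseteq> N" "open (l ` D)" "Cr_on r l D" "Cr_on r (inv_into D l) (l ` D)"
proof -
  show o: "open D" using patch[OF assms] by blast
  show "inj_on l D" "l ` D \<subseteq> N" "open (l ` D)" "Cr_on r l D" "Cr_on r (inv_into D l) (l ` D)"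
    using conjunct2[OF patch[OF assms]] unfolding Cr_embedding_iff[OF o] by simp_all
qed

text \<open>
  A small vector field \<open>u\<close> such that \<open>id + u\<close> is C^s on \<open>W\<close> for the structure given by \<open>\<Lambda>\<close>.
\<close>

definition perturbation :: "(real^'n \<Rightarrow> real^'n) \<Rightarrow> real \<Rightarrow> (real^'n) set \<Rightarrow> bool" where
  "perturbation u e W \<longleftrightarrow> Cr_on r u UNIV \<and> (\<exists>L. compact L \<and> L \<subseteq> N \<and> (\<forall>x. x \<notin> L \<longrightarrow> u x = 0)) \<and>
     (\<forall>x y. norm (u x - u y) \<le> e * norm (x - y)) \<and> open W \<and>
     (\<forall>(D, l)\<in>\<Lambda>. Cr_on s (\<lambda>x. l x + u (l x)) (D \<inter> l -` W))"

lemma patch_open_vimage: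
  assumes "(D, l) \<in> \<Lambda>" "open W" shows "open (D \<inter> l -` W)"
proof -
  have "continuous_on D l" "open D"
    using patchD[OF assms(1)] Cr_on_continuous by blast+
  then show ?thesis using assms(2) continuous_open_preimage by blast
qed

text \<open>
  In the coordinates of the patch \<open>l0\<close>, the map \<open>f = id + u\<close> is replaced by
  \<open>f + \<zeta> (g - f)\<close>, where \<open>g\<close> is a smooth approximation and \<open>\<zeta>\<close> a bump function. The result is smooth
  where \<open>\<zeta> = 1\<close>, it is still C^s wherever \<open>f\<close> was, since \<open>\<zeta>\<close> and \<open>g\<close> are smooth, and it differs
  from \<open>f\<close> by a small term.
\<close>

lemma perturbation_step:
  assumes u: "perturbation u e1 W" and D0: "(D0, l0) \<in> \<Lambda>" and Q: "compact Q" "Q \<subseteq> l0 ` D0"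
    and e: "e2 > 0"
  obtains u' W' where "perturbation u' (e1 + e2) W'" "W \<union> Q \<subseteq> W'"
proof -
  obtain L where L: "compact L" "L \<subseteq> N" "\<And>x. x \<notin> L \<Longrightarrow> u x = 0"
    and ur: "Cr_on r u UNIV" and uL: "\<And>x y. norm (u x - u y) \<le> e1 * norm (x - y)" and W: "open W"
    and us: "\<And>D l. (D, l) \<in> \<Lambda> \<Longrightarrow> Cr_on s (\<lambda>x. l x + u (l x)) (D \<inter> l -` W)"
    using u unfolding perturbation_def by blast
  have p0: "open D0" "inj_on l0 D0" "l0 ` D0 \<subseteq> N" "open (l0 ` D0)" "Cr_on r l0 D0"
    using patchD[OF D0] by blast+
  define k where "k = inv_into D0 l0"
  have k: "Cr_on r k (l0 ` D0)" "\<And>x. x \<in> D0 \<Longrightarrow> k (l0 x) = x"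
    "\<And>y. y \<in> l0 ` D0 \<Longrightarrow> k y \<in> D0 \<and> l0 (k y) = y"
    using patchD[OF D0] by (auto simp: k_def)
  note cont_l0 = Cr_on_continuous[OF p0(5)] and cont_k = Cr_on_continuous[OF k(1)]
  have "compact (k ` Q)" "k ` Q \<subseteq> D0"
    using compact_continuous_image[OF continuous_on_subset[OF cont_k Q(2)] Q(1)] k(3) Q(2) by auto
  then obtain \<zeta> :: "real^'n \<Rightarrow> real" and V P where \<zeta>: "\<And>s. Cr_on s \<zeta> UNIV" "open V" "k ` Q \<subseteq> V" "V \<subseteq> P"
    "compact P" "P \<subseteq> D0" "\<And>x. x \<in> V \<Longrightarrow> \<zeta> x = 1" "\<And>x. x \<notin> P \<Longrightarrow> \<zeta> x = 0" "\<And>x. 0 \<le> \<zeta> x" "\<And>x. \<zeta> x \<le> 1"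
    by (rule smooth_bump[OF _ p0(1)]) blast
  \<comment> \<open>a second cut-off, equal to 1 on the support of the first, extends the local map to the whole space\<close>
  obtain \<zeta>' :: "real^'n \<Rightarrow> real" and V' P' where \<zeta>': "\<And>s. Cr_on s \<zeta>' UNIV" "P \<subseteq> V'" "compact P'" "P' \<subseteq> D0"
    "\<And>x. x \<in> V' \<Longrightarrow> \<zeta>' x = 1" "\<And>x. x \<notin> P' \<Longrightarrow> \<zeta>' x = 0"
    by (rule smooth_bump[OF \<zeta>(5) p0(1) \<zeta>(6)]) blast
  define f where "f x = l0 x + u (l0 x)" for x
  have f: "Cr_on r f D0"
    unfolding f_def using p0 by (intro Cr_on_add Cr_on_compose[OF p0(5) ur]) auto
  define F where "F x = (if x \<in> D0 then \<zeta>' x *\<^sub>R f x else 0)" for x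
  have F: "Cr_on r F UNIV"
  proof -
    have o: "open (- P')" using \<zeta>'(3) by (simp add: compact_imp_closed open_Compl)
    have "Cr_on r F D0 \<longleftrightarrow> Cr_on r (\<lambda>x. \<zeta>' x *\<^sub>R f x) D0"
      by (rule Cr_on_cong[OF p0(1)]) (simp add: F_def)
    moreover have "Cr_on r F (- P') \<longleftrightarrow> Cr_on r (\<lambda>x. 0 :: real^'n) (- P')"
      by (rule Cr_on_cong[OF o]) (simp add: F_def \<zeta>'(6))
    ultimately have "Cr_on r F (D0 \<union> - P')"
      using p0(1) o f Cr_on_subset[OF \<zeta>'(1)] by (intro Cr_on_Un) (auto intro: Cr_on_scaleR Cr_on_const)
    moreover have "D0 \<union> - P' = UNIV" using \<zeta>'(4) by blast
    ultimately show ?thesis by simp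
  qed
  have F0: "F x = 0" if "x \<notin> P'" for x using that \<zeta>'(6) by (simp add: F_def)
  obtain M where M: "M > 0" "\<And>y v. y \<in> l0 ` P \<Longrightarrow> norm (frechet_derivative k (at y) v) \<le> M * norm v"
    using frechet_derivative_bound_compact[OF k(1) r, of "l0 ` P"] \<zeta>(5,6)
      compact_continuous_image[OF continuous_on_subset[OF cont_l0 \<zeta>(6)] \<zeta>(5)] by (metis image_mono)
  obtain M' where M': "M' > 0" "\<And>y v. y \<in> P \<Longrightarrow> norm (frechet_derivative \<zeta> (at y) v) \<le> M' * norm v"
    using frechet_derivative_bound_compact[OF \<zeta>(1)[of 1] _ \<zeta>(5)] by auto
  \<comment> \<open>the derivative of the new term is at most this number times the bounds for those of the bump and of the inverse patch\<close>
  define e' where "e' = e2 / (M * (1 + M'))"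
  have e': "e' > 0" using e M M' by (simp add: e'_def)
  obtain g where g: "Cr_on \<infinity> g UNIV" "\<And>x. norm (g x - F x) \<le> e'"
    "\<And>x y. norm ((g x - F x) - (g y - F y)) \<le> e' * norm (x - y)"
    using smooth_approximation[OF F r \<zeta>'(3) F0 e'] by blast
  have gs: "Cr_on t g UNIV" for t using Cr_on_mono[OF g(1)] by simp
  define c where "c x = \<zeta> x *\<^sub>R (g x - F x)" for x
  have c: "Cr_on r c UNIV" unfolding c_def using gs F \<zeta>(1) by (intro Cr_on_scaleR Cr_on_diff) auto
  have c0: "c x = 0" if "x \<notin> P" for x using that \<zeta>(8) by (simp add: c_def)
  have cf: "c x = \<zeta> x *\<^sub>R (g x - f x)" if "x \<in> D0" for x
    using that \<zeta>'(2,5) \<zeta>(8) by (cases "x \<in> P") (auto simp: c_def F_def)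
  have dc: "norm (frechet_derivative c (at x) v) \<le> e' * (1 + M') * norm v" if x: "x \<in> P" for x v
  proof -
    let ?h = "\<lambda>x. g x - F x"
    have h: "Cr_on r ?h UNIV" using gs F by (intro Cr_on_diff) auto
    have dh: "(?h has_derivative frechet_derivative ?h (at x)) (at x)" using Cr_on_has_derivative[OF h r] by simp
    have d\<zeta>: "(\<zeta> has_derivative frechet_derivative \<zeta> (at x)) (at x)" using Cr_on_has_derivative[OF \<zeta>(1) r] by simp
    have "(c has_derivative (\<lambda>v. \<zeta> x *\<^sub>R frechet_derivative ?h (at x) v + frechet_derivative \<zeta> (at x) v *\<^sub>R ?h x)) (at x)"
      unfolding c_def by (rule has_derivative_scaleR[OF d\<zeta> dh])
    from frechet_derivative_at[OF this]
    have "frechet_derivative c (at x) v = \<zeta> x *\<^sub>R frechet_derivative ?h (at x) v + frechet_derivative \<zeta> (at x) v *\<^sub>R ?h x"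
      by (simp add: fun_eq_iff)
    also have "norm \<dots> \<le> \<bar>\<zeta> x\<bar> * norm (frechet_derivative ?h (at x) v) + norm (frechet_derivative \<zeta> (at x) v) * norm (?h x)"
      by (rule order_trans[OF norm_triangle_ineq]) simp
    also have "\<dots> \<le> 1 * (e' * norm v) + (M' * norm v) * e'"
      using \<zeta>(9,10)[of x] frechet_derivative_bounded_by_lipschitz[OF dh g(3)] M'(2)[OF x] g(2)[of x] e' M'(1)
      by (intro add_mono mult_mono) auto
    finally show ?thesis by (simp add: algebra_simps)
  qed
  define w where "w y = (if y \<in> l0 ` D0 then c (k y) else 0)" for y
  define C where "C = l0 ` P"
  have C: "compact C" "C \<subseteq> l0 ` D0" "open (- C)"
    using compact_continuous_image[OF continuous_on_subset[OF cont_l0 \<zeta>(6)] \<zeta>(5)] \<zeta>(6)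
    by (auto simp: C_def compact_imp_closed open_Compl)
  have w0: "w y = 0" if "y \<notin> C" for y
    using that c0 k(3) unfolding w_def C_def by (metis imageI)
  have UN: "l0 ` D0 \<union> - C = UNIV" using C by blast
  have w: "Cr_on r w UNIV"
  proof -
    have "Cr_on r w (l0 ` D0) \<longleftrightarrow> Cr_on r (\<lambda>y. c (k y)) (l0 ` D0)"
      by (rule Cr_on_cong[OF p0(4)]) (simp add: w_def)
    moreover have "Cr_on r w (- C) \<longleftrightarrow> Cr_on r (\<lambda>x. 0 :: real^'n) (- C)"
      by (rule Cr_on_cong[OF C(3)]) (simp add: w0)
    ultimately have "Cr_on r w (l0 ` D0 \<union> - C)"
      using p0(4) C(3) Cr_on_compose[OF k(1) c p0(4)] by (intro Cr_on_Un) (auto intro: Cr_on_const)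
    then show ?thesis by (simp add: UN)
  qed
  have wd: "(w has_derivative frechet_derivative w (at y)) (at y)" for y
    using Cr_on_has_derivative[OF w r] by simp
  have wb: "norm (frechet_derivative w (at y) v) \<le> e2 * norm v" for y v
  proof (cases "y \<in> C")
    case True
    then have y: "y \<in> l0 ` D0" "k y \<in> P" using C k(2) \<zeta>(6) by (auto simp: C_def)
    have "((\<lambda>y. c (k y)) has_derivative (\<lambda>v. frechet_derivative c (at (k y)) (frechet_derivative k (at y) v))) (at y)"
      using has_derivative_compose[OF Cr_on_has_derivative[OF k(1) r y(1)] Cr_on_has_derivative[OF c r, of "k y"]] by simp
    then have "(w has_derivative (\<lambda>v. frechet_derivative c (at (k y)) (frechet_derivative k (at y) v))) (at y)"
      by (rule has_derivative_transform_within_open[OF _ p0(4) y(1)]) (simp add: w_def)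
    from frechet_derivative_at[OF this]
    have "norm (frechet_derivative w (at y) v) \<le> e' * (1 + M') * norm (frechet_derivative k (at y) v)"
      using dc[OF y(2)] by (metis (no_types, lifting))
    also have "\<dots> \<le> e' * (1 + M') * (M * norm v)"
      using M(2)[of y v] True e' M'(1) by (intro mult_left_mono) (auto simp: C_def)
    also have "\<dots> = (e' * ((1 + M') * M)) * norm v" by (simp only: mult.assoc)
    also have "e' * ((1 + M') * M) = e2" using M(1) M'(1) by (simp add: e'_def mult.commute[of M])
    finally show ?thesis .
  next
    case False
    have "(w has_derivative (\<lambda>v. 0)) (at y)"
      by (rule has_derivative_transform_within_open[OF has_derivative_const[of 0] C(3)]) (use False w0 in auto)
    from frechet_derivative_at[OF this] show ?thesis using e by (metis norm_zero norm_ge_zero mult_nonneg_nonneg less_imp_le)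
  qed
  have wL: "norm (w x - w y) \<le> e2 * norm (x - y)" for x y
    by (rule lipschitz_from_frechet[OF wd wb])
  have oV: "open (l0 ` V)"
    using invariance_of_domain[OF continuous_on_subset[OF cont_l0] \<zeta>(2) inj_on_subset[OF p0(2)]] \<zeta>(4,6) by blast
  define W' where "W' = W \<union> l0 ` V"
  have smooth: "Cr_on s (\<lambda>x. l x + (u (l x) + w (l x))) (D \<inter> l -` W')" if Dl: "(D, l) \<in> \<Lambda>" for D l
  proof (rule Cr_on_local)
    fix x assume "x \<in> D \<inter> l -` W'"
    then have x: "x \<in> D" "l x \<in> W'" by auto
    have kl: "Cr_on s (\<lambda>x. k (l x)) (D \<inter> l -` (l0 ` D0))" unfolding k_def by (rule trans[OF Dl D0])
    consider (a) "l x \<in> l0 ` V" | (b) "l x \<in> W \<inter> l0 ` D0" | (c) "l x \<in> W" "l x \<notin> l0 ` D0"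
      using x by (auto simp: W'_def)
    then show "\<exists>T. open T \<and> x \<in> T \<and> Cr_on s (\<lambda>x. l x + (u (l x) + w (l x))) T"
    proof cases
      case a
      let ?T = "D \<inter> l -` (l0 ` V)"
      have o: "open ?T" by (rule patch_open_vimage[OF Dl oV])
      have sub: "l0 ` V \<subseteq> l0 ` D0" using \<zeta>(4,6) by blast
      have "Cr_on s (\<lambda>x. g (k (l x))) ?T"
        by (rule Cr_on_compose[OF Cr_on_subset[OF kl] gs o]) (use sub in auto)
      moreover have "l x + (u (l x) + w (l x)) = g (k (l x))" if xT: "x \<in> ?T" for x
      proof -
        obtain z where z: "z \<in> V" "l x = l0 z" using xT by auto
        then have zD: "z \<in> D0" using \<zeta>(4,6) by blast
        have "w (l x) = g z - f z" using z zD cf[OF zD] \<zeta>(7) k(2) by (simp add: w_def)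
        then show ?thesis using z k(2)[OF zD] by (simp add: f_def)
      qed
      ultimately have "Cr_on s (\<lambda>x. l x + (u (l x) + w (l x))) ?T"
        by (rule Cr_on_transform[OF _ o])
      then show ?thesis using o a x by blast
    next
      case b
      let ?T = "D \<inter> l -` (W \<inter> l0 ` D0)"
      have o: "open ?T" by (rule patch_open_vimage[OF Dl open_Int[OF W p0(4)]])
      have h: "Cr_on s (\<lambda>x. l x + u (l x)) ?T" by (rule Cr_on_subset[OF us[OF Dl]]) auto
      have kT: "Cr_on s (\<lambda>x. k (l x)) ?T" by (rule Cr_on_subset[OF kl]) auto
      have "Cr_on s (\<lambda>x. (l x + u (l x)) + \<zeta> (k (l x)) *\<^sub>R (g (k (l x)) - (l x + u (l x)))) ?T"
        by (intro Cr_on_add Cr_on_scaleR Cr_on_diff o h Cr_on_compose[OF kT \<zeta>(1) o] Cr_on_compose[OF kT gs o]) auto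
      moreover have "l x + (u (l x) + w (l x)) = (l x + u (l x)) + \<zeta> (k (l x)) *\<^sub>R (g (k (l x)) - (l x + u (l x)))"
        if "x \<in> ?T" for x
        using that cf k(3)[of "l x"] by (auto simp: w_def f_def)
      ultimately have "Cr_on s (\<lambda>x. l x + (u (l x) + w (l x))) ?T"
        by (rule Cr_on_transform[OF _ o])
      then show ?thesis using o b x by blast
    next
      case c
      let ?T = "D \<inter> l -` (W \<inter> - C)"
      have o: "open ?T" by (rule patch_open_vimage[OF Dl open_Int[OF W C(3)]])
      have "Cr_on s (\<lambda>x. l x + u (l x)) ?T" by (rule Cr_on_subset[OF us[OF Dl]]) auto
      moreover have "l x + (u (l x) + w (l x)) = l x + u (l x)" if "x \<in> ?T" for x
        using that w0 by auto
      ultimately have "Cr_on s (\<lambda>x. l x + (u (l x) + w (l x))) ?T"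
        by (rule Cr_on_transform[OF _ o])
      then show ?thesis using o c x C(2) by blast
    qed
  qed
  show ?thesis
  proof (rule that[of "\<lambda>y. u y + w y" W'])
    have "norm (u x + w x - (u y + w y)) \<le> (e1 + e2) * norm (x - y)" for x y
      using norm_triangle_ineq[of "u x - u y" "w x - w y"] uL[of x y] wL[of x y] by (simp add: algebra_simps)
    moreover have "compact (L \<union> C) \<and> L \<union> C \<subseteq> N \<and> (\<forall>x. x \<notin> L \<union> C \<longrightarrow> u x + w x = 0)"
      using L C p0(3) w0 by auto
    moreover have "Cr_on r (\<lambda>y. u y + w y) UNIV" using ur w by (intro Cr_on_add) auto
    moreover have "open W'" using W oV by (auto simp: W'_def)
    ultimately show "perturbation (\<lambda>y. u y + w y) (e1 + e2) W'"
      unfolding perturbation_def using smooth by blast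
    have "Q \<subseteq> l0 ` V" using \<zeta>(3) k(3) Q(2) by force
    then show "W \<union> Q \<subseteq> W'" by (auto simp: W'_def)
  qed
qed

lemma exists_perturbation:
  assumes K: "compact K" "K \<subseteq> N" and e: "e > 0"
  obtains u W where "perturbation u e W" "K \<subseteq> W"
proof -
  have "\<exists>D l q. (D, l) \<in> \<Lambda> \<and> q > 0 \<and> cball x q \<subseteq> l ` D" if x: "x \<in> K" for x
  proof -
    obtain D l where Dl: "(D, l) \<in> \<Lambda>" "x \<in> l ` D" using x K(2) cover by blast
    moreover have "open (l ` D)" using patchD[OF Dl(1)] by blast
    ultimately show ?thesis using open_contains_cball by blast
  qed
  then obtain D l q where q: "\<And>x. x \<in> K \<Longrightarrow> (D x, l x) \<in> \<Lambda> \<and> q x > 0 \<and> cball x (q x) \<subseteq> l x ` D x"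
    by metis
  obtain C where C: "C \<subseteq> K" "finite C" "K \<subseteq> (\<Union>x\<in>C. ball x (q x))"
    by (rule compactE_image[OF K(1), of K "\<lambda>x. ball x (q x)"]) (use q in auto)
  have "\<forall>e>0. \<exists>u W. perturbation u e W \<and> (\<Union>x\<in>C. cball x (q x)) \<subseteq> W"
    using C(2,1)
  proof (induction C rule: finite_induct)
    case empty
    have "perturbation (\<lambda>x. 0) e {}" if "e > 0" for e
      using that by (auto simp: perturbation_def Cr_on_const Cr_on_empty)
    then show ?case by blast
  next
    case (insert x C)
    show ?case
    proof (intro allI impI)
      fix e :: real assume e: "e > 0"
      then obtain u W where u: "perturbation u (e / 2) W" "(\<Union>x\<in>C. cball x (q x)) \<subseteq> W"
        using insert by (meson half_gt_zero insert_subset)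
      obtain u' W' where "perturbation u' (e / 2 + e / 2) W'" "W \<union> cball x (q x) \<subseteq> W'"
        by (rule perturbation_step[OF u(1), of "D x" "l x" "cball x (q x)" "e / 2"])
          (use q[of x] insert.prems e in auto)
      then show "\<exists>u W. perturbation u e W \<and> (\<Union>x\<in>insert x C. cball x (q x)) \<subseteq> W"
        using u(2) by auto
    qed
  qed
  then obtain u W where u: "perturbation u e W" "(\<Union>x\<in>C. cball x (q x)) \<subseteq> W" using e by blast
  have "(\<Union>x\<in>C. ball x (q x)) \<subseteq> (\<Union>x\<in>C. cball x (q x))" by (intro UN_mono) auto
  then show ?thesis by (intro that[OF u(1)] order_trans[OF C(3)] order_trans[OF _ u(2)])
qed

end

text \<open>
  Surjectivity is Banach's fixed point theorem for \<open>x \<mapsto> y - u x\<close>.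
\<close>

lemma contraction_perturbation_diffeo:
  fixes u :: "real^'n \<Rightarrow> real^'n"
  assumes u: "Cr_on r u UNIV" "1 \<le> r" and L: "\<And>x y. norm (u x - u y) \<le> 1 / 2 * norm (x - y)"
  obtains \<theta>' where "Cr_on r \<theta>' UNIV" "\<And>x. \<theta>' (x + u x) = x" "\<And>y. \<theta>' y + u (\<theta>' y) = y"
proof -
  define \<theta> where "\<theta> x = x + u x" for x
  have \<theta>: "Cr_on r \<theta> UNIV" unfolding \<theta>_def using u by (intro Cr_on_add Cr_on_id) auto
  have inj: "inj \<theta>"
  proof (rule injI)
    fix x y assume "\<theta> x = \<theta> y"
    then have "u x - u y = y - x" by (simp add: \<theta>_def algebra_simps)
    then show "x = y" using L[of x y] by (simp add: norm_minus_commute)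
  qed
  have surj: "\<exists>x. \<theta> x = y" for y
  proof -
    have "\<exists>!x. y - u x = x"
      by (rule banach_fix_type[of "1/2"]) (use L in \<open>auto simp: dist_norm norm_minus_commute\<close>)
    then show ?thesis unfolding \<theta>_def by (metis diff_add_cancel)
  qed
  have der: "v = 0" if "frechet_derivative \<theta> (at x) v = 0" for x v
  proof -
    have d: "(u has_derivative frechet_derivative u (at x)) (at x)" using Cr_on_has_derivative[OF u] by simp
    have "(\<theta> has_derivative (\<lambda>v. v + frechet_derivative u (at x) v)) (at x)"
      unfolding \<theta>_def by (intro has_derivative_add has_derivative_ident d)
    from frechet_derivative_at[OF this] that have "v + frechet_derivative u (at x) v = 0" by metis
    then have "frechet_derivative u (at x) v = - v" by (simp add: add_eq_0_iff)
    then show ?thesis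
      using frechet_derivative_bounded_by_lipschitz[OF d L, of v] by simp
  qed
  have "range \<theta> = UNIV" using surj by (metis surj_def)
  then have "Cr_on r (inv_into UNIV \<theta>) UNIV"
    using Cr_on_inverse(3)[OF open_UNIV \<theta> u(2) inj der] by simp
  then show ?thesis
    using that[of "inv_into UNIV \<theta>"] inj surj by (metis \<theta>_def inv_f_f surj_def surj_f_inv_f)
qed

text \<open>
  The perturbation is averaged over the group. Conjugating by an element \<open>T\<close> permutes the patches, so
  each conjugate is C^s for the same structure, and linear maps preserve this under taking means.
\<close>

lemma equivariant_smoothing:
  fixes \<T> :: "(real^'n \<Rightarrow> real^'n) set"
  assumes "smooth_patches r s N \<Lambda>" and "finite_linear_group \<T>"
    and \<Lambda>: "\<And>D l T. (D, l) \<in> \<Lambda> \<Longrightarrow> T \<in> \<T> \<Longrightarrow> (D, T \<circ> l) \<in> \<Lambda>"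
    and N: "\<And>T. T \<in> \<T> \<Longrightarrow> T ` N \<subseteq> N"
    and K: "compact K" "K \<subseteq> N" "\<And>T. T \<in> \<T> \<Longrightarrow> T ` K \<subseteq> K"
  obtains \<theta> \<theta>' L W where "Cr_on r \<theta> UNIV" "Cr_on r \<theta>' UNIV" "\<And>x. \<theta>' (\<theta> x) = x" "\<And>x. \<theta> (\<theta>' x) = x"
    "compact L" "L \<subseteq> N" "\<And>x. x \<notin> L \<Longrightarrow> \<theta> x = x"
    "\<And>T x. T \<in> \<T> \<Longrightarrow> \<theta> (T x) = T (\<theta> x)"
    "open W" "K \<subseteq> W" "\<And>T. T \<in> \<T> \<Longrightarrow> T ` W \<subseteq> W"
    "\<And>D l. (D, l) \<in> \<Lambda> \<Longrightarrow> Cr_on s (\<lambda>x. \<theta> (l x)) (D \<inter> l -` W)"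
proof -
  interpret smooth_patches r s N \<Lambda> by fact
  interpret T: finite_linear_group \<T> by fact
  note fin = T.fin and id = T.id_mem and lin = T.lin and comp = T.comp_mem and inv = T.inverse_ex and Tc = T.continuous_mem
  define J :: "(real^'n \<Rightarrow> real^'n) \<Rightarrow> real^'n \<Rightarrow> real^'n" where "J = inv_into UNIV"
  have I: "J T \<in> \<T>" "T (J T x) = x" "J T (T x) = x" if T: "T \<in> \<T>" for T x
  proof -
    obtain S where S: "S \<in> \<T>" "S \<circ> T = id" "T \<circ> S = id" using inv[OF T] by blast
    then have "J T = S" unfolding J_def by (intro inv_unique_comp)
    then show "J T \<in> \<T>" "T (J T x) = x" "J T (T x) = x"
      using S(1) fun_cong[OF S(2), of x] fun_cong[OF S(3), of x] by simp_all
  qed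
  have "\<exists>b>0. \<forall>v. norm (T v) \<le> b * norm v" if "T \<in> \<T>" for T
    using linear_bounded_pos[OF lin[OF that]] by metis
  then obtain b where b: "\<And>T. T \<in> \<T> \<Longrightarrow> b T > 0 \<and> (\<forall>v. norm (T v) \<le> b T * norm v)" by metis
  define B where "B = sum b \<T>"
  have bB: "b T \<le> B" if "T \<in> \<T>" for T
    unfolding B_def by (rule member_le_sum) (use that b fin in \<open>auto simp: less_imp_le\<close>)
  have B: "B > 0" using bB[OF id] b[OF id] by linarith
  have nB: "norm (T v) \<le> B * norm v" if "T \<in> \<T>" for T v
    using b[OF that] bB[OF that] by (meson mult_right_mono norm_ge_zero order_trans)
  \<comment> \<open>conjugation by a group element enlarges the Lipschitz constant at most by the factor \<open>B * B\<close>\<close>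
  obtain u W where u: "perturbation u (1 / (2 * B * B)) W" "K \<subseteq> W"
    using exists_perturbation[OF K(1,2), of "1 / (2 * B * B)"] B by auto
  then obtain L where L: "compact L" "L \<subseteq> N" "\<And>x. x \<notin> L \<Longrightarrow> u x = 0"
    and ur: "Cr_on r u UNIV" and uL: "\<And>x y. norm (u x - u y) \<le> 1 / (2 * B * B) * norm (x - y)" and W: "open W"
    and us: "\<And>D l. (D, l) \<in> \<Lambda> \<Longrightarrow> Cr_on s (\<lambda>x. l x + u (l x)) (D \<inter> l -` W)"
    unfolding perturbation_def by blast
  define n where "n = real (card \<T>)"
  have n: "n > 0" using fin id by (auto simp: n_def card_gt_0_iff)
  define v where "v y = (1 / n) *\<^sub>R (\<Sum>T\<in>\<T>. J T (u (T y)))" for y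
  have Tr: "Cr_on t T S" if "T \<in> \<T>" "open S" for T t S using Cr_on_linear[OF lin] that by blast
  have vr: "Cr_on r v UNIV"
    unfolding v_def
    by (intro Cr_on_scaleR Cr_on_const Cr_on_sum Cr_on_linear_comp[OF lin[OF I(1)]] Cr_on_compose[OF Tr ur]) auto
  have vL: "norm (v x - v y) \<le> 1 / 2 * norm (x - y)" for x y
  proof -
    have "norm (J T (u (T x)) - J T (u (T y))) \<le> 1 / 2 * norm (x - y)" if T: "T \<in> \<T>" for T
    proof -
      have "norm (J T (u (T x)) - J T (u (T y))) \<le> B * norm (u (T x) - u (T y))"
        using nB[OF I(1)[OF T]] by (simp add: linear_diff[OF lin[OF I(1)[OF T]], symmetric])
      also have "\<dots> \<le> B * (1 / (2 * B * B) * (B * norm (x - y)))"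
      proof (intro mult_left_mono)
        have "norm (u (T x) - u (T y)) \<le> 1 / (2 * B * B) * norm (T x - T y)" by (rule uL)
        also have "\<dots> \<le> 1 / (2 * B * B) * (B * norm (x - y))"
          using nB[OF T, of "x - y"] B by (intro mult_left_mono) (auto simp: linear_diff[OF lin[OF T]])
        finally show "norm (u (T x) - u (T y)) \<le> 1 / (2 * B * B) * (B * norm (x - y))" .
      qed (use B in auto)
      also have "\<dots> = 1 / 2 * norm (x - y)" using B by simp
      finally show ?thesis .
    qed
    then have "norm (\<Sum>T\<in>\<T>. J T (u (T x)) - J T (u (T y))) \<le> (\<Sum>T\<in>\<T>. 1 / 2 * norm (x - y))"
      by (rule sum_norm_le)
    also have "\<dots> = n * (1 / 2 * norm (x - y))" by (simp add: n_def)
    finally have *: "norm (\<Sum>T\<in>\<T>. J T (u (T x)) - J T (u (T y))) \<le> n * (1 / 2 * norm (x - y))" .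
    have "v x - v y = (1 / n) *\<^sub>R (\<Sum>T\<in>\<T>. J T (u (T x)) - J T (u (T y)))"
      by (simp add: v_def sum_subtractf scaleR_diff_right)
    also have "norm \<dots> = norm (\<Sum>T\<in>\<T>. J T (u (T x)) - J T (u (T y))) / n" using n by simp
    also have "\<dots> \<le> 1 / 2 * norm (x - y)" using * n by (simp add: pos_divide_le_eq mult.commute)
    finally show ?thesis .
  qed
  obtain \<theta>' where \<theta>': "Cr_on r \<theta>' UNIV" "\<And>x. \<theta>' (x + v x) = x" "\<And>y. \<theta>' y + v (\<theta>' y) = y"
    using contraction_perturbation_diffeo[OF vr r vL] by blast
  have v_eq: "v (S y) = S (v y)" if S: "S \<in> \<T>" for S y
  proof -
    have lS: "linear S" using lin[OF S] .
    have "(\<Sum>T\<in>\<T>. J T (u (T (S y)))) = (\<Sum>T\<in>\<T>. S (J T (u (T y))))"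
    proof (rule sum.reindex_bij_witness[of _ "\<lambda>T. T \<circ> J S" "\<lambda>T. T \<circ> S"])
      fix T assume T: "T \<in> \<T>"
      show "T \<circ> S \<in> \<T>" "T \<circ> J S \<in> \<T>" using comp T S I by auto
      show "T \<circ> S \<circ> J S = T" "T \<circ> J S \<circ> S = T" using I[OF S] by (auto simp: fun_eq_iff)
      have "J (T \<circ> S) = J S \<circ> J T"
        unfolding J_def by (rule inv_unique_comp) (use I[OF S] I[OF T] in \<open>auto simp: fun_eq_iff J_def\<close>)
      then show "S (J (T \<circ> S) (u ((T \<circ> S) y))) = J T (u (T (S y)))" using I[OF S] by simp
    qed
    then show ?thesis by (simp add: v_def linear_cmul[OF lS] linear_sum[OF lS])
  qed
  define W' where "W' = (\<Inter>T\<in>\<T>. T -` W)"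
  define L' where "L' = (\<Union>T\<in>\<T>. J T ` L)"
  show ?thesis
  proof (rule that[of "\<lambda>x. x + v x" \<theta>' L' W'])
    show "Cr_on r (\<lambda>x. x + v x) UNIV" using vr by (intro Cr_on_add Cr_on_id) auto
    show "compact L'" unfolding L'_def
      using fin L(1) I(1) by (intro compact_UN compact_continuous_image) (auto intro: Tc)
    show "L' \<subseteq> N" unfolding L'_def using L(2) N I(1) by blast
    show "x + v x = x" if "x \<notin> L'" for x
    proof -
      have "T x \<notin> L" if "T \<in> \<T>" for T using \<open>x \<notin> L'\<close> that I(3)[OF that, of x] unfolding L'_def by (metis UN_I imageI)
      then have "J T (u (T x)) = 0" if "T \<in> \<T>" for T
        using that L(3) linear_0[OF lin[OF I(1)[OF that]]] by simp
      then show ?thesis by (simp add: v_def)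
    qed
    show "T x + v (T x) = T (x + v x)" if "T \<in> \<T>" for T x
      using v_eq[OF that] linear_add[OF lin[OF that]] by simp
    show "open W'" unfolding W'_def
      using fin W by (intro open_INT ballI open_vimage Tc) auto
    show "K \<subseteq> W'" using K(3) u(2) by (auto simp: W'_def)
    show "T ` W' \<subseteq> W'" if T: "T \<in> \<T>" for T
    proof -
      have "S (T x) \<in> W" if S: "S \<in> \<T>" and x: "x \<in> W'" for S x
        using x comp[OF S T] unfolding W'_def by (auto dest!: bspec[of _ _ "S \<circ> T"])
      then show ?thesis unfolding W'_def by blast
    qed
    fix D l assume Dl: "(D, l) \<in> \<Lambda>"
    have "open (D \<inter> l -` W')" using patch_open_vimage[OF Dl \<open>open W'\<close>] .
    then show "Cr_on s (\<lambda>x. l x + v (l x)) (D \<inter> l -` W')"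
    proof (rule Cr_on_transform[rotated])
      show "l x + v (l x) = (1 / n) *\<^sub>R (\<Sum>T\<in>\<T>. J T (T (l x) + u (T (l x))))" for x
      proof -
        have "(\<Sum>T\<in>\<T>. J T (T (l x) + u (T (l x)))) = (\<Sum>T\<in>\<T>. l x + J T (u (T (l x))))"
          by (intro sum.cong refl) (simp add: linear_add[OF lin[OF I(1)]] I(3))
        also have "\<dots> = n *\<^sub>R l x + (\<Sum>T\<in>\<T>. J T (u (T (l x))))"
          by (simp add: sum.distrib n_def sum_constant_scaleR del: sum_constant)
        finally show ?thesis using n by (simp add: v_def scaleR_add_right)
      qed
      have "Cr_on s (\<lambda>x. T (l x) + u (T (l x))) (D \<inter> l -` W')" if T: "T \<in> \<T>" for T
      proof -
        have "Cr_on s (\<lambda>x. T (l x) + u (T (l x))) (D \<inter> (T \<circ> l) -` W)"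
          using us[OF \<Lambda>[OF Dl T]] by (simp add: comp_def)
        then show ?thesis by (rule Cr_on_subset) (use T in \<open>auto simp: W'_def\<close>)
      qed
      then show "Cr_on s (\<lambda>x. (1 / n) *\<^sub>R (\<Sum>T\<in>\<T>. J T (T (l x) + u (T (l x))))) (D \<inter> l -` W')"
        by (intro Cr_on_scaleR Cr_on_const Cr_on_sum Cr_on_linear_comp[OF lin[OF I(1)]] \<open>open (D \<inter> l -` W')\<close>)
    qed
  qed (use \<theta>' u in auto)
qed

section \<open>Orbifold charts\<close>

text \<open>
  By invariance of domain.
\<close>

lemma embedding_map_open_iff:
  fixes l :: "'a::euclidean_space \<Rightarrow> 'a"
  assumes "open S"
  shows "embedding_map (top_of_set S) (top_of_set T) l \<longleftrightarrow> continuous_on S l \<and> inj_on l S \<and> l ` S \<subseteq> T"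
proof
  assume e: "embedding_map (top_of_set S) (top_of_set T) l"
  then have h: "homeomorphic_map (top_of_set S) (subtopology (top_of_set T) (l ` S)) l"
    by (simp add: embedding_map_def)
  then show "continuous_on S l \<and> inj_on l S \<and> l ` S \<subseteq> T"
    unfolding homeomorphic_eq_everything_map by (auto simp: continuous_map_in_subtopology)
next
  assume l: "continuous_on S l \<and> inj_on l S \<and> l ` S \<subseteq> T"
  then obtain k where "homeomorphism S (l ` S) l k"
    using invariance_of_domain_homeomorphism[OF assms, of l] by auto
  then have "homeomorphic_maps (top_of_set S) (top_of_set (l ` S)) l k"
    by (auto simp: homeomorphism_def homeomorphic_maps_def)
  then have "homeomorphic_map (top_of_set S) (top_of_set (l ` S)) l"
    by (auto simp: homeomorphic_map_maps)
  then show "embedding_map (top_of_set S) (top_of_set T) l"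
    using l by (simp add: embedding_map_def subtopology_subtopology inf.absorb2)
qed

locale chart =
  fixes X :: "'x topology" and c :: "('a::euclidean_space, 'x) orbifold_chart"
  assumes orbifold_chart: "orbifold_chart X c"
begin

abbreviation "Dom \<equiv> chart_dom c"
abbreviation "Grp \<equiv> chart_group c"
abbreviation "act \<equiv> chart_action c"
abbreviation "\<phi> \<equiv> chart_map c"

sublocale group_action Grp Dom act
  using orbifold_chart by (simp add: orbifold_chart_def)

sublocale group Grp
  using group_hom group_hom.axioms(1) by blast

lemma open_Dom: "open Dom" and connected_Dom: "connected Dom" and finite_Grp: "finite (carrier Grp)"
  and open_image: "openin X (chart_image c)"
  using orbifold_chart by (auto simp: orbifold_chart_def)

lemma act_closed: "g \<in> carrier Grp \<Longrightarrow> x \<in> Dom \<Longrightarrow> act g x \<in> Dom"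
  using element_image by blast

lemma act_one: "x \<in> Dom \<Longrightarrow> act \<one>\<^bsub>Grp\<^esub> x = x"
  using id_eq_one by (metis restrict_apply')

lemma act_inv: assumes "g \<in> carrier Grp" "x \<in> Dom"
  shows "act (inv\<^bsub>Grp\<^esub> g) (act g x) = x" "act g (act (inv\<^bsub>Grp\<^esub> g) x) = x"
  using assms orbit_sym_aux[OF assms refl] orbit_sym_aux[of "inv\<^bsub>Grp\<^esub> g" x] by auto

lemma act_inj: "g \<in> carrier Grp \<Longrightarrow> x \<in> Dom \<Longrightarrow> y \<in> Dom \<Longrightarrow> act g x = act g y \<Longrightarrow> x = y"
  using act_inv(1) by metis

lemma continuous_act: "g \<in> carrier Grp \<Longrightarrow> continuous_on Dom (act g)"
  using orbifold_chart
  by (auto simp: orbifold_chart_def homeomorphic_eq_everything_map continuous_map_in_subtopology)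

lemma open_act_vimage: "g \<in> carrier Grp \<Longrightarrow> open U \<Longrightarrow> open {x \<in> Dom. act g x \<in> U}"
  using continuous_open_preimage[OF continuous_act open_Dom] by (simp add: vimage_def Int_def)

lemma act_image: "g \<in> carrier Grp \<Longrightarrow> U \<subseteq> Dom \<Longrightarrow> act g ` U = {x \<in> Dom. act (inv\<^bsub>Grp\<^esub> g) x \<in> U}"
  using act_inv act_closed by force

lemma open_act_image: "g \<in> carrier Grp \<Longrightarrow> open U \<Longrightarrow> U \<subseteq> Dom \<Longrightarrow> open (act g ` U)"
  using act_image open_act_vimage by simp

lemma topspace_orbit_space: "topspace (orbit_space c) = chart_orbit c ` Dom"
proof -
  have "{x \<in> Dom. chart_orbit c x \<in> chart_orbit c ` Dom} = Dom" by blast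
  then have "openin (orbit_space c) (chart_orbit c ` Dom)" by (simp add: openin_orbit_space)
  moreover have "topspace (orbit_space c) \<subseteq> chart_orbit c ` Dom"
    using openin_topspace[of "orbit_space c"] unfolding openin_orbit_space by (rule conjunct1)
  ultimately show ?thesis using openin_subset by blast
qed

lemma orbit_eq_iff:
  assumes "x \<in> Dom" "y \<in> Dom"
  shows "chart_orbit c x = chart_orbit c y \<longleftrightarrow> (\<exists>g\<in>carrier Grp. y = act g x)"
proof
  assume "chart_orbit c x = chart_orbit c y"
  then have "y \<in> orbit Grp act x" using orbit_refl[OF assms(2)] by (simp add: chart_orbit_def)
  then show "\<exists>g\<in>carrier Grp. y = act g x" by (auto simp: orbit_def)
next
  assume "\<exists>g\<in>carrier Grp. y = act g x"
  then have y: "y \<in> orbit Grp act x" by (auto simp: orbit_def)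
  have sub: "orbit Grp act b \<subseteq> orbit Grp act a" if "a \<in> Dom" "b \<in> Dom" "b \<in> orbit Grp act a" for a b
  proof
    fix z assume z: "z \<in> orbit Grp act b"
    then have "z \<in> Dom" using act_closed that by (auto simp: orbit_def)
    then show "z \<in> orbit Grp act a" using orbit_trans that z by blast
  qed
  show "chart_orbit c x = chart_orbit c y"
    using sub[OF assms y] sub[OF assms(2,1) orbit_sym[OF assms y]] by (simp add: chart_orbit_def)
qed

lemma quotient_map_exists:
  obtains q where "homeomorphic_map (orbit_space c) (subtopology X (chart_image c)) q"
    "\<And>x. x \<in> Dom \<Longrightarrow> q (chart_orbit c x) = \<phi> x"
proof -
  have "\<exists>q. homeomorphic_map (orbit_space c) (subtopology X (chart_image c)) q \<and>
     (\<forall>x\<in>Dom. q (chart_orbit c x) = \<phi> x)"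
    using orbifold_chart unfolding orbifold_chart_def by blast
  then show ?thesis using that by blast
qed

lemma map_eq_iff:
  assumes "x \<in> Dom" "y \<in> Dom"
  shows "\<phi> x = \<phi> y \<longleftrightarrow> (\<exists>g\<in>carrier Grp. y = act g x)"
proof -
  obtain q where q: "homeomorphic_map (orbit_space c) (subtopology X (chart_image c)) q"
    "\<And>x. x \<in> Dom \<Longrightarrow> q (chart_orbit c x) = \<phi> x" using quotient_map_exists by blast
  have "inj_on q (chart_orbit c ` Dom)"
    using q(1) by (simp add: homeomorphic_map_def topspace_orbit_space)
  then have "\<phi> x = \<phi> y \<longleftrightarrow> chart_orbit c x = chart_orbit c y"
    using assms q(2) by (metis imageI inj_onD)
  then show ?thesis by (simp add: orbit_eq_iff[OF assms])
qed

lemma map_act: "g \<in> carrier Grp \<Longrightarrow> x \<in> Dom \<Longrightarrow> \<phi> (act g x) = \<phi> x"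
  using map_eq_iff act_closed by metis

lemma open_map_vimage:
  assumes "openin X U" shows "open {x \<in> Dom. \<phi> x \<in> U}"
proof -
  obtain q where q: "homeomorphic_map (orbit_space c) (subtopology X (chart_image c)) q"
    "\<And>x. x \<in> Dom \<Longrightarrow> q (chart_orbit c x) = \<phi> x" using quotient_map_exists by blast
  have "continuous_map (orbit_space c) X q"
    using homeomorphic_imp_continuous_map[OF q(1)] by (simp add: continuous_map_in_subtopology)
  then have "openin (orbit_space c) {z \<in> topspace (orbit_space c). q z \<in> U}"
    using assms by (simp add: continuous_map_def)
  then have "openin (top_of_set Dom) {x \<in> Dom. chart_orbit c x \<in> {z \<in> topspace (orbit_space c). q z \<in> U}}"
    unfolding openin_orbit_space by blast
  moreover have "{x \<in> Dom. chart_orbit c x \<in> {z \<in> topspace (orbit_space c). q z \<in> U}} = {x \<in> Dom. \<phi> x \<in> U}"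
    using q(2) by (auto simp: topspace_orbit_space)
  ultimately show ?thesis using openin_open_eq[OF open_Dom] by auto
qed

lemma open_map_image:
  assumes "open U" "U \<subseteq> Dom" shows "openin X (\<phi> ` U)"
proof -
  obtain q where q: "homeomorphic_map (orbit_space c) (subtopology X (chart_image c)) q"
    "\<And>x. x \<in> Dom \<Longrightarrow> q (chart_orbit c x) = \<phi> x" using quotient_map_exists by blast
  have "{x \<in> Dom. chart_orbit c x \<in> chart_orbit c ` U} = (\<Union>g\<in>carrier Grp. act g ` U)"
    using assms(2) orbit_eq_iff act_closed by (auto simp: subset_eq image_iff; metis)
  moreover have "open (\<Union>g\<in>carrier Grp. act g ` U)" using open_act_image assms by blast
  moreover have "(\<Union>g\<in>carrier Grp. act g ` U) \<subseteq> Dom" using assms(2) act_closed by blast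
  ultimately have "openin (orbit_space c) (chart_orbit c ` U)"
    using assms(2) by (auto simp: openin_orbit_space openin_open_eq[OF open_Dom])
  then have "openin (subtopology X (chart_image c)) (q ` (chart_orbit c ` U))"
    using homeomorphic_imp_open_map[OF q(1)] by (simp add: open_map_def)
  moreover have "q ` (chart_orbit c ` U) = \<phi> ` U" using q(2) assms(2) by (force simp: image_iff)
  ultimately show ?thesis using open_image by (metis openin_trans_full)
qed

end

text \<open>
  The converse of the facts just proved: the condition on the quotient map says that the chart map is
  continuous and open with the orbits as fibres. Further charts are constructed through this rule.
\<close>

lemma orbifold_chartI:
  fixes c :: "('a::euclidean_space, 'x) orbifold_chart"
  assumes D: "open (chart_dom c)" "connected (chart_dom c)"
    and fin: "finite (carrier (chart_group c))"
    and ga: "group_action (chart_group c) (chart_dom c) (chart_action c)"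
    and cont: "\<And>g. g \<in> carrier (chart_group c) \<Longrightarrow> continuous_on (chart_dom c) (chart_action c g)"
    and vim: "\<And>U. openin X U \<Longrightarrow> open {x \<in> chart_dom c. chart_map c x \<in> U}"
    and im: "\<And>U. open U \<Longrightarrow> U \<subseteq> chart_dom c \<Longrightarrow> openin X (chart_map c ` U)"
    and eq: "\<And>x y. x \<in> chart_dom c \<Longrightarrow> y \<in> chart_dom c \<Longrightarrow>
      chart_map c x = chart_map c y \<longleftrightarrow> (\<exists>g\<in>carrier (chart_group c). y = chart_action c g x)"
  shows "orbifold_chart X c"
proof -
  interpret group_action "chart_group c" "chart_dom c" "chart_action c" by fact
  interpret group "chart_group c" using group_hom group_hom.axioms(1) by blast
  let ?D = "chart_dom c" and ?o = "chart_orbit c" and ?\<phi> = "chart_map c"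
  have homeo: "homeomorphic_map (top_of_set ?D) (top_of_set ?D) (chart_action c g)"
    if g: "g \<in> carrier (chart_group c)" for g
  proof -
    have "bij_betw (chart_action c g) ?D ?D" using bij_prop0[OF g] by (simp add: Bij_def)
    then have "chart_action c g ` ?D = ?D" "inj_on (chart_action c g) ?D" by (auto simp: bij_betw_def)
    moreover from this obtain k where "homeomorphism ?D (chart_action c g ` ?D) (chart_action c g) k"
      using invariance_of_domain_homeomorphism[OF D(1) cont[OF g]] by auto
    ultimately have "homeomorphic_maps (top_of_set ?D) (top_of_set ?D) (chart_action c g) k"
      by (auto simp: homeomorphism_def homeomorphic_maps_def)
    then show ?thesis by (auto simp: homeomorphic_map_maps)
  qed
  have orb: "?o x = ?o y \<longleftrightarrow> ?\<phi> x = ?\<phi> y" if xy: "x \<in> ?D" "y \<in> ?D" for x y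
  proof
    assume "?o x = ?o y"
    then have "y \<in> orbit (chart_group c) (chart_action c) x"
      using orbit_refl[OF xy(2)] by (simp add: chart_orbit_def)
    then show "?\<phi> x = ?\<phi> y" using eq[OF xy] by (auto simp: orbit_def)
  next
    assume "?\<phi> x = ?\<phi> y"
    then obtain g where g: "g \<in> carrier (chart_group c)" "y = chart_action c g x" using eq[OF xy] by blast
    then have y: "y \<in> orbit (chart_group c) (chart_action c) x" by (auto simp: orbit_def)
    have sub: "orbit (chart_group c) (chart_action c) b \<subseteq> orbit (chart_group c) (chart_action c) a"
      if "a \<in> ?D" "b \<in> ?D" "b \<in> orbit (chart_group c) (chart_action c) a" for a b
    proof
      fix z assume z: "z \<in> orbit (chart_group c) (chart_action c) b"
      then have "z \<in> ?D" using element_image that by (auto simp: orbit_def)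
      then show "z \<in> orbit (chart_group c) (chart_action c) a" using orbit_trans that z by blast
    qed
    show "?o x = ?o y"
      using sub[OF xy y] sub[OF xy(2,1) orbit_sym[OF xy y]] by (simp add: chart_orbit_def)
  qed
  define q where "q z = ?\<phi> (inv_into ?D ?o z)" for z
  have q: "q (?o x) = ?\<phi> x" if "x \<in> ?D" for x
  proof -
    have "inv_into ?D ?o (?o x) \<in> ?D" "?o (inv_into ?D ?o (?o x)) = ?o x"
      using that by (auto simp: inv_into_into f_inv_into_f)
    then show ?thesis using orb[of "inv_into ?D ?o (?o x)" x] that by (simp add: q_def)
  qed
  have "{x \<in> ?D. ?o x \<in> ?o ` ?D} = ?D" by blast
  then have "openin (orbit_space c) (?o ` ?D)" by (simp add: openin_orbit_space)
  moreover have "topspace (orbit_space c) \<subseteq> ?o ` ?D"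
    using openin_topspace[of "orbit_space c"] unfolding openin_orbit_space by (rule conjunct1)
  ultimately have top: "topspace (orbit_space c) = ?o ` ?D" using openin_subset by blast
  have img: "openin X (chart_image c)" using im[OF D(1)] by (simp add: chart_image_def)
  have "homeomorphic_map (orbit_space c) (subtopology X (chart_image c)) q"
  proof (rule bijective_open_imp_homeomorphic_map)
    have qi: "q ` topspace (orbit_space c) = chart_image c"
      unfolding top chart_image_def using q by (force simp: image_iff)
    then show "q ` topspace (orbit_space c) = topspace (subtopology X (chart_image c))"
      using openin_subset[OF img] by (auto simp: topspace_subtopology)
    show "inj_on q (topspace (orbit_space c))" unfolding top using q orb by (auto simp: inj_on_def)
    have "openin (orbit_space c) {z \<in> topspace (orbit_space c). q z \<in> U}" if "openin X U" for U
    proof -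
      have "{x \<in> ?D. ?o x \<in> {z \<in> topspace (orbit_space c). q z \<in> U}} = {x \<in> ?D. ?\<phi> x \<in> U}"
        using q by (auto simp: top)
      then show ?thesis using vim[OF that] by (auto simp: openin_orbit_space top openin_open_eq[OF D(1)])
    qed
    then have "continuous_map (orbit_space c) X q"
      using qi openin_subset[OF img] by (auto simp: continuous_map_def)
    then show "continuous_map (orbit_space c) (subtopology X (chart_image c)) q"
      using qi by (auto simp: continuous_map_in_subtopology)
    have "openin X (q ` W)" if "openin (orbit_space c) W" for W
    proof -
      let ?U = "{x \<in> ?D. ?o x \<in> W}"
      have W: "W \<subseteq> ?o ` ?D" "open ?U" using that by (auto simp: openin_orbit_space openin_open_eq[OF D(1)])
      have "q ` W = ?\<phi> ` ?U" using W(1) q by (force simp: image_iff subset_eq)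
      then show ?thesis using im[OF W(2)] by auto
    qed
    moreover have "q ` W \<subseteq> chart_image c" if "openin (orbit_space c) W" for W
      using openin_subset[OF that] qi by blast
    ultimately show "open_map (orbit_space c) (subtopology X (chart_image c)) q"
      by (simp add: open_map_def openin_open_subtopology[OF img])
  qed
  then show ?thesis unfolding orbifold_chart_def using D fin ga homeo img q by blast
qed

definition Cr_action :: "enat \<Rightarrow> ('a::euclidean_space, 'x) orbifold_chart \<Rightarrow> bool" where
  "Cr_action s c \<longleftrightarrow> (\<forall>g\<in>carrier (chart_group c). Cr_on s (chart_action c g) (chart_dom c))"

context chart begin

lemma Cr_action_iff:
  "Cr_action s c \<longleftrightarrow> (\<forall>g \<in> carrier Grp. Cr_diffeomorphism s Dom Dom (act g))"
proof
  assume a: "Cr_action s c"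
  show "\<forall>g \<in> carrier Grp. Cr_diffeomorphism s Dom Dom (act g)"
  proof
    fix g assume g: "g \<in> carrier Grp"
    then have g': "inv\<^bsub>Grp\<^esub> g \<in> carrier Grp" by simp
    have "homeomorphism Dom Dom (act g) (act (inv\<^bsub>Grp\<^esub> g))"
      using g g' by (auto intro!: homeomorphismI continuous_act act_closed simp: act_inv)
    then show "Cr_diffeomorphism s Dom Dom (act g)"
      unfolding Cr_diffeomorphism_def using a g g' by (auto simp: Cr_action_def)
  qed
qed (auto simp: Cr_action_def Cr_diffeomorphism_def)

end

section \<open>Linearization of smooth actions\<close>

text \<open>
  Near \<open>p\<close> the derivative of \<open>\<psi> x - x\<close> has norm at most 1/2.
\<close>

lemma near_identity_injective:
  fixes \<psi> :: "'a::euclidean_space \<Rightarrow> 'a"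
  assumes D: "open D" "p \<in> D" and \<psi>: "Cr_on s \<psi> D" "1 \<le> s" and der: "(\<psi> has_derivative (\<lambda>v. v)) (at p)"
  obtains \<delta> where "\<delta> > 0" "ball p \<delta> \<subseteq> D" "inj_on \<psi> (ball p \<delta>)"
    "\<And>x v. x \<in> ball p \<delta> \<Longrightarrow> frechet_derivative \<psi> (at x) v = 0 \<Longrightarrow> v = 0"
proof -
  let ?D = "\<lambda>x. frechet_derivative \<psi> (at x)"
  have d\<psi>: "(\<psi> has_derivative ?D x) (at x)" if "x \<in> D" for x using Cr_on_has_derivative[OF \<psi> that] .
  have Dp: "?D p = (\<lambda>v. v)" using frechet_derivative_at[OF der] by simp
  define e where "e = 1 / 2 / real DIM('a)"
  have e: "e > 0" by (simp add: e_def)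
  have "\<exists>d>0. \<forall>x\<in>D. dist x p < d \<longrightarrow> norm (?D x b - b) \<le> e" for b
  proof -
    obtain d where "d > 0" "\<forall>x\<in>D. dist x p < d \<longrightarrow> dist (?D x b) (?D p b) < e"
      using Cr_on_frechet_continuous[OF \<psi>, of b] D(2) e unfolding continuous_on_iff by metis
    then show ?thesis by (intro exI[of _ d]) (auto simp: Dp dist_norm less_imp_le)
  qed
  then obtain d where d: "\<And>b. d b > 0" "\<And>b x. x \<in> D \<Longrightarrow> dist x p < d b \<Longrightarrow> norm (?D x b - b) \<le> e"
    by metis
  obtain d0 where d0: "d0 > 0" "ball p d0 \<subseteq> D" using D open_contains_ball by blast
  define \<delta> where "\<delta> = Min (insert d0 (d ` Basis))"
  have \<delta>: "\<delta> > 0" "\<delta> \<le> d0" "\<And>b. b \<in> Basis \<Longrightarrow> \<delta> \<le> d b"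
    using d d0 by (auto simp: \<delta>_def intro: min.coboundedI2)
  have sub: "ball p \<delta> \<subseteq> D" using d0 \<delta>(2) by force
  have bd: "norm (?D x v - v) \<le> 1 / 2 * norm v" if x: "x \<in> ball p \<delta>" for x v
  proof (rule linear_bound_Basis[of "\<lambda>v. ?D x v - v"])
    have xD: "x \<in> D" using x sub by blast
    have "linear (?D x)" using d\<psi>[OF xD] by (simp add: has_derivative_bounded_linear bounded_linear.linear)
    then show "linear (\<lambda>v. ?D x v - v)" by (intro linear_compose_sub linear_ident)
    show "norm (?D x b - b) \<le> 1 / 2 / real DIM('a)" if "b \<in> Basis" for b
      using d(2)[OF xD, of b] \<delta>(3)[OF that] x unfolding e_def mem_ball dist_commute[of p x] by linarith
  qed
  show ?thesis
  proof (rule that[OF \<delta>(1) sub])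
    show "inj_on \<psi> (ball p \<delta>)"
    proof (rule inj_onI)
      fix x y assume xy: "x \<in> ball p \<delta>" "y \<in> ball p \<delta>" "\<psi> x = \<psi> y"
      have "norm ((\<psi> x - x) - (\<psi> y - y)) \<le> 1 / 2 * norm (x - y)"
      proof (rule differentiable_bound[of "ball p \<delta>" "\<lambda>x. \<psi> x - x" "\<lambda>x v. ?D x v - v"])
        show "((\<lambda>x. \<psi> x - x) has_derivative (\<lambda>v. ?D x v - v)) (at x within ball p \<delta>)" if "x \<in> ball p \<delta>" for x
          using that sub by (intro has_derivative_at_withinI[OF has_derivative_diff] has_derivative_ident d\<psi>) blast
        show "onorm (\<lambda>v. ?D x v - v) \<le> 1 / 2" if "x \<in> ball p \<delta>" for x
          using bd[OF that] by (rule onorm_le)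
      qed (use xy(1,2) in auto)
      then have "norm (y - x) \<le> 1 / 2 * norm (x - y)" unfolding xy(3) by simp
      then show "x = y" by (simp add: norm_minus_commute)
    qed
    show "v = 0" if "x \<in> ball p \<delta>" "?D x v = 0" for x v
      using bd[OF that(1), of v] that(2) by simp
  qed
qed

locale smooth_chart = chart X c for X :: "'x topology" and c :: "(real^'n, 'x) orbifold_chart" +
  fixes s :: enat
  assumes smooth_action: "Cr_action s c" and s: "1 \<le> s"
begin

definition isotropy :: "real^'n \<Rightarrow> nat \<Rightarrow> real^'n \<Rightarrow> real^'n" where
  "isotropy p g = frechet_derivative (act g) (at p)"

lemma Cr_act: "g \<in> carrier Grp \<Longrightarrow> Cr_on s (act g) Dom"
  using smooth_action by (simp add: Cr_action_def)

lemma act_has_derivative: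
  "g \<in> carrier Grp \<Longrightarrow> p \<in> Dom \<Longrightarrow> (act g has_derivative isotropy p g) (at p)"
  unfolding isotropy_def using Cr_on_has_derivative[OF Cr_act s] .

lemma stabD: "g \<in> stabilizer Grp act p \<Longrightarrow> g \<in> carrier Grp \<and> act g p = p"
  by (simp add: stabilizer_def)

lemma isotropy_mult:
  assumes p: "p \<in> Dom" and g: "g \<in> stabilizer Grp act p" and h: "h \<in> stabilizer Grp act p"
  shows "isotropy p (g \<otimes>\<^bsub>Grp\<^esub> h) = isotropy p g \<circ> isotropy p h"
proof -
  note g' = stabD[OF g] and h' = stabD[OF h]
  have "((\<lambda>x. act g (act h x)) has_derivative (\<lambda>v. isotropy p g (isotropy p h v))) (at p)"
    using has_derivative_compose[OF act_has_derivative, of h p "act g"] act_has_derivative[of g p] p g' h' by simp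
  then have "(act (g \<otimes>\<^bsub>Grp\<^esub> h) has_derivative (\<lambda>v. isotropy p g (isotropy p h v))) (at p)"
    by (rule has_derivative_transform_within_open[OF _ open_Dom p]) (simp add: composition_rule g' h')
  from frechet_derivative_at[OF this] show ?thesis by (simp add: isotropy_def comp_def)
qed

lemma isotropy_one: assumes p: "p \<in> Dom" shows "isotropy p \<one>\<^bsub>Grp\<^esub> = id"
proof -
  have "(act \<one>\<^bsub>Grp\<^esub> has_derivative (\<lambda>v. v)) (at p)"
    by (rule has_derivative_transform_within_open[OF has_derivative_ident open_Dom p]) (simp add: act_one)
  from frechet_derivative_at[OF this] show ?thesis by (simp add: isotropy_def id_def)
qed

lemma stab_subgroup: "p \<in> Dom \<Longrightarrow> subgroup (stabilizer Grp act p) Grp"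
  by (rule stabilizer_subgroup)

lemma isotropy_group: assumes p: "p \<in> Dom"
  shows "finite_linear_group (isotropy p ` stabilizer Grp act p)"
proof (rule finite_linear_group.intro)
  note sg = stab_subgroup[OF p]
  show "finite (isotropy p ` stabilizer Grp act p)"
    using finite_Grp by (auto simp: stabilizer_def)
  show "id \<in> isotropy p ` stabilizer Grp act p"
    using isotropy_one[OF p] subgroup.one_closed[OF sg] by (metis imageI)
  show "linear T" if "T \<in> isotropy p ` stabilizer Grp act p" for T
    using that act_has_derivative[OF _ p] has_derivative_bounded_linear bounded_linear.linear stabD by blast
  show "S \<circ> T \<in> isotropy p ` stabilizer Grp act p"
    if "S \<in> isotropy p ` stabilizer Grp act p" "T \<in> isotropy p ` stabilizer Grp act p" for S T
    using that isotropy_mult[OF p] subgroup.m_closed[OF sg] by (auto simp: image_iff) metis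
  show "\<exists>S\<in>isotropy p ` stabilizer Grp act p. S \<circ> T = id \<and> T \<circ> S = id"
    if T: "T \<in> isotropy p ` stabilizer Grp act p" for T
  proof -
    obtain g where g: "g \<in> stabilizer Grp act p" "T = isotropy p g" using T by blast
    have gi: "inv\<^bsub>Grp\<^esub> g \<in> stabilizer Grp act p" using subgroup.m_inv_closed[OF sg g(1)] .
    have "isotropy p (inv\<^bsub>Grp\<^esub> g) \<circ> T = id" "T \<circ> isotropy p (inv\<^bsub>Grp\<^esub> g) = id"
      using isotropy_mult[OF p gi g(1)] isotropy_mult[OF p g(1) gi] stabD[OF g(1)] isotropy_one[OF p] g(2) by simp_all
    then show ?thesis using gi by blast
  qed
qed

abbreviation iball :: "real^'n \<Rightarrow> real \<Rightarrow> (real^'n) set" where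
  "iball p \<equiv> finite_linear_group.polyball (isotropy p ` stabilizer Grp act p)"

text \<open>
  Bochner's theorem. The mean over the isotropy group of the maps
  \<open>y \<mapsto> Dh(p)^(-1) (h y - p)\<close> has derivative 1 at \<open>p\<close> and intertwines the action with its
  derivative at \<open>p\<close>; its local inverse is the required parametrization.
\<close>

lemma linearization:
  assumes p: "p \<in> Dom" and W: "open W" "p \<in> W"
  obtains \<rho> l where "\<rho> > 0" "Cr_on s l (iball p \<rho>)" "inj_on l (iball p \<rho>)" "l ` iball p \<rho> \<subseteq> W \<inter> Dom"
    "open (l ` iball p \<rho>)" "Cr_on s (inv_into (iball p \<rho>) l) (l ` iball p \<rho>)" "l 0 = p"
    "\<And>h z. h \<in> stabilizer Grp act p \<Longrightarrow> z \<in> iball p \<rho> \<Longrightarrow> act h (l z) = l (isotropy p h z)"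
    "\<And>g z z'. g \<in> carrier Grp \<Longrightarrow> z \<in> iball p \<rho> \<Longrightarrow> z' \<in> iball p \<rho> \<Longrightarrow> act g (l z) = l z' \<Longrightarrow>
      g \<in> stabilizer Grp act p"
proof -
  let ?H = "stabilizer Grp act p" and ?T = "isotropy p"
  note sg = stab_subgroup[OF p]
  interpret T: finite_linear_group "?T ` ?H" by (rule isotropy_group[OF p])
  have linT: "linear (?T h)" if "h \<in> ?H" for h using T.lin that by blast
  have finH: "finite ?H" using finite_Grp by (simp add: stabilizer_def)
  have invH: "inv\<^bsub>Grp\<^esub> h \<in> ?H" if "h \<in> ?H" for h using subgroup.m_inv_closed[OF sg that] .
  have oneH: "\<one>\<^bsub>Grp\<^esub> \<in> ?H" using subgroup.one_closed[OF sg] .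
  define n where "n = real (card ?H)"
  have n: "n > 0" using finH oneH by (auto simp: n_def card_gt_0_iff)
  define \<psi> where "\<psi> y = (1 / n) *\<^sub>R (\<Sum>h\<in>?H. ?T (inv\<^bsub>Grp\<^esub> h) (act h y - p))" for y
  have T_inv: "?T (inv\<^bsub>Grp\<^esub> h) (?T h v) = v" if "h \<in> ?H" for h v
    using fun_cong[OF isotropy_mult[OF p invH[OF that] that], of v] isotropy_one[OF p] stabD[OF that] by simp
  have \<psi>s: "Cr_on s \<psi> Dom"
  proof -
    have "Cr_on s (\<lambda>y. ?T (inv\<^bsub>Grp\<^esub> h) (act h y - p)) Dom" if h: "h \<in> ?H" for h
      using stabD[OF h]
      by (intro Cr_on_linear_comp[OF linT[OF invH[OF h]] open_Dom] Cr_on_diff open_Dom Cr_act Cr_on_const) auto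
    then show ?thesis
      unfolding \<psi>_def by (intro Cr_on_scaleR Cr_on_sum open_Dom Cr_on_const)
  qed
  have \<psi>d: "(\<psi> has_derivative (\<lambda>v. v)) (at p)"
  proof -
    have "((\<lambda>y. ?T (inv\<^bsub>Grp\<^esub> h) (act h y - p)) has_derivative (\<lambda>v. v)) (at p)" if h: "h \<in> ?H" for h
    proof -
      have "((\<lambda>y. act h y - p) has_derivative (\<lambda>v. ?T h v - 0)) (at p)"
        using stabD[OF h] by (intro has_derivative_diff act_has_derivative p has_derivative_const) auto
      then have "((\<lambda>y. ?T (inv\<^bsub>Grp\<^esub> h) (act h y - p)) has_derivative (\<lambda>v. ?T (inv\<^bsub>Grp\<^esub> h) (?T h v - 0))) (at p)"
        by (rule bounded_linear.has_derivative[OF linT[OF invH[OF h], unfolded linear_conv_bounded_linear]])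
      then show ?thesis by (simp add: T_inv[OF h])
    qed
    then have "((\<lambda>y. (1 / n) *\<^sub>R (\<Sum>h\<in>?H. ?T (inv\<^bsub>Grp\<^esub> h) (act h y - p))) has_derivative
      (\<lambda>v. (1 / n) *\<^sub>R (\<Sum>h\<in>?H. v))) (at p)"
      by (intro has_derivative_scaleR_right has_derivative_sum)
    moreover have "(1 / n) *\<^sub>R (\<Sum>h\<in>?H. v) = v" for v :: "real^'n"
      using n by (simp add: n_def sum_constant_scaleR del: sum_constant)
    ultimately show ?thesis unfolding \<psi>_def by simp
  qed
  have \<psi>p: "\<psi> p = 0" by (simp add: \<psi>_def linear_0[OF linT[OF invH]] stabD)
  have equi: "\<psi> (act h y) = ?T h (\<psi> y)" if h: "h \<in> ?H" and y: "y \<in> Dom" for h y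
  proof -
    have "(\<Sum>k\<in>?H. ?T (inv\<^bsub>Grp\<^esub> k) (act k (act h y) - p)) = (\<Sum>k\<in>?H. ?T h (?T (inv\<^bsub>Grp\<^esub> k) (act k y - p)))"
    proof (rule sum.reindex_bij_witness[of _ "\<lambda>k. k \<otimes>\<^bsub>Grp\<^esub> inv\<^bsub>Grp\<^esub> h" "\<lambda>k. k \<otimes>\<^bsub>Grp\<^esub> h"])
      fix k assume k: "k \<in> ?H"
      note hc = stabD[OF h] and kc = stabD[OF k]
      show "k \<otimes>\<^bsub>Grp\<^esub> h \<in> ?H" "k \<otimes>\<^bsub>Grp\<^esub> inv\<^bsub>Grp\<^esub> h \<in> ?H"
        using subgroup.m_closed[OF sg] h k invH by auto
      show "k \<otimes>\<^bsub>Grp\<^esub> h \<otimes>\<^bsub>Grp\<^esub> inv\<^bsub>Grp\<^esub> h = k" "k \<otimes>\<^bsub>Grp\<^esub> inv\<^bsub>Grp\<^esub> h \<otimes>\<^bsub>Grp\<^esub> h = k"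
        using hc kc by (simp_all add: m_assoc)
      have "?T (inv\<^bsub>Grp\<^esub> (k \<otimes>\<^bsub>Grp\<^esub> h)) = ?T (inv\<^bsub>Grp\<^esub> h) \<circ> ?T (inv\<^bsub>Grp\<^esub> k)"
        using isotropy_mult[OF p invH[OF h] invH[OF k]] hc kc by (simp add: inv_mult_group)
      then have "?T h (?T (inv\<^bsub>Grp\<^esub> (k \<otimes>\<^bsub>Grp\<^esub> h)) v) = ?T (inv\<^bsub>Grp\<^esub> k) v" for v
        using T_inv[OF invH[OF h]] hc by simp
      then show "?T h (?T (inv\<^bsub>Grp\<^esub> (k \<otimes>\<^bsub>Grp\<^esub> h)) (act (k \<otimes>\<^bsub>Grp\<^esub> h) y - p)) = ?T (inv\<^bsub>Grp\<^esub> k) (act k (act h y) - p)"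
        using hc kc y by (simp add: composition_rule)
    qed
    then show ?thesis by (simp add: \<psi>_def linear_cmul[OF linT[OF h]] linear_sum[OF linT[OF h]])
  qed
  obtain \<delta> where \<delta>: "\<delta> > 0" "ball p \<delta> \<subseteq> Dom" "inj_on \<psi> (ball p \<delta>)"
    "\<And>x v. x \<in> ball p \<delta> \<Longrightarrow> frechet_derivative \<psi> (at x) v = 0 \<Longrightarrow> v = 0"
    by (rule near_identity_injective[OF open_Dom p \<psi>s s \<psi>d]) blast
  let ?B = "ball p \<delta>"
  have inv\<psi>: "Cr_on s (inv_into ?B \<psi>) (\<psi> ` ?B)"
    by (rule Cr_on_inverse(3)[OF open_ball Cr_on_subset[OF \<psi>s \<delta>(2)] s \<delta>(3)]) (rule \<delta>(4))
  \<comment> \<open>the parametrization, called \<open>l\<close> in the statement\<close>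
  define k where "k = inv_into ?B \<psi>"
  have "\<exists>V. open V \<and> p \<in> V \<and> V \<subseteq> Dom \<and> (\<forall>x\<in>V. \<forall>y\<in>V. act g x \<noteq> y)"
    if g: "g \<in> carrier Grp - ?H" for g
  proof -
    have "act g p \<noteq> p" using g by (simp add: stabilizer_def)
    then obtain U V where UV: "open U" "open V" "act g p \<in> U" "p \<in> V" "U \<inter> V = {}" using separation_t2 by metis
    then show ?thesis using g p open_act_vimage[of g U]
      by (intro exI[of _ "{x \<in> Dom. act g x \<in> U} \<inter> V"]) auto
  qed
  then obtain V where V: "\<And>g. g \<in> carrier Grp - ?H \<Longrightarrow> open (V g) \<and> p \<in> V g \<and> (\<forall>x\<in>V g. \<forall>y\<in>V g. act g x \<noteq> y)"
    by metis
  define U where "U = ?B \<inter> W \<inter> (\<Inter>h\<in>?H. {x \<in> Dom. act h x \<in> ?B}) \<inter> (\<Inter>g\<in>carrier Grp - ?H. V g)"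
  have U: "open U" "p \<in> U" "U \<subseteq> ?B"
  proof -
    have "open {x \<in> Dom. act h x \<in> ?B}" if "h \<in> ?H" for h
      using stabD[OF that] by (intro open_act_vimage) auto
    moreover have "open (V g)" "p \<in> V g" if "g \<in> carrier Grp - ?H" for g using V[OF that] by auto
    ultimately show "open U" unfolding U_def
      using finH finite_Grp W(1) by (intro open_Int open_INT) auto
    show "p \<in> U"
      unfolding U_def using W(2) \<delta>(1) p stabD V by auto
  qed (auto simp: U_def)
  have o: "open (\<psi> ` U)"
    using invariance_of_domain[OF continuous_on_subset[OF Cr_on_continuous[OF \<psi>s]] U(1) inj_on_subset[OF \<delta>(3) U(3)]] U(3) \<delta>(2) by blast
  have "0 \<in> \<psi> ` U" using U(2) \<psi>p by force
  then obtain \<rho> where \<rho>: "\<rho> > 0" "ball 0 \<rho> \<subseteq> \<psi> ` U" using o open_contains_ball by blast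
  let ?D = "T.polyball \<rho>"
  have D: "?D \<subseteq> \<psi> ` U" using T.polyball_subset \<rho>(2) by blast
  have k: "k z \<in> U" "\<psi> (k z) = z" if z: "z \<in> ?D" for z
  proof -
    obtain x where x: "x \<in> U" "z = \<psi> x" using D z by blast
    then have "k z = x" using U(3) \<delta>(3) by (auto simp: k_def inv_into_f_f)
    then show "k z \<in> U" "\<psi> (k z) = z" using x by auto
  qed
  have k\<psi>: "k (\<psi> x) = x" if "x \<in> ?B" for x using that \<delta>(3) by (simp add: k_def)
  have kD: "k ` ?D = {x \<in> ?B. \<psi> x \<in> ?D}" using k k\<psi> U(3) by force
  show ?thesis
  proof (rule that[OF \<rho>(1), of k])
    show ks: "Cr_on s k ?D"
      using inv\<psi> unfolding k_def by (rule Cr_on_subset) (rule order_trans[OF D image_mono[OF U(3)]])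
    show ki: "inj_on k ?D" using k(2) by (metis inj_onI)
    show kU: "k ` ?D \<subseteq> W \<inter> Dom" using k(1) U(3) \<delta>(2) unfolding U_def by blast
    show ok: "open (k ` ?D)"
      using invariance_of_domain[OF Cr_on_continuous[OF ks] T.open_polyball ki] .
    have "Cr_on s \<psi> (k ` ?D)" by (rule Cr_on_subset[OF \<psi>s]) (use kU in blast)
    moreover have "inv_into ?D k x = \<psi> x" if "x \<in> k ` ?D" for x using that ki k(2) by auto
    ultimately show "Cr_on s (inv_into ?D k) (k ` ?D)" using Cr_on_transform ok by blast
    show "k 0 = p" using k\<psi>[of p] \<psi>p \<delta>(1) by simp
    show "act h (k z) = k (?T h z)" if h: "h \<in> ?H" and z: "z \<in> ?D" for h z
    proof -
      have kz: "k z \<in> Dom" "act h (k z) \<in> ?B" using k(1)[OF z] h unfolding U_def by auto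
      have "\<psi> (act h (k z)) = ?T h z" using equi[OF h kz(1)] k(2)[OF z] by simp
      then show ?thesis using k\<psi>[OF kz(2)] by simp
    qed
    show "g \<in> ?H" if "g \<in> carrier Grp" "z \<in> ?D" "z' \<in> ?D" "act g (k z) = k z'" for g z z'
    proof (rule ccontr)
      assume "g \<notin> ?H"
      then have g: "g \<in> carrier Grp - ?H" using that by blast
      then have "k z \<in> V g" "k z' \<in> V g" using k(1) that(2,3) unfolding U_def by blast+
      then show False using V[OF g] that(4) by blast
    qed
  qed
qed

text \<open>
  The smooth case of Newman's theorem: an element that fixes an open set acts trivially. In a linear
  chart at a boundary point of the interior of the fixed point set, the element is a linear map that
  is the identity on an open set; hence that interior is closed, and the domain is connected.
\<close>

lemma rigid:
  assumes g: "g \<in> carrier Grp" and U: "open U" "U \<noteq> {}" "U \<subseteq> Dom" "\<And>x. x \<in> U \<Longrightarrow> act g x = x"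
  shows "g \<in> chart_kernel c"
proof -
  define A where "A = interior {x \<in> Dom. act g x = x}"
  have A: "A \<subseteq> Dom" "\<And>x. x \<in> A \<Longrightarrow> act g x = x"
    using interior_subset[of "{x \<in> Dom. act g x = x}"] by (auto simp: A_def)
  have UA: "U \<subseteq> A" unfolding A_def by (rule interior_maximal) (use U in auto)
  have "p \<in> A" if p: "p \<in> Dom" "p \<in> closure A" for p
  proof -
    have "closedin (top_of_set Dom) {x \<in> Dom. act g x - x = 0}"
      by (intro continuous_closedin_preimage_constant continuous_on_diff continuous_act g continuous_on_id)
    then obtain C where C: "closed C" "{x \<in> Dom. act g x - x = 0} = Dom \<inter> C" by (auto simp: closedin_closed)
    have "A \<subseteq> C" using A C(2) by auto
    then have "p \<in> C" using p(2) closure_minimal[OF _ C(1)] by blast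
    then have gp: "act g p = p" using C(2) p(1) by auto
    then have gH: "g \<in> stabilizer Grp act p" using g by (simp add: stabilizer_def)
    interpret T: finite_linear_group "isotropy p ` stabilizer Grp act p" by (rule isotropy_group[OF p(1)])
    obtain \<rho> l where l: "\<rho> > 0" "Cr_on s l (iball p \<rho>)" "inj_on l (iball p \<rho>)" "l ` iball p \<rho> \<subseteq> UNIV \<inter> Dom"
      "open (l ` iball p \<rho>)" "l 0 = p"
      "\<And>h z. h \<in> stabilizer Grp act p \<Longrightarrow> z \<in> iball p \<rho> \<Longrightarrow> act h (l z) = l (isotropy p h z)"
      by (rule linearization[OF p(1) open_UNIV UNIV_I]) blast
    have p_in: "p \<in> l ` iball p \<rho>" using l(6) T.zero_in_polyball[OF l(1)] by blast
    then have "l ` iball p \<rho> \<inter> A \<noteq> {}" using p(2) l(5) by (metis disjoint_iff open_Int_closure_eq_empty inf_commute)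
    then have ne: "iball p \<rho> \<inter> l -` A \<noteq> {}" by blast
    have op: "open (iball p \<rho> \<inter> l -` A)"
      using continuous_open_preimage[OF Cr_on_continuous[OF l(2)] T.open_polyball] by (simp add: A_def)
    have "isotropy p g = id"
    proof (rule linear_eq_on_open[OF _ linear_id op ne])
      show "linear (isotropy p g)" using T.lin gH by blast
      fix z assume z: "z \<in> iball p \<rho> \<inter> l -` A"
      then have "l (isotropy p g z) = l z" using l(7)[OF gH, of z] A(2) by auto
      then show "isotropy p g z = id z"
        using l(3) z T.polyball_invariant[of "isotropy p g" z] gH by (auto simp: inj_on_eq_iff)
    qed
    then have "act g x = x" if "x \<in> l ` iball p \<rho>" for x using l(7)[OF gH] that by auto
    then have "l ` iball p \<rho> \<subseteq> A" unfolding A_def using l(4,5) by (intro interior_maximal) auto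
    then show ?thesis using p_in by blast
  qed
  then have "A = Dom \<inter> closure A" using A(1) closure_subset[of A] by blast
  then have "closedin (top_of_set Dom) A" unfolding closedin_closed using closed_closure by blast
  moreover have "openin (top_of_set Dom) A" using A(1) by (simp add: A_def openin_open_eq[OF open_Dom])
  ultimately have "A = Dom" using connected_Dom UA U(2) unfolding connected_clopen by blast
  then show ?thesis using A(2) g by (simp add: chart_kernel_def)
qed

end

section \<open>Chart embeddings, lifts and subcharts\<close>

lemma chart_kernel_subset: "chart_kernel c \<subseteq> carrier (chart_group c)"
  by (auto simp: chart_kernel_def)

lemma chart_embeddingD:
  fixes c d :: "('a::euclidean_space, 'x) orbifold_chart"
  assumes "chart_embedding c d l h" "open (chart_dom c)"
  shows "h \<in> hom (chart_group c) (chart_group d)" "inj_on h (carrier (chart_group c))"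
    "bij_betw h (chart_kernel c) (chart_kernel d)" "continuous_on (chart_dom c) l" "inj_on l (chart_dom c)"
    "l ` chart_dom c \<subseteq> chart_dom d"
    "\<And>g x. g \<in> carrier (chart_group c) \<Longrightarrow> x \<in> chart_dom c \<Longrightarrow> l (chart_action c g x) = chart_action d (h g) (l x)"
    "\<And>x. x \<in> chart_dom c \<Longrightarrow> chart_map d (l x) = chart_map c x"
  using assms by (auto simp: chart_embedding_def embedding_map_open_iff iso_def)

lemma chart_embeddingI:
  fixes c d :: "('a::euclidean_space, 'x) orbifold_chart"
  assumes "open (chart_dom c)"
    and h: "h \<in> hom (chart_group c) (chart_group d)" "inj_on h (carrier (chart_group c))"
    "bij_betw h (chart_kernel c) (chart_kernel d)"
    and "continuous_on (chart_dom c) l" "inj_on l (chart_dom c)"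
    "l ` chart_dom c \<subseteq> chart_dom d"
    "\<And>g x. g \<in> carrier (chart_group c) \<Longrightarrow> x \<in> chart_dom c \<Longrightarrow> l (chart_action c g x) = chart_action d (h g) (l x)"
    "\<And>x. x \<in> chart_dom c \<Longrightarrow> chart_map d (l x) = chart_map c x"
  shows "chart_embedding c d l h"
proof -
  have "h (x \<otimes>\<^bsub>chart_group c\<^esub> y) = h x \<otimes>\<^bsub>chart_group d\<^esub> h y" if "x \<in> chart_kernel c" "y \<in> chart_kernel c" for x y
    using that h(1) chart_kernel_subset[of c] by (auto simp: hom_def)
  then have "h \<in> iso ((chart_group c)\<lparr>carrier := chart_kernel c\<rparr>) ((chart_group d)\<lparr>carrier := chart_kernel d\<rparr>)"
    using h(3) by (auto simp: iso_def hom_def bij_betw_def)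
  then show ?thesis using assms by (auto simp: chart_embedding_def embedding_map_open_iff)
qed

lemma chart_embedding_compose:
  assumes "chart_embedding c d l h" "chart_embedding d e k m" "orbifold_chart X c" "orbifold_chart X d"
  shows "chart_embedding c e (k \<circ> l) (m \<circ> h)"
proof -
  have o: "open (chart_dom c)" "open (chart_dom d)" using assms(3,4) by (auto simp: orbifold_chart_def)
  note 1 = chart_embeddingD[OF assms(1) o(1)] and 2 = chart_embeddingD[OF assms(2) o(2)]
  have hc: "h ` carrier (chart_group c) \<subseteq> carrier (chart_group d)" using 1(1) by (auto simp: hom_def)
  show ?thesis
  proof (rule chart_embeddingI[OF o(1)])
    show "m \<circ> h \<in> hom (chart_group c) (chart_group e)" using 1(1) 2(1) by (auto simp: hom_def Pi_def)
    show "inj_on (m \<circ> h) (carrier (chart_group c))"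
      using 1(2) inj_on_subset[OF 2(2) hc] by (rule comp_inj_on)
    show "bij_betw (m \<circ> h) (chart_kernel c) (chart_kernel e)" using 1(3) 2(3) by (rule bij_betw_trans)
    show "continuous_on (chart_dom c) (k \<circ> l)"
      using 1(4) continuous_on_subset[OF 2(4) 1(6)] by (rule continuous_on_compose)
    show "inj_on (k \<circ> l) (chart_dom c)" using 1(5) inj_on_subset[OF 2(5) 1(6)] by (rule comp_inj_on)
  qed (use 1(6-8) 2(6-8) hc in \<open>auto simp: image_subset_iff\<close>)
qed

lemma embeds_into_trans:
  "embeds_into c d \<Longrightarrow> embeds_into d e \<Longrightarrow> orbifold_chart X c \<Longrightarrow> orbifold_chart X d \<Longrightarrow> embeds_into c e"
  unfolding embeds_into_def using chart_embedding_compose by blast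

lemma embeds_into_refl: assumes "orbifold_chart X c" shows "embeds_into c c"
proof -
  have o: "open (chart_dom c)" using assms unfolding orbifold_chart_def by blast
  have "chart_embedding c c id id" by (rule chart_embeddingI[OF o]) (auto simp: hom_def)
  then show ?thesis unfolding embeds_into_def by blast
qed

lemma embedding_image_subset:
  assumes e: "chart_embedding c d l h" and o: "open (chart_dom c)"
  shows "chart_image c \<subseteq> chart_image d"
proof
  fix x assume "x \<in> chart_image c"
  then obtain z where z: "z \<in> chart_dom c" "x = chart_map c z" by (auto simp: chart_image_def)
  then have "x = chart_map d (l z)" "l z \<in> chart_dom d" using chart_embeddingD(6,8)[OF e o] by auto
  then show "x \<in> chart_image d" by (auto simp: chart_image_def)
qed

lemma embeds_into_image:
  assumes "embeds_into c d" "orbifold_chart X c" shows "chart_image c \<subseteq> chart_image d"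
proof -
  have "open (chart_dom c)" using assms(2) unfolding orbifold_chart_def by blast
  then show ?thesis using assms(1) embedding_image_subset unfolding embeds_into_def by blast
qed

definition lift_on :: "('a::euclidean_space, 'x) orbifold_chart \<Rightarrow> ('a, 'x) orbifold_chart \<Rightarrow> 'a set \<Rightarrow> ('a \<Rightarrow> 'a) \<Rightarrow> bool" where
  "lift_on c d P f \<longleftrightarrow> open P \<and> P \<subseteq> chart_dom c \<and> continuous_on P f \<and> inj_on f P \<and> f ` P \<subseteq> chart_dom d \<and>
     (\<forall>z\<in>P. chart_map d (f z) = chart_map c z)"

text \<open>
  In a linear chart at \<open>p\<close>, after composing \<open>f1\<close> with a group element so that both lifts agree at
  \<open>p\<close>, the map \<open>f1^(-1) f2\<close> sends every point into its orbit. It is an injective selection and hence a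
  group element. This element acts on the source, which explains the factor \<open>a\<close>.
\<close>

lemma (in smooth_chart) lifts_differ:
  assumes d: "orbifold_chart X d" and f1: "lift_on c d P f1" and f2: "lift_on c d P f2" and p: "p \<in> P"
  obtains g a V where "g \<in> carrier (chart_group d)" "a \<in> carrier Grp" "act a p = p" "open V" "p \<in> V" "V \<subseteq> P"
    "act a ` V \<subseteq> P" "\<And>y. y \<in> V \<Longrightarrow> f2 y = chart_action d g (f1 (act a y))"
proof -
  interpret d: chart X d by (rule chart.intro[OF d])
  note F1 = f1[unfolded lift_on_def] and F2 = f2[unfolded lift_on_def]
  have pD: "p \<in> Dom" using F1 p by blast
  interpret T: finite_linear_group "isotropy p ` stabilizer Grp act p" by (rule isotropy_group[OF pD])
  have P: "open P" using F1 by blast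
  obtain \<rho> l where l: "\<rho> > 0" "Cr_on s l (iball p \<rho>)" "inj_on l (iball p \<rho>)" "l ` iball p \<rho> \<subseteq> P \<inter> Dom"
    "open (l ` iball p \<rho>)" "l 0 = p"
    "\<And>h z. h \<in> stabilizer Grp act p \<Longrightarrow> z \<in> iball p \<rho> \<Longrightarrow> act h (l z) = l (isotropy p h z)"
    "\<And>g z z'. g \<in> carrier Grp \<Longrightarrow> z \<in> iball p \<rho> \<Longrightarrow> z' \<in> iball p \<rho> \<Longrightarrow> act g (l z) = l z' \<Longrightarrow>
      g \<in> stabilizer Grp act p"
    by (rule linearization[OF pD P p]) blast
  let ?D = "iball p \<rho>"
  have lc: "continuous_on ?D l" using l(2) by (rule Cr_on_continuous)
  have lP: "l z \<in> P" "l z \<in> Dom" if "z \<in> ?D" for z using l(4) that by auto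
  have "f1 p \<in> d.Dom" "f2 p \<in> d.Dom" "d.\<phi> (f1 p) = d.\<phi> (f2 p)" using F1 F2 p by auto
  then obtain g where g: "g \<in> carrier d.Grp" "f2 p = d.act g (f1 p)" using d.map_eq_iff by blast
  \<comment> \<open>the first lift, moved by the group so that it agrees with the second one at \<open>p\<close>\<close>
  define G1 where "G1 z = d.act g (f1 (l z))" for z
  have f1D: "f1 (l z) \<in> d.Dom" if "z \<in> ?D" for z using F1 lP[OF that] by auto
  have G1c: "continuous_on ?D G1"
    unfolding G1_def
    by (intro continuous_on_compose2[OF d.continuous_act[OF g(1)]] continuous_on_compose2[OF _ lc, of P f1])
      (use F1 lP f1D in auto)
  have G1i: "inj_on G1 ?D"
  proof (rule inj_onI)
    fix x y assume xy: "x \<in> ?D" "y \<in> ?D" "G1 x = G1 y"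
    then have "f1 (l x) = f1 (l y)" using d.act_inj[OF g(1)] f1D by (simp add: G1_def)
    then have "l x = l y" using F1 lP xy by (auto simp: inj_on_eq_iff)
    then show "x = y" using l(3) xy by (simp add: inj_on_eq_iff)
  qed
  have G1\<phi>: "d.\<phi> (G1 z) = \<phi> (l z)" if "z \<in> ?D" for z
    using F1 lP[OF that] f1D[OF that] d.map_act[OF g(1)] by (simp add: G1_def)
  have oG: "open (G1 ` ?D)" by (rule invariance_of_domain[OF G1c T.open_polyball G1i])
  have f2c: "continuous_on ?D (\<lambda>z. f2 (l z))"
    by (rule continuous_on_compose2[OF _ lc, of P f2]) (use F2 lP in auto)
  let ?O = "?D \<inter> (\<lambda>z. f2 (l z)) -` (G1 ` ?D)"
  have 0: "0 \<in> ?D" using T.zero_in_polyball[OF l(1)] .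
  have "open ?O" using continuous_open_preimage[OF f2c T.open_polyball oG] .
  moreover have "0 \<in> ?O" using 0 l(6) g(2) by (auto simp: G1_def image_iff intro!: bexI[of _ 0])
  ultimately obtain \<rho>1 where \<rho>1: "\<rho>1 > 0" "ball 0 \<rho>1 \<subseteq> ?O" using open_contains_ball by blast
  then have sub: "iball p \<rho>1 \<subseteq> ?O" using T.polyball_subset by blast
  define f where "f z = inv_into ?D G1 (f2 (l z))" for z
  have f: "f z \<in> ?D" "G1 (f z) = f2 (l z)" if z: "z \<in> iball p \<rho>1" for z
  proof -
    have "f2 (l z) \<in> G1 ` ?D" using sub z by blast
    then show "f z \<in> ?D" "G1 (f z) = f2 (l z)" unfolding f_def by (rule inv_into_into, rule f_inv_into_f)
  qed
  have "T.selection \<rho>1 f"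
    unfolding T.selection_def
  proof
    have "continuous_on (G1 ` ?D) (inv_into ?D G1)"
      by (rule continuous_on_inverse_open[OF T.open_polyball G1c]) (use G1i in auto)
    then show "continuous_on (iball p \<rho>1) f"
      unfolding f_def
      by (rule continuous_on_compose2[OF _ continuous_on_subset[OF f2c]]) (use sub in auto)
    show "\<forall>z\<in>iball p \<rho>1. \<exists>S\<in>isotropy p ` stabilizer Grp act p. f z = S z"
    proof
      fix z assume z: "z \<in> iball p \<rho>1"
      have zD: "z \<in> ?D" using sub z by blast
      have "\<phi> (l (f z)) = \<phi> (l z)"
        using G1\<phi>[OF f(1)[OF z]] f(2)[OF z] F2 lP[OF zD] by simp
      then obtain h where h: "h \<in> carrier Grp" "l (f z) = act h (l z)"
        using map_eq_iff[OF lP(2)[OF zD] lP(2)[OF f(1)[OF z]]] by metis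
      then have hH: "h \<in> stabilizer Grp act p" using l(8)[OF h(1) zD f(1)[OF z]] by simp
      then have "l (f z) = l (isotropy p h z)" using l(7)[OF hH zD] h by simp
      then have "f z = isotropy p h z"
        using l(3) f(1)[OF z] T.polyball_invariant[OF imageI[OF hH] zD] by (simp add: inj_on_eq_iff)
      then show "\<exists>S\<in>isotropy p ` stabilizer Grp act p. f z = S z" using hH by blast
    qed
  qed
  moreover have "inj_on f (iball p \<rho>1)"
  proof (rule inj_onI)
    fix x y assume xy: "x \<in> iball p \<rho>1" "y \<in> iball p \<rho>1" "f x = f y"
    then have "f2 (l x) = f2 (l y)" "x \<in> ?D" "y \<in> ?D" using f sub by (metis, blast+)
    then have "l x = l y" using F2 lP by (auto simp: inj_on_eq_iff)
    then show "x = y" using l(3) \<open>x \<in> ?D\<close> \<open>y \<in> ?D\<close> by (simp add: inj_on_eq_iff)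
  qed
  ultimately obtain S where S: "S \<in> isotropy p ` stabilizer Grp act p" "\<And>z. z \<in> iball p \<rho>1 \<Longrightarrow> f z = S z"
    using T.injective_selection_eq[OF _ _ \<rho>1(1)] by blast
  then obtain a where a: "a \<in> stabilizer Grp act p" "S = isotropy p a" by blast
  have sub': "iball p \<rho>1 \<subseteq> ?D" using sub by blast
  have al: "act a (l z) = l (f z)" if "z \<in> iball p \<rho>1" for z
    using l(7)[OF a(1), of z] that sub' S(2) a(2) by auto
  show ?thesis
  proof (rule that[OF g(1), of a "l ` iball p \<rho>1"])
    show "a \<in> carrier Grp" "act a p = p" using stabD[OF a(1)] by auto
    show "open (l ` iball p \<rho>1)"
      using invariance_of_domain[OF continuous_on_subset[OF lc sub'] T.open_polyball inj_on_subset[OF l(3) sub']] .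
    show "p \<in> l ` iball p \<rho>1" using l(6) T.zero_in_polyball[OF \<rho>1(1)] by blast
    show "l ` iball p \<rho>1 \<subseteq> P" using l(4) sub' by blast
    show "act a ` l ` iball p \<rho>1 \<subseteq> P" using al f(1) lP(1) by auto
    show "f2 y = d.act g (f1 (act a y))" if "y \<in> l ` iball p \<rho>1" for y
      using that al f(2) by (auto simp: G1_def)
  qed
qed

text \<open>
  The chart obtained by pulling back \<open>c\<close> along \<open>l\<close> and restricting the group to \<open>H\<close>. It covers both
  the restriction of a chart to a linear neighbourhood and a change of coordinates.
\<close>

definition subchart :: "('a, 'x) orbifold_chart \<Rightarrow> nat set \<Rightarrow> 'a set \<Rightarrow> (nat \<Rightarrow> 'a \<Rightarrow> 'a) \<Rightarrow> ('a \<Rightarrow> 'a) \<Rightarrow>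
    ('a, 'x) orbifold_chart" where
  "subchart c H D a l = \<lparr>chart_dom = D, chart_group = (chart_group c)\<lparr>carrier := H\<rparr>, chart_action = a,
     chart_map = \<lambda>z. chart_map c (l z)\<rparr>"

lemma (in chart) subchart_orbifold_chart:
  assumes D: "open D" "connected D" and l: "continuous_on D l" "inj_on l D" "l ` D \<subseteq> Dom"
    and H: "subgroup H Grp" and ext: "\<And>h. h \<in> H \<Longrightarrow> a h \<in> extensional D"
    and a: "\<And>h z. h \<in> H \<Longrightarrow> z \<in> D \<Longrightarrow> a h z \<in> D \<and> l (a h z) = act h (l z)"
    and sep: "\<And>g z z'. g \<in> carrier Grp \<Longrightarrow> z \<in> D \<Longrightarrow> z' \<in> D \<Longrightarrow> act g (l z) = l z' \<Longrightarrow> g \<in> H"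
  shows "orbifold_chart X (subchart c H D a l)"
proof -
  have HG: "h \<in> carrier Grp" if "h \<in> H" for h using subgroup.mem_carrier[OF H that] .
  have lD: "l z \<in> Dom" if "z \<in> D" for z using l(3) that by blast
  have li: "x = y" if "l x = l y" "x \<in> D" "y \<in> D" for x y using l(2) that by (simp add: inj_on_eq_iff)
  interpret H: group "Grp\<lparr>carrier := H\<rparr>" by (rule subgroup_imp_group[OF H])
  have am: "a (g \<otimes>\<^bsub>Grp\<^esub> h) z = a g (a h z)" if "g \<in> H" "h \<in> H" "z \<in> D" for g h z
  proof (rule li)
    show "l (a (g \<otimes>\<^bsub>Grp\<^esub> h) z) = l (a g (a h z))"
      using that a subgroup.m_closed[OF H] HG lD by (simp add: composition_rule)
  qed (use that a subgroup.m_closed[OF H] in auto)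
  have ai: "a g (a (inv\<^bsub>Grp\<^esub> g) z) = z" if "g \<in> H" "z \<in> D" for g z
  proof (rule li)
    have i: "inv\<^bsub>Grp\<^esub> g \<in> H" using subgroup.m_inv_closed[OF H that(1)] .
    show "l (a g (a (inv\<^bsub>Grp\<^esub> g) z)) = l z"
      using that a i HG lD act_inv(2) by simp
    show "a g (a (inv\<^bsub>Grp\<^esub> g) z) \<in> D" using a i that by blast
  qed (use that in auto)
  have bij: "a g \<in> Bij D" if g: "g \<in> H" for g
  proof -
    have "inj_on (a g) D" using act_inj[OF HG[OF g]] a[OF g] lD li by (metis inj_onI)
    moreover have "a g ` D = D"
      using a g ai subgroup.m_inv_closed[OF H g] by (metis image_subsetI imageI subsetI subset_antisym)
    ultimately show ?thesis using ext[OF g] by (simp add: Bij_def bij_betw_def)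
  qed
  have ga: "group_action (Grp\<lparr>carrier := H\<rparr>) D a"
  proof (intro group_action.intro group_hom.intro group_hom_axioms.intro H.group_axioms group_BijGroup)
    show "a \<in> hom (Grp\<lparr>carrier := H\<rparr>) (BijGroup D)"
    proof (rule homI)
      fix g h assume gh: "g \<in> carrier (Grp\<lparr>carrier := H\<rparr>)" "h \<in> carrier (Grp\<lparr>carrier := H\<rparr>)"
      have "a (g \<otimes>\<^bsub>Grp\<^esub> h) = compose D (a g) (a h)"
      proof
        fix z show "a (g \<otimes>\<^bsub>Grp\<^esub> h) z = compose D (a g) (a h) z"
          using gh am ext[OF subgroup.m_closed[OF H], of g h]
          by (cases "z \<in> D") (auto simp: compose_def extensional_def)
      qed
      then show "a (g \<otimes>\<^bsub>Grp\<lparr>carrier := H\<rparr>\<^esub> h) = a g \<otimes>\<^bsub>BijGroup D\<^esub> a h"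
        using gh bij by (simp add: BijGroup_def)
    qed (simp add: BijGroup_def bij)
  qed
  have oD: "open (l ` U)" if "open U" "U \<subseteq> D" for U
    using invariance_of_domain[OF continuous_on_subset[OF l(1)] that(1) inj_on_subset[OF l(2)]] that(2) by blast
  show ?thesis
  proof (rule orbifold_chartI; simp only: subchart_def orbifold_chart.simps partial_object.simps)
    show "open D" "connected D" by fact+
    show "finite (carrier (Grp\<lparr>carrier := H\<rparr>))"
      using finite_subset[OF subgroup.subset[OF H] finite_Grp] by simp
    show "group_action (Grp\<lparr>carrier := H\<rparr>) D a" by (rule ga)
    show "continuous_on D (a g)" if "g \<in> carrier (Grp\<lparr>carrier := H\<rparr>)" for g
    proof -
      have g: "g \<in> H" using that by simp
      have inv: "continuous_on (l ` D) (inv_into D l)"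
        by (rule continuous_on_inverse_open[OF D(1) l(1)]) (use l(2) in auto)
      have "continuous_on D (\<lambda>z. inv_into D l (act g (l z)))"
      proof (rule continuous_on_compose2[OF inv continuous_on_compose2[OF continuous_act[OF HG[OF g]] l(1,3)]])
        have "act g (l z) \<in> l ` D" if "z \<in> D" for z
          using a[OF g that] image_eqI[of "act g (l z)" l "a g z" D] by simp
        then show "(\<lambda>z. act g (l z)) ` D \<subseteq> l ` D" by blast
      qed
      moreover have "inv_into D l (act g (l z)) = a g z" if "z \<in> D" for z
        using a[OF g that] inv_into_f_f[OF l(2), of "a g z"] by simp
      ultimately show ?thesis by (simp cong: continuous_on_cong)
    qed
    show "open {x \<in> D. \<phi> (l x) \<in> U}" if "openin X U" for U
    proof -
      have "{x \<in> D. \<phi> (l x) \<in> U} = D \<inter> l -` {x \<in> Dom. \<phi> x \<in> U}" using lD by auto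
      then show ?thesis using continuous_open_preimage[OF l(1) D(1) open_map_vimage[OF that]] by simp
    qed
    show "openin X ((\<lambda>z. \<phi> (l z)) ` U)" if "open U" "U \<subseteq> D" for U
    proof -
      have "l ` U \<subseteq> Dom" using lD that(2) by blast
      from open_map_image[OF oD[OF that] this] show ?thesis by (simp add: image_image)
    qed
    show "\<phi> (l x) = \<phi> (l y) \<longleftrightarrow> (\<exists>g\<in>carrier (Grp\<lparr>carrier := H\<rparr>). y = a g x)" if xy: "x \<in> D" "y \<in> D" for x y
    proof
      assume "\<phi> (l x) = \<phi> (l y)"
      then obtain g where g: "g \<in> carrier Grp" "l y = act g (l x)"
        using map_eq_iff[OF lD[OF xy(1)] lD[OF xy(2)]] by blast
      then have gH: "g \<in> H" using sep[OF g(1) xy] by simp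
      have "y = a g x" by (rule li) (use a[OF gH xy(1)] g(2) xy in simp_all)
      then show "\<exists>g\<in>carrier (Grp\<lparr>carrier := H\<rparr>). y = a g x" using gH by auto
    next
      assume "\<exists>g\<in>carrier (Grp\<lparr>carrier := H\<rparr>). y = a g x"
      then obtain g where g: "g \<in> H" "y = a g x" by auto
      then show "\<phi> (l x) = \<phi> (l y)" using a[OF g(1) xy(1)] map_act[OF HG[OF g(1)] lD[OF xy(1)]] by simp
    qed
  qed
qed

lemma (in smooth_chart) subchart_embedding:
  assumes D: "open D" "D \<noteq> {}" and l: "continuous_on D l" "inj_on l D" "l ` D \<subseteq> Dom"
    and H: "subgroup H Grp"
    and a: "\<And>h z. h \<in> H \<Longrightarrow> z \<in> D \<Longrightarrow> a h z \<in> D \<and> l (a h z) = act h (l z)"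
    and sep: "\<And>g z z'. g \<in> carrier Grp \<Longrightarrow> z \<in> D \<Longrightarrow> z' \<in> D \<Longrightarrow> act g (l z) = l z' \<Longrightarrow> g \<in> H"
  shows "chart_embedding (subchart c H D a l) c l id"
proof -
  have HG: "h \<in> carrier Grp" if "h \<in> H" for h using subgroup.mem_carrier[OF H that] .
  have ol: "open (l ` D)" by (rule invariance_of_domain[OF l(1) D(1) l(2)])
  have "chart_kernel (subchart c H D a l) = chart_kernel c"
  proof (rule equalityI; rule subsetI)
    fix g assume "g \<in> chart_kernel (subchart c H D a l)"
    then have g: "g \<in> H" "\<And>z. z \<in> D \<Longrightarrow> a g z = z" by (auto simp: chart_kernel_def subchart_def)
    then have "act g x = x" if "x \<in> l ` D" for x using that a by fastforce
    then show "g \<in> chart_kernel c" using rigid[OF HG[OF g(1)] ol] D(2) l(3) by blast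
  next
    fix g assume "g \<in> chart_kernel c"
    then have g: "g \<in> carrier Grp" "\<And>x. x \<in> Dom \<Longrightarrow> act g x = x" by (auto simp: chart_kernel_def)
    obtain z where z: "z \<in> D" using D(2) by blast
    then have gH: "g \<in> H" using sep[OF g(1) z z] g(2) l(3) by blast
    have "a g z = z" if "z \<in> D" for z
      using a[OF gH that] g(2)[of "l z"] l(2,3) that by (auto simp: inj_on_eq_iff)
    then show "g \<in> chart_kernel (subchart c H D a l)" using gH by (auto simp: chart_kernel_def subchart_def)
  qed
  then have "bij_betw id (chart_kernel (subchart c H D a l)) (chart_kernel c)" by simp
  then show ?thesis
    by (intro chart_embeddingI) (use D l HG a in \<open>auto simp: subchart_def hom_def\<close>)
qed

lemma (in chart) conj_embedding:
  assumes g: "g \<in> carrier Grp"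
  shows "chart_embedding c c (act g) (\<lambda>x. g \<otimes>\<^bsub>Grp\<^esub> x \<otimes>\<^bsub>Grp\<^esub> inv\<^bsub>Grp\<^esub> g)"
proof -
  let ?h = "\<lambda>x. g \<otimes>\<^bsub>Grp\<^esub> x \<otimes>\<^bsub>Grp\<^esub> inv\<^bsub>Grp\<^esub> g" and ?k = "\<lambda>x. inv\<^bsub>Grp\<^esub> g \<otimes>\<^bsub>Grp\<^esub> x \<otimes>\<^bsub>Grp\<^esub> g"
  have c1: "g \<otimes>\<^bsub>Grp\<^esub> (inv\<^bsub>Grp\<^esub> g \<otimes>\<^bsub>Grp\<^esub> y) = y" "inv\<^bsub>Grp\<^esub> g \<otimes>\<^bsub>Grp\<^esub> (g \<otimes>\<^bsub>Grp\<^esub> y) = y"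
    if "y \<in> carrier Grp" for y
    using g that by (simp_all add: m_assoc[symmetric])
  have hk: "?h (?k x) = x" "?k (?h x) = x" if "x \<in> carrier Grp" for x
    using g that by (simp_all add: m_assoc c1)
  have actc: "act (?h x) (act g z) = act g (act x z)" if "x \<in> carrier Grp" "z \<in> Dom" for x z
    using g that act_closed by (simp add: composition_rule act_inv)
  have ker: "b \<otimes>\<^bsub>Grp\<^esub> x \<otimes>\<^bsub>Grp\<^esub> inv\<^bsub>Grp\<^esub> b \<in> chart_kernel c"
    if b: "b \<in> carrier Grp" and x: "x \<in> chart_kernel c" for b x
  proof -
    have x: "x \<in> carrier Grp" "\<And>z. z \<in> Dom \<Longrightarrow> act x z = z" using x by (auto simp: chart_kernel_def)
    have "act (b \<otimes>\<^bsub>Grp\<^esub> x \<otimes>\<^bsub>Grp\<^esub> inv\<^bsub>Grp\<^esub> b) z = z" if "z \<in> Dom" for z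
      using b x that act_closed by (simp add: composition_rule act_inv)
    moreover have "b \<otimes>\<^bsub>Grp\<^esub> x \<otimes>\<^bsub>Grp\<^esub> inv\<^bsub>Grp\<^esub> b \<in> carrier Grp" using b x(1) by simp
    ultimately show ?thesis unfolding chart_kernel_def by blast
  qed
  have kerk: "?k x \<in> chart_kernel c" if "x \<in> chart_kernel c" for x
    using ker[of "inv\<^bsub>Grp\<^esub> g" x] that g by simp
  show ?thesis
  proof (rule chart_embeddingI)
    show "?h \<in> hom Grp Grp"
      using g by (auto intro!: homI simp: m_assoc c1)
    show "inj_on ?h (carrier Grp)" by (rule inj_on_inverseI[where g = ?k]) (rule hk(2))
    show "bij_betw ?h (chart_kernel c) (chart_kernel c)"
      by (rule bij_betw_byWitness[of _ ?k]) (use hk ker[OF g] kerk chart_kernel_subset[of c] in \<open>auto simp: subset_eq\<close>)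
    show "inj_on (act g) Dom" using act_inj[OF g] by (rule inj_onI)
  qed (use g open_Dom continuous_act act_closed actc map_act in auto)
qed

text \<open>
  An element of the group of \<open>e\<close> maps points of \<open>e\<close> to points with the same image in the orbifold, so
  at every point it acts like some element of the group of \<open>d\<close>. One such element works on an open set,
  and by rigidity the two differ by an element of the kernel, which comes from \<open>d\<close> since embeddings are
  isomorphisms on kernels.
\<close>

lemma (in smooth_chart) embeds_into_factor:
  assumes e: "orbifold_chart X e" "chart_embedding e c l h" "chart_dom e \<noteq> {}"
    and d: "orbifold_chart X d" "chart_embedding d c m k"
    and sub: "l ` chart_dom e \<subseteq> m ` chart_dom d"
  shows "embeds_into e d"
proof -
  interpret e: chart X e by (rule chart.intro[OF e(1)])
  interpret d: chart X d by (rule chart.intro[OF d(1)])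
  note E = chart_embeddingD[OF e(2) e.open_Dom] and M = chart_embeddingD[OF d(2) d.open_Dom]
  have kc: "k a \<in> carrier Grp" if "a \<in> carrier d.Grp" for a using M(1) that by (auto simp: hom_def)
  have hc: "h a \<in> carrier Grp" if "a \<in> carrier e.Grp" for a using E(1) that by (auto simp: hom_def)
  have hk: "h b \<in> k ` carrier d.Grp" if b: "b \<in> carrier e.Grp" for b
  proof -
    have "\<exists>a\<in>carrier d.Grp. act (h b) (l z) = act (k a) (l z)" if z: "z \<in> e.Dom" for z
    proof -
      obtain z1 where z1: "z1 \<in> d.Dom" "l z = m z1" using sub z by blast
      have bz: "e.act b z \<in> e.Dom" using e.act_closed[OF b z] .
      then obtain z2 where z2: "z2 \<in> d.Dom" "l (e.act b z) = m z2" using sub by blast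
      have "d.\<phi> z1 = d.\<phi> z2"
        using M(8)[OF z1(1)] M(8)[OF z2(1)] E(8)[OF z] E(8)[OF bz] e.map_act[OF b z] z1(2) z2(2) by simp
      then obtain a where a: "a \<in> carrier d.Grp" "z2 = d.act a z1" using d.map_eq_iff[OF z1(1) z2(1)] by blast
      then show ?thesis using E(7)[OF b z] M(7)[OF a(1) z1(1)] z1(2) z2(2) by (intro bexI[of _ a]) auto
    qed
    then have cov: "e.Dom \<subseteq> (\<Union>a\<in>carrier d.Grp. {z \<in> e.Dom. act (h b) (l z) = act (k a) (l z)})" by blast
    have clo: "closedin (top_of_set e.Dom) (e.Dom \<inter> {z \<in> e.Dom. act (h b) (l z) = act (k a) (l z)})"
      if a: "a \<in> carrier d.Grp" for a
    proof -
      have "closedin (top_of_set e.Dom) {z \<in> e.Dom. act (h b) (l z) - act (k a) (l z) = 0}"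
        by (intro continuous_closedin_preimage_constant continuous_on_diff
            continuous_on_compose2[OF continuous_act[OF hc[OF b]] E(4,6)] continuous_on_compose2[OF continuous_act[OF kc[OF a]] E(4,6)])
      moreover have "e.Dom \<inter> {z \<in> e.Dom. act (h b) (l z) = act (k a) (l z)} =
        {z \<in> e.Dom. act (h b) (l z) - act (k a) (l z) = 0}" by auto
      ultimately show ?thesis by simp
    qed
    obtain a V where a: "a \<in> carrier d.Grp" and V: "open V" "V \<noteq> {}" "V \<subseteq> e.Dom"
      "V \<subseteq> {z \<in> e.Dom. act (h b) (l z) = act (k a) (l z)}"
      by (rule finite_closed_cover_interior[OF d.finite_Grp e.open_Dom e(3) cov clo])
    \<comment> \<open>this element fixes the image of \<open>V\<close>\<close>
    let ?g = "inv\<^bsub>Grp\<^esub> (k a) \<otimes>\<^bsub>Grp\<^esub> h b"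
    have g: "?g \<in> carrier Grp" using kc[OF a] hc[OF b] by simp
    have "?g \<in> chart_kernel c"
    proof (rule rigid[OF g, of "l ` V"])
      show "open (l ` V)"
        by (rule invariance_of_domain[OF continuous_on_subset[OF E(4) V(3)] V(1) inj_on_subset[OF E(5) V(3)]])
      show "l ` V \<noteq> {}" "l ` V \<subseteq> Dom" using V E(6) by auto
      show "act ?g x = x" if "x \<in> l ` V" for x
      proof -
        have "x \<in> Dom" "act (h b) x = act (k a) x" using that V E(6) by auto
        then show ?thesis using kc[OF a] hc[OF b] by (simp add: composition_rule act_inv)
      qed
    qed
    then obtain a' where a': "a' \<in> chart_kernel d" "k a' = ?g" using M(3) by (metis bij_betw_imp_surj_on imageE)
    then have a'c: "a' \<in> carrier d.Grp" using chart_kernel_subset by blast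
    have "k (a \<otimes>\<^bsub>d.Grp\<^esub> a') = k a \<otimes>\<^bsub>Grp\<^esub> ?g" using M(1) a a'c a'(2) by (simp add: hom_def)
    also have "\<dots> = h b" using kc[OF a] hc[OF b] by (simp add: m_assoc[symmetric])
    finally show ?thesis using a a'c by (metis d.m_closed imageI)
  qed
  define j where "j b = inv_into (carrier d.Grp) k (h b)" for b
  have j: "j b \<in> carrier d.Grp" "k (j b) = h b" if "b \<in> carrier e.Grp" for b
    using hk[OF that] by (auto simp: j_def inv_into_into f_inv_into_f)
  have kinj: "a = a'" if "k a = k a'" "a \<in> carrier d.Grp" "a' \<in> carrier d.Grp" for a a'
    using M(2) that by (simp add: inj_on_eq_iff)
  define f where "f z = inv_into d.Dom m (l z)" for z
  have f: "f z \<in> d.Dom" "m (f z) = l z" if "z \<in> e.Dom" for z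
  proof -
    have "l z \<in> m ` d.Dom" using sub that by blast
    then show "f z \<in> d.Dom" "m (f z) = l z" unfolding f_def by (rule inv_into_into, rule f_inv_into_f)
  qed
  have minj: "x = y" if "m x = m y" "x \<in> d.Dom" "y \<in> d.Dom" for x y
    using M(5) that by (simp add: inj_on_eq_iff)
  have "chart_embedding e d f j"
  proof (rule chart_embeddingI[OF e.open_Dom])
    show "j \<in> hom e.Grp d.Grp"
    proof (rule homI)
      fix a b assume ab: "a \<in> carrier e.Grp" "b \<in> carrier e.Grp"
      have "k (j (a \<otimes>\<^bsub>e.Grp\<^esub> b)) = k (j a \<otimes>\<^bsub>d.Grp\<^esub> j b)"
        using ab j E(1) M(1) by (simp add: hom_def)
      then show "j (a \<otimes>\<^bsub>e.Grp\<^esub> b) = j a \<otimes>\<^bsub>d.Grp\<^esub> j b" 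
        by (rule kinj) (use ab j in auto)
    qed (rule j)
    show inj_j: "inj_on j (carrier e.Grp)"
    proof (rule inj_onI)
      fix a b assume ab: "a \<in> carrier e.Grp" "b \<in> carrier e.Grp" "j a = j b"
      then have "h a = h b" using j(2)[of a] j(2)[of b] by simp
      then show "a = b" using E(2) ab by (simp add: inj_on_eq_iff)
    qed
    show "bij_betw j (chart_kernel e) (chart_kernel d)"
    proof -
      have i: "inj_on j (chart_kernel e)" using inj_on_subset[OF inj_j chart_kernel_subset] .
      have "j b \<in> chart_kernel d" if b: "b \<in> chart_kernel e" for b
      proof -
        have bc: "b \<in> carrier e.Grp" using b chart_kernel_subset by blast
        have "h b \<in> chart_kernel c" using E(3) b by (metis bij_betw_imp_surj_on imageI)
        then obtain a where a: "a \<in> chart_kernel d" "k a = h b" using M(3) by (metis bij_betw_imp_surj_on imageE)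
        then have "j b = a" using j[OF bc] chart_kernel_subset[of d] by (intro kinj[of "j b" a]) auto
        then show ?thesis using a by simp
      qed
      moreover have "a \<in> j ` chart_kernel e" if a: "a \<in> chart_kernel d" for a
      proof -
        have "k a \<in> chart_kernel c" using M(3) a by (metis bij_betw_imp_surj_on imageI)
        then obtain b where b: "b \<in> chart_kernel e" "h b = k a" using E(3) by (metis bij_betw_imp_surj_on imageE)
        have "j b = a" by (rule kinj) (use j[of b] b a chart_kernel_subset[of d] chart_kernel_subset[of e] in auto)
        then show ?thesis using b by blast
      qed
      ultimately show ?thesis using i by (auto simp: bij_betw_def)
    qed
    have "continuous_on (m ` d.Dom) (inv_into d.Dom m)"
      by (rule continuous_on_inverse_open[OF d.open_Dom M(4)]) (use M(5) in auto)
    then show "continuous_on e.Dom f"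
      unfolding f_def by (rule continuous_on_compose2[OF _ E(4) sub])
    show "inj_on f e.Dom"
    proof (rule inj_onI)
      fix x y assume xy: "x \<in> e.Dom" "y \<in> e.Dom" "f x = f y"
      then have "l x = l y" using f(2)[of x] f(2)[of y] by simp
      then show "x = y" using E(5) xy by (simp add: inj_on_eq_iff)
    qed
    show "f ` e.Dom \<subseteq> d.Dom" using f by blast
    show "f (e.act g x) = d.act (j g) (f x)" if "g \<in> carrier e.Grp" "x \<in> e.Dom" for g x
    proof (rule minj)
      show "m (f (e.act g x)) = m (d.act (j g) (f x))"
        using f that e.act_closed[OF that] E(7)[OF that] M(7)[OF j(1)[OF that(1)] f(1)[OF that(2)]] j(2)[OF that(1)] by simp
    qed (use f j that e.act_closed d.act_closed in auto)
    show "d.\<phi> (f x) = e.\<phi> x" if "x \<in> e.Dom" for x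
      using f[OF that] M(8)[of "f x"] E(8)[OF that] by simp
  qed
  then show ?thesis by (auto simp: embeds_into_def)
qed

text \<open>
  The carrier acts through \<open>T\<close>, which may be far from injective: elements of the kernel act trivially.
\<close>

definition linear_chart :: "(real^'n, 'x) orbifold_chart \<Rightarrow> bool" where
  "linear_chart e \<longleftrightarrow> (\<exists>T \<rho>. finite_linear_group (T ` carrier (chart_group e)) \<and> \<rho> > 0 \<and>
     chart_dom e = finite_linear_group.polyball (T ` carrier (chart_group e)) \<rho> \<and>
     (\<forall>g\<in>carrier (chart_group e). \<forall>z\<in>chart_dom e. chart_action e g z = T g z))"

lemma linear_chart_smooth_action: "linear_chart e \<Longrightarrow> Cr_action t e"
  unfolding linear_chart_def Cr_action_def
proof (elim exE conjE, intro ballI)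
  fix T \<rho> g
  assume T: "finite_linear_group (T ` carrier (chart_group e))"
    and dom: "chart_dom e = finite_linear_group.polyball (T ` carrier (chart_group e)) \<rho>"
    and a: "\<forall>g\<in>carrier (chart_group e). \<forall>z\<in>chart_dom e. chart_action e g z = T g z"
    and g: "g \<in> carrier (chart_group e)"
  interpret T: finite_linear_group "T ` carrier (chart_group e)" by fact
  have o: "open (chart_dom e)" unfolding dom by (rule T.open_polyball)
  have "linear (T g)" using T.lin g by blast
  from Cr_on_transform[OF Cr_on_linear[OF this o] o] show "Cr_on t (chart_action e g) (chart_dom e)"
    using a g by blast
qed

lemma (in smooth_chart) linear_chart_at:
  assumes p: "p \<in> Dom" and W: "open W" "p \<in> W"
  obtains e l where "linear_chart e" "orbifold_chart X e" "0 \<in> chart_dom e" "l 0 = p"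
    "chart_embedding e c l id" "Cr_embedding s (chart_dom e) Dom l" "l ` chart_dom e \<subseteq> W"
proof -
  let ?H = "stabilizer Grp act p"
  interpret T: finite_linear_group "isotropy p ` ?H" by (rule isotropy_group[OF p])
  obtain \<rho> l where l: "\<rho> > 0" "Cr_on s l (iball p \<rho>)" "inj_on l (iball p \<rho>)" "l ` iball p \<rho> \<subseteq> W \<inter> Dom"
    "open (l ` iball p \<rho>)" "Cr_on s (inv_into (iball p \<rho>) l) (l ` iball p \<rho>)" "l 0 = p"
    and eq: "\<And>h z. h \<in> ?H \<Longrightarrow> z \<in> iball p \<rho> \<Longrightarrow> act h (l z) = l (isotropy p h z)"
    and sep: "\<And>g z z'. g \<in> carrier Grp \<Longrightarrow> z \<in> iball p \<rho> \<Longrightarrow> z' \<in> iball p \<rho> \<Longrightarrow> act g (l z) = l z' \<Longrightarrow> g \<in> ?H"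
    by (rule linearization[OF p W]) blast
  let ?D = "iball p \<rho>"
  have lc: "continuous_on ?D l" using l(2) by (rule Cr_on_continuous)
  have lD: "l ` ?D \<subseteq> Dom" using l(4) by blast
  have 0: "0 \<in> ?D" using T.zero_in_polyball[OF l(1)] .
  define a where "a h = restrict (isotropy p h) ?D" for h
  have a: "a h z \<in> ?D \<and> l (a h z) = act h (l z)" if "h \<in> ?H" "z \<in> ?D" for h z
    using T.polyball_invariant[OF imageI[OF that(1)] that(2)] eq[OF that] that by (simp add: a_def)
  define e where "e = subchart c ?H ?D a l"
  have eD: "chart_dom e = ?D" "carrier (chart_group e) = ?H" "chart_action e = a" by (simp_all add: e_def subchart_def)
  show ?thesis
  proof (rule that[of e l])
    show "orbifold_chart X e" unfolding e_def
      by (rule subchart_orbifold_chart[OF T.open_polyball convex_connected[OF T.convex_polyball] lc l(3) lD stab_subgroup[OF p] _ a sep])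
        (simp_all only: a_def restrict_extensional)
    show "chart_embedding e c l id" unfolding e_def
      by (rule subchart_embedding[OF T.open_polyball _ lc l(3) lD stab_subgroup[OF p] a sep]) (use 0 in auto)
    show "linear_chart e" unfolding linear_chart_def eD
      using T.finite_linear_group_axioms l(1) by (intro exI[of _ "isotropy p"] exI[of _ \<rho>]) (auto simp: a_def)
    show "Cr_embedding s (chart_dom e) Dom l"
      unfolding eD Cr_embedding_iff[OF T.open_polyball] using l lD by blast
  qed (use l 0 eD in auto)
qed

lemma chart_embedding_act:
  assumes c: "chart X c" "g \<in> carrier (chart_group c)" and d: "orbifold_chart X d" "chart_embedding d c m k"
  obtains k' where "chart_embedding d c (chart_action c g \<circ> m) k'"
  using chart_embedding_compose[OF d(2) chart.conj_embedding[OF c] d(1) chart.orbifold_chart[OF c(1)]] that by blast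

text \<open>
  Charts embedded in a smooth chart over a common point have a common refinement there: after moving
  one of them by the group, their images in \<open>c\<close> meet over \<open>x\<close>, and any small linear chart there
  factors through both.
\<close>

lemma (in smooth_chart) common_linear_subchart:
  assumes d1: "orbifold_chart X d1" "embeds_into d1 c" and d2: "orbifold_chart X d2" "embeds_into d2 c"
    and x: "x \<in> chart_image d1" "x \<in> chart_image d2"
  obtains e l where "linear_chart e" "orbifold_chart X e" "0 \<in> chart_dom e" "x = chart_map e 0"
    "chart_embedding e c l id" "Cr_embedding s (chart_dom e) Dom l" "embeds_into e d1" "embeds_into e d2"
proof -
  obtain m1 k1 where m1: "chart_embedding d1 c m1 k1" using d1(2) by (auto simp: embeds_into_def)
  obtain m2 k2 where m2: "chart_embedding d2 c m2 k2" using d2(2) by (auto simp: embeds_into_def)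
  have o: "open (chart_dom d1)" "open (chart_dom d2)" using d1 d2 by (auto simp: orbifold_chart_def)
  note M1 = chart_embeddingD[OF m1 o(1)] and M2 = chart_embeddingD[OF m2 o(2)]
  obtain z1 where z1: "z1 \<in> chart_dom d1" "x = chart_map d1 z1" using x(1) by (auto simp: chart_image_def)
  obtain z2 where z2: "z2 \<in> chart_dom d2" "x = chart_map d2 z2" using x(2) by (auto simp: chart_image_def)
  have p: "m1 z1 \<in> Dom" and q: "m2 z2 \<in> Dom" using M1(6) M2(6) z1 z2 by auto
  have "\<phi> (m2 z2) = \<phi> (m1 z1)" using M1(8)[OF z1(1)] M2(8)[OF z2(1)] z1 z2 by simp
  then obtain g where g: "g \<in> carrier Grp" "m1 z1 = act g (m2 z2)" using map_eq_iff[OF q p] by blast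
  obtain k2' where m2': "chart_embedding d2 c (act g \<circ> m2) k2'"
    by (rule chart_embedding_act[OF chart_axioms g(1) d2(1) m2])
  note M2' = chart_embeddingD[OF m2' o(2)]
  let ?W = "m1 ` chart_dom d1 \<inter> (act g \<circ> m2) ` chart_dom d2"
  have W: "open ?W" "m1 z1 \<in> ?W"
    using open_Int[OF invariance_of_domain[OF M1(4) o(1) M1(5)] invariance_of_domain[OF M2'(4) o(2) M2'(5)]]
      imageI[OF z1(1), of m1] imageI[OF z2(1), of "act g \<circ> m2"] g(2) by simp_all
  obtain e l where e: "linear_chart e" "orbifold_chart X e" "0 \<in> chart_dom e" "l 0 = m1 z1"
    "chart_embedding e c l id" "Cr_embedding s (chart_dom e) Dom l" "l ` chart_dom e \<subseteq> ?W"
    by (rule linear_chart_at[OF p W]) blast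
  have eo: "open (chart_dom e)" using e(2) by (auto simp: orbifold_chart_def)
  show ?thesis
  proof (rule that[OF e(1-3) _ e(5,6)])
    show "x = chart_map e 0"
      using chart_embeddingD(8)[OF e(5) eo e(3)] e(4) M1(8)[OF z1(1)] z1(2) by simp
    show "embeds_into e d1" by (rule embeds_into_factor[OF e(2,5) _ d1(1) m1]) (use e(3,7) in auto)
    show "embeds_into e d2" by (rule embeds_into_factor[OF e(2,5) _ d2(1) m2']) (use e(3,7) in auto)
  qed
qed

text \<open>
  The overlap condition of an atlas at one point. It ensures that groups, and not just coordinates, match.
\<close>

definition linked :: "'x topology \<Rightarrow> 'x \<Rightarrow> (real^'n, 'x) orbifold_chart \<Rightarrow> (real^'n, 'x) orbifold_chart \<Rightarrow> bool" where
  "linked X x c d \<longleftrightarrow> (\<exists>e. orbifold_chart X e \<and> x \<in> chart_image e \<and> embeds_into e c \<and> embeds_into e d)"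

lemma linked_sym: "linked X x c d \<Longrightarrow> linked X x d c"
  unfolding linked_def by blast

lemma linked_of_embedding:
  "orbifold_chart X e \<Longrightarrow> embeds_into e d \<Longrightarrow> x \<in> chart_image e \<Longrightarrow> linked X x e d"
  unfolding linked_def using embeds_into_refl by blast

text \<open>
  Smoothness of the middle chart is essential, since linear charts refine two charts embedded in it.
\<close>

lemma linked_trans:
  assumes a: "smooth_chart X a s" and ca: "linked X x c a" and ad: "linked X x a d"
  shows "linked X x c d"
proof -
  interpret a: smooth_chart X a s by fact
  obtain e1 where e1: "orbifold_chart X e1" "x \<in> chart_image e1" "embeds_into e1 c" "embeds_into e1 a"
    using ca unfolding linked_def by blast
  obtain e2 where e2: "orbifold_chart X e2" "x \<in> chart_image e2" "embeds_into e2 a" "embeds_into e2 d"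
    using ad unfolding linked_def by blast
  obtain e where e: "orbifold_chart X e" "0 \<in> chart_dom e" "x = chart_map e 0" "embeds_into e e1" "embeds_into e e2"
    by (rule a.common_linear_subchart[OF e1(1,4) e2(1,3) e1(2) e2(2)]) blast
  have "x \<in> chart_image e" using e(2,3) by (auto simp: chart_image_def)
  moreover have "embeds_into e c" by (rule embeds_into_trans[OF e(4) e1(3) e(1) e1(1)])
  moreover have "embeds_into e d" by (rule embeds_into_trans[OF e(5) e2(4) e(1) e2(1)])
  ultimately show ?thesis using e(1) unfolding linked_def by blast
qed

section \<open>Smooth compatibility of charts\<close>

text \<open>
  A germ of a C^s coordinate change from \<open>p\<close> to \<open>q\<close> over the identity of the orbifold. It
  records coordinates only, so that germs compose and invert freely; groups are matched by linked charts.
\<close>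

definition smooth_lift :: "enat \<Rightarrow> ('a::euclidean_space, 'x) orbifold_chart \<Rightarrow> ('a, 'x) orbifold_chart \<Rightarrow> 'a \<Rightarrow> 'a \<Rightarrow> bool" where
  "smooth_lift s c d p q \<longleftrightarrow> (\<exists>P f. open P \<and> p \<in> P \<and> P \<subseteq> chart_dom c \<and> f p = q \<and>
     Cr_embedding s P (chart_dom d) f \<and> (\<forall>z\<in>P. chart_map d (f z) = chart_map c z))"

lemma smooth_liftI:
  assumes "open P" "p \<in> P" "P \<subseteq> chart_dom c" "f p = q" "Cr_on s f P" "f ` P \<subseteq> chart_dom d" "open (f ` P)"
    "Cr_on s k (f ` P)" "\<And>z. z \<in> P \<Longrightarrow> k (f z) = z" "\<And>z. z \<in> P \<Longrightarrow> chart_map d (f z) = chart_map c z"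
  shows "smooth_lift s c d p q"
proof -
  have "Cr_embedding s P (chart_dom d) f" by (rule Cr_embeddingI[OF assms(1,5-9)])
  then show ?thesis unfolding smooth_lift_def using assms by blast
qed

lemma smooth_liftE:
  assumes "smooth_lift s c d p q"
  obtains P f k where "open P" "p \<in> P" "P \<subseteq> chart_dom c" "f p = q" "Cr_on s f P" "f ` P \<subseteq> chart_dom d" "open (f ` P)"
    "Cr_on s k (f ` P)" "\<And>z. z \<in> P \<Longrightarrow> k (f z) = z" "\<And>z. z \<in> P \<Longrightarrow> chart_map d (f z) = chart_map c z"
proof -
  obtain P f where P: "open P" "p \<in> P" "P \<subseteq> chart_dom c" "f p = q" "Cr_embedding s P (chart_dom d) f"
     "\<forall>z\<in>P. chart_map d (f z) = chart_map c z"
    using assms unfolding smooth_lift_def by blast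
  note f = P(5)[unfolded Cr_embedding_iff[OF P(1)]]
  show ?thesis by (rule that[of P f "inv_into P f"]) (use P f in auto)
qed

lemma smooth_lift_sym: assumes "smooth_lift s c d p q" shows "smooth_lift s d c q p"
proof -
  obtain P f k where f: "open P" "p \<in> P" "P \<subseteq> chart_dom c" "f p = q" "Cr_on s f P" "f ` P \<subseteq> chart_dom d" "open (f ` P)"
    "Cr_on s k (f ` P)" "\<And>z. z \<in> P \<Longrightarrow> k (f z) = z" "\<And>z. z \<in> P \<Longrightarrow> chart_map d (f z) = chart_map c z"
    using assms by (rule smooth_liftE) blast
  have kf: "k ` f ` P = P" using f(9) by force
  show ?thesis
    by (rule smooth_liftI[of "f ` P" _ _ k _ _ _ f]) (use f kf in auto)
qed

lemma smooth_lift_trans: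
  assumes "smooth_lift s c d p q" "smooth_lift s d e q t" shows "smooth_lift s c e p t"
proof -
  obtain P f k where f: "open P" "p \<in> P" "P \<subseteq> chart_dom c" "f p = q" "Cr_on s f P" "f ` P \<subseteq> chart_dom d" "open (f ` P)"
    "Cr_on s k (f ` P)" "\<And>z. z \<in> P \<Longrightarrow> k (f z) = z" "\<And>z. z \<in> P \<Longrightarrow> chart_map d (f z) = chart_map c z"
    using assms(1) by (rule smooth_liftE) blast
  obtain Q g m where g: "open Q" "q \<in> Q" "Q \<subseteq> chart_dom d" "g q = t" "Cr_on s g Q" "g ` Q \<subseteq> chart_dom e" "open (g ` Q)"
    "Cr_on s m (g ` Q)" "\<And>z. z \<in> Q \<Longrightarrow> m (g z) = z" "\<And>z. z \<in> Q \<Longrightarrow> chart_map e (g z) = chart_map d z"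
    using assms(2) by (rule smooth_liftE) blast
  let ?P = "P \<inter> f -` Q"
  have o: "open ?P" using continuous_open_preimage[OF Cr_on_continuous[OF f(5)] f(1) g(1)] .
  have fP: "f ` ?P = f ` P \<inter> Q" by blast
  have gfP: "(\<lambda>z. g (f z)) ` ?P = g ` Q \<inter> m -` (f ` P)"
  proof
    show "(\<lambda>z. g (f z)) ` ?P \<subseteq> g ` Q \<inter> m -` (f ` P)" using g(9) by auto
    show "g ` Q \<inter> m -` (f ` P) \<subseteq> (\<lambda>z. g (f z)) ` ?P"
    proof
      fix y assume "y \<in> g ` Q \<inter> m -` (f ` P)"
      then obtain w z where "w \<in> Q" "y = g w" "z \<in> P" "m y = f z" by blast
      then show "y \<in> (\<lambda>z. g (f z)) ` ?P" using g(9)[of w] by (intro image_eqI[of _ _ z]) auto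
    qed
  qed
  have og: "open (g ` Q \<inter> m -` (f ` P))"
    using continuous_open_preimage[OF Cr_on_continuous[OF g(8)] g(7) f(7)] .
  show ?thesis
  proof (rule smooth_liftI[of ?P _ _ "\<lambda>z. g (f z)" _ _ _ "\<lambda>z. k (m z)"])
    show "Cr_on s (\<lambda>z. g (f z)) ?P"
      by (rule Cr_on_compose[OF Cr_on_subset[OF f(5)] g(5) o g(1)]) auto
    show "Cr_on s (\<lambda>z. k (m z)) ((\<lambda>z. g (f z)) ` ?P)"
      unfolding gfP by (rule Cr_on_compose[OF Cr_on_subset[OF g(8)] f(8) og f(7)]) auto
    show "open ((\<lambda>z. g (f z)) ` ?P)" unfolding gfP by (rule og)
    show "open ?P" by (rule o)
    show "p \<in> ?P" "g (f p) = t" using f(2,4) g(2,4) by simp_all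
    show "?P \<subseteq> chart_dom c" using f(3) by blast
    show "(\<lambda>z. g (f z)) ` ?P \<subseteq> chart_dom e" unfolding gfP using g(6) by blast
    fix z assume z: "z \<in> ?P"
    show "k (m (g (f z))) = z" using z f(9) g(9) by simp
    show "chart_map e (g (f z)) = chart_map c z" using z f(10) g(10) by simp
  qed
qed

lemma smooth_lift_mono: assumes "smooth_lift s c d p q" "r \<le> s" shows "smooth_lift r c d p q"
proof -
  obtain P f where P: "open P" "p \<in> P" "P \<subseteq> chart_dom c" "f p = q" "Cr_embedding s P (chart_dom d) f"
     "\<forall>z\<in>P. chart_map d (f z) = chart_map c z"
    using assms(1) unfolding smooth_lift_def by blast
  show ?thesis unfolding smooth_lift_def
    by (rule exI[of _ P], rule exI[of _ f]) (use P Cr_embedding_mono[OF P(5) assms(2)] in simp)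
qed

lemma smooth_lift_embedding:
  assumes "chart_embedding c d l h" "orbifold_chart X c" "Cr_embedding s (chart_dom c) (chart_dom d) l" "p \<in> chart_dom c"
  shows "smooth_lift s c d p (l p)"
proof -
  have o: "open (chart_dom c)" using assms(2) by (simp add: orbifold_chart_def)
  show ?thesis unfolding smooth_lift_def
    by (rule exI[of _ "chart_dom c"], rule exI[of _ l])
      (use o assms(3,4) chart_embeddingD(8)[OF assms(1) o] in simp)
qed

lemma (in smooth_chart) smooth_lift_act:
  assumes g: "g \<in> carrier Grp" and p: "p \<in> Dom" shows "smooth_lift s c c p (act g p)"
proof -
  have im: "act g ` Dom = Dom" using surj_prop[OF g] .
  show ?thesis
    by (rule smooth_liftI[of Dom _ _ "act g" _ _ _ "act (inv\<^bsub>Grp\<^esub> g)"])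
      (use g p im open_Dom Cr_act act_inv map_act in auto)
qed

definition Cr_compatible :: "enat \<Rightarrow> 'x \<Rightarrow> ('a::euclidean_space, 'x) orbifold_chart \<Rightarrow> ('a, 'x) orbifold_chart \<Rightarrow> bool" where
  "Cr_compatible s x c d \<longleftrightarrow> (\<forall>p\<in>chart_dom c. \<forall>q\<in>chart_dom d. chart_map c p = x \<and> chart_map d q = x \<longrightarrow> smooth_lift s c d p q)"

lemma Cr_compatible_sym: "Cr_compatible s x c d \<Longrightarrow> Cr_compatible s x d c"
  unfolding Cr_compatible_def by (auto intro: smooth_lift_sym)

lemma Cr_compatibleD:
  "Cr_compatible s x c d \<Longrightarrow> p \<in> chart_dom c \<Longrightarrow> q \<in> chart_dom d \<Longrightarrow> chart_map c p = x \<Longrightarrow> chart_map d q = x \<Longrightarrow>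
    smooth_lift s c d p q"
  unfolding Cr_compatible_def by simp

lemma Cr_compatible_trans:
  assumes "Cr_compatible s x c b" "Cr_compatible s x b d" "x \<in> chart_image b"
  shows "Cr_compatible s x c d"
  unfolding Cr_compatible_def
proof (intro ballI impI, elim conjE)
  fix p q assume pq: "p \<in> chart_dom c" "q \<in> chart_dom d" "chart_map c p = x" "chart_map d q = x"
  obtain t where t: "t \<in> chart_dom b" "chart_map b t = x" using assms(3) by (auto simp: chart_image_def)
  show "smooth_lift s c d p q"
    by (rule smooth_lift_trans[OF Cr_compatibleD[OF assms(1) pq(1) t(1) pq(3) t(2)] Cr_compatibleD[OF assms(2) t(1) pq(2) t(2) pq(4)]])
qed

lemma Cr_compatible_mono: "Cr_compatible s x c d \<Longrightarrow> r \<le> s \<Longrightarrow> Cr_compatible r x c d"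
  unfolding Cr_compatible_def by (auto intro: smooth_lift_mono)

lemma (in smooth_chart) Cr_compatible_embedding:
  assumes e: "orbifold_chart X e" "chart_embedding e c l h" "Cr_embedding s (chart_dom e) Dom l"
  shows "Cr_compatible s x e c"
  unfolding Cr_compatible_def
proof (intro ballI impI, elim conjE)
  fix p q assume p: "p \<in> chart_dom e" "chart_map e p = x" and q: "q \<in> Dom" "\<phi> q = x"
  have o: "open (chart_dom e)" using e(1) by (simp add: orbifold_chart_def)
  have lp: "l p \<in> Dom" "\<phi> (l p) = x" using chart_embeddingD(6,8)[OF e(2) o] p by auto
  then obtain g where g: "g \<in> carrier Grp" "q = act g (l p)" using map_eq_iff[OF lp(1) q(1)] q(2) by auto
  show "smooth_lift s e c p q"
    using smooth_lift_trans[OF smooth_lift_embedding[OF e(2,1,3) p(1)] smooth_lift_act[OF g(1) lp(1)]] g(2) by simp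
qed

text \<open>
  Near each point any lift agrees with a given smooth lift up to group elements, and these act smoothly.
\<close>

lemma (in smooth_chart) lift_on_smooth:
  assumes d: "smooth_chart X d s" and f: "lift_on c d P f" and cd: "\<And>z. z \<in> P \<Longrightarrow> Cr_compatible s (\<phi> z) c d"
  shows "Cr_on s f P"
proof (rule Cr_on_local)
  fix p assume p: "p \<in> P"
  interpret d: smooth_chart X d s by fact
  note F = f[unfolded lift_on_def]
  have pD: "p \<in> Dom" "f p \<in> d.Dom" "d.\<phi> (f p) = \<phi> p" using F p by auto
  then have "smooth_lift s c d p (f p)" using Cr_compatibleD[OF cd[OF p], of p "f p"] F p by auto
  then obtain Q g k where g: "open Q" "p \<in> Q" "Q \<subseteq> Dom" "g p = f p" "Cr_on s g Q" "g ` Q \<subseteq> d.Dom" "open (g ` Q)"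
    "Cr_on s k (g ` Q)" "\<And>z. z \<in> Q \<Longrightarrow> k (g z) = z" "\<And>z. z \<in> Q \<Longrightarrow> d.\<phi> (g z) = \<phi> z"
    by (rule smooth_liftE) blast
  let ?R = "P \<inter> Q"
  have gi: "inj_on g Q" using g(9) by (rule inj_on_inverseI)
  have l1: "lift_on c d ?R g"
    unfolding lift_on_def using F g Cr_on_continuous[OF g(5)] gi by (auto intro: continuous_on_subset inj_on_subset)
  have l2: "lift_on c d ?R f"
    unfolding lift_on_def using F g(1) by (auto intro: continuous_on_subset inj_on_subset)
  obtain b a V where V: "b \<in> carrier d.Grp" "a \<in> carrier Grp" "open V" "p \<in> V" "V \<subseteq> ?R" "act a ` V \<subseteq> ?R"
    "\<And>y. y \<in> V \<Longrightarrow> f y = d.act b (g (act a y))"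
    by (rule lifts_differ[OF d.orbifold_chart l1 l2, of p]) (use p g(2) in auto)
  have "Cr_on s (\<lambda>y. g (act a y)) V"
    by (rule Cr_on_compose[OF Cr_on_subset[OF Cr_act[OF V(2)]] g(5) V(3) g(1)]) (use V(5,6) g(3) in auto)
  then have "Cr_on s (\<lambda>y. d.act b (g (act a y))) V"
    by (rule Cr_on_compose[OF _ d.Cr_act[OF V(1)] V(3) d.open_Dom]) (use V(6) g(6) in blast)
  then have "Cr_on s f V" by (rule Cr_on_transform[OF _ V(3)]) (rule V(7))
  then show "\<exists>T. open T \<and> p \<in> T \<and> Cr_on s f T" using V(3,4) by blast
qed

text \<open>
  Both the embedding and its inverse are lifts.
\<close>

lemma (in smooth_chart) Cr_compatible_imp_Cr_embedding:
  assumes d: "smooth_chart X d s" and l: "chart_embedding c d l h" and cd: "\<And>x. Cr_compatible s x c d"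
  shows "Cr_embedding s Dom (chart_dom d) l"
proof -
  interpret d: smooth_chart X d s by fact
  note L = chart_embeddingD[OF l open_Dom]
  have lo: "open (l ` Dom)" by (rule invariance_of_domain[OF L(4) open_Dom L(5)])
  have "lift_on c d Dom l" unfolding lift_on_def using L open_Dom by auto
  then have 1: "Cr_on s l Dom" using cd by (rule lift_on_smooth[OF d])
  have "continuous_on (l ` Dom) (inv_into Dom l)"
    by (rule continuous_on_inverse_open[OF open_Dom L(4)]) (use L(5) in auto)
  moreover have "chart_map c (inv_into Dom l y) = d.\<phi> y" if "y \<in> l ` Dom" for y
    using that L(5,8) by auto
  ultimately have "lift_on d c (l ` Dom) (inv_into Dom l)"
    unfolding lift_on_def using lo L(6) by (auto simp: inj_on_inv_into L(5) intro: inv_into_into)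
  then have 2: "Cr_on s (inv_into Dom l) (l ` Dom)"
    using Cr_compatible_sym[OF cd] by (rule d.lift_on_smooth[OF smooth_chart_axioms])
  show ?thesis unfolding Cr_embedding_iff[OF open_Dom] using 1 2 L(5,6) lo by blast
qed

section \<open>The atlas of all compatible charts\<close>

text \<open>
  The charts whose groups match those of \<open>A\<close> and whose coordinates match those of \<open>S\<close>.
\<close>

definition compatible_charts :: "'x topology \<Rightarrow> enat \<Rightarrow> (real^'n, 'x) orbifold_chart set \<Rightarrow>
    (real^'n, 'x) orbifold_chart set \<Rightarrow> (real^'n, 'x) orbifold_chart set" where
  "compatible_charts X s A S = {c. orbifold_chart X c \<and> Cr_action s c \<and> (\<forall>x\<in>chart_image c. \<exists>a\<in>A. linked X x c a) \<and>
     (\<forall>d\<in>S. \<forall>x. Cr_compatible s x c d)}"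

lemma Cr_action_mono: "Cr_action s c \<Longrightarrow> r \<le> s \<Longrightarrow> Cr_action r c"
  unfolding Cr_action_def by (auto intro: Cr_on_mono)

lemma smooth_chartI: "orbifold_chart X c \<Longrightarrow> Cr_action s c \<Longrightarrow> 1 \<le> s \<Longrightarrow> smooth_chart X c s"
  by (simp add: smooth_chart_def smooth_chart_axioms_def chart_def)

lemma Cr_atlas_smooth_chart: "Cr_atlas s X A \<Longrightarrow> 1 \<le> s \<Longrightarrow> c \<in> A \<Longrightarrow> smooth_chart X c s"
proof -
  assume A: "Cr_atlas s X A" and s: "1 \<le> s" and c: "c \<in> A"
  have oc: "orbifold_chart X c" using A c unfolding Cr_atlas_def orbifold_atlas_def by blast
  then have "Cr_action s c" using A c unfolding Cr_atlas_def by (simp add: chart.Cr_action_iff[OF chart.intro])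
  then show ?thesis using oc s by (intro smooth_chartI)
qed

lemma orbifold_atlas_linked:
  assumes "orbifold_atlas X A" "a \<in> A" "b \<in> A" "x \<in> chart_image a" "x \<in> chart_image b"
  shows "linked X x a b"
proof -
  obtain e where "e \<in> A" "x \<in> chart_image e" "embeds_into e a" "embeds_into e b"
    using assms unfolding orbifold_atlas_def by blast
  moreover have "orbifold_chart X e" using assms(1) \<open>e \<in> A\<close> unfolding orbifold_atlas_def by blast
  ultimately show ?thesis unfolding linked_def by blast
qed

lemma Cr_compatible_vacuous: "x \<notin> chart_image c \<or> x \<notin> chart_image d \<Longrightarrow> Cr_compatible s x c d"
  unfolding Cr_compatible_def chart_image_def by (metis imageI)

lemma Cr_atlas_compat:
  fixes A :: "(real^'n, 'x) orbifold_chart set"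
  assumes A: "Cr_atlas s X A" "1 \<le> s" and ab: "a \<in> A" "b \<in> A"
  shows "Cr_compatible s x a b"
proof (cases "x \<in> chart_image a \<inter> chart_image b")
  case True
  interpret a: smooth_chart X a s by (rule Cr_atlas_smooth_chart[OF A ab(1)])
  interpret b: smooth_chart X b s by (rule Cr_atlas_smooth_chart[OF A ab(2)])
  obtain e where e: "e \<in> A" "x \<in> chart_image e" "embeds_into e a" "embeds_into e b"
    using A(1) ab True unfolding Cr_atlas_def orbifold_atlas_def by blast
  have oe: "orbifold_chart X e" using A(1) e(1) unfolding Cr_atlas_def orbifold_atlas_def by blast
  obtain l h where l: "chart_embedding e a l h" using e(3) unfolding embeds_into_def by blast
  obtain m k where m: "chart_embedding e b m k" using e(4) unfolding embeds_into_def by blast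
  have "Cr_embedding s (chart_dom e) (chart_dom a) l" "Cr_embedding s (chart_dom e) (chart_dom b) m"
    using A(1) e(1) ab l m unfolding Cr_atlas_def by blast+
  then have ea: "Cr_compatible s x e a" and eb: "Cr_compatible s x e b"
    using a.Cr_compatible_embedding[OF oe l] b.Cr_compatible_embedding[OF oe m] by auto
  show ?thesis by (rule Cr_compatible_trans[OF Cr_compatible_sym[OF ea] eb e(2)])
qed (auto intro: Cr_compatible_vacuous)

lemma compatible_chartsD:
  assumes "c \<in> compatible_charts X s A S"
  shows "orbifold_chart X c" "Cr_action s c" "\<And>x. x \<in> chart_image c \<Longrightarrow> \<exists>a\<in>A. linked X x c a"
    "\<And>d x. d \<in> S \<Longrightarrow> Cr_compatible s x c d"
  using assms by (auto simp: compatible_charts_def)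

lemma chart_image_subset_topspace: "orbifold_chart X c \<Longrightarrow> chart_image c \<subseteq> topspace X"
  unfolding orbifold_chart_def by (meson openin_subset)

text \<open>
  Two of the charts are linked over a common point through charts of \<open>A\<close>, whose actions are smooth;
  a linear chart that is C^s-embedded in one of them and factors through the link is the chart required
  on the overlap.
\<close>

theorem compatible_charts_Cr_atlas:
  assumes A: "Cr_atlas r X A" "1 \<le> r" and s: "1 \<le> s"
    and S: "S \<subseteq> compatible_charts X s A S" "topspace X \<subseteq> (\<Union>c\<in>S. chart_image c)"
  shows "Cr_atlas s X (compatible_charts X s A S)"
proof -
  let ?C = "compatible_charts X s A S"
  have sm: "smooth_chart X c s" if "c \<in> ?C" for c
    using compatible_chartsD(1,2)[OF that] s by (rule smooth_chartI)
  have compatC: "Cr_compatible s x c d" if c: "c \<in> ?C" and d: "d \<in> ?C" for c d x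
  proof (cases "x \<in> chart_image c")
    case True
    then obtain b where b: "b \<in> S" "x \<in> chart_image b"
      using S(2) chart_image_subset_topspace[OF compatible_chartsD(1)[OF c]] by blast
    show ?thesis
      using Cr_compatible_trans[OF compatible_chartsD(4)[OF c b(1)] Cr_compatible_sym[OF compatible_chartsD(4)[OF d b(1)]] b(2)] .
  qed (auto intro: Cr_compatible_vacuous)
  have overlap: "\<exists>e\<in>?C. x \<in> chart_image e \<and> chart_image e \<subseteq> chart_image c \<inter> chart_image d \<and> embeds_into e c \<and> embeds_into e d"
    if c: "c \<in> ?C" and d: "d \<in> ?C" and x: "x \<in> chart_image c \<inter> chart_image d" for c d x
  proof -
    interpret c: smooth_chart X c s by (rule sm[OF c])
    obtain a1 where a1: "a1 \<in> A" "linked X x c a1" using compatible_chartsD(3)[OF c] x by blast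
    obtain a2 where a2: "a2 \<in> A" "linked X x d a2" using compatible_chartsD(3)[OF d] x by blast
    have im: "x \<in> chart_image a" if "linked X x b a" for a b
      using that embeds_into_image unfolding linked_def by blast
    have "linked X x a1 a2"
      using A(1) a1(1) a2(1) im[OF a1(2)] im[OF a2(2)]
      unfolding Cr_atlas_def by (intro orbifold_atlas_linked) auto
    then have "linked X x c a2" by (rule linked_trans[OF Cr_atlas_smooth_chart[OF A a1(1)] a1(2)])
    then have "linked X x c d" by (rule linked_trans[OF Cr_atlas_smooth_chart[OF A a2(1)] _ linked_sym[OF a2(2)]])
    then obtain e where e: "orbifold_chart X e" "x \<in> chart_image e" "embeds_into e c" "embeds_into e d"
      unfolding linked_def by blast
    obtain f l where f: "linear_chart f" "orbifold_chart X f" "0 \<in> chart_dom f" "x = chart_map f 0"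
      "chart_embedding f c l id" "Cr_embedding s (chart_dom f) (chart_dom c) l" "embeds_into f e"
      by (rule c.common_linear_subchart[OF e(1,3) e(1,3) e(2) e(2)]) blast
    have fc: "embeds_into f c" using f(5) unfolding embeds_into_def by blast
    have fd: "embeds_into f d" by (rule embeds_into_trans[OF f(7) e(4) f(2) e(1)])
    have fim: "chart_image f \<subseteq> chart_image c" "chart_image f \<subseteq> chart_image d"
      using embeds_into_image[OF fc f(2)] embeds_into_image[OF fd f(2)] by auto
    have "f \<in> ?C"
      unfolding compatible_charts_def
    proof (intro CollectI conjI ballI allI)
      show "orbifold_chart X f" by fact
      show "Cr_action s f" by (rule linear_chart_smooth_action[OF f(1)])
      show "\<exists>a\<in>A. linked X y f a" if y: "y \<in> chart_image f" for y
      proof -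
        obtain a where a: "a \<in> A" "linked X y c a" using compatible_chartsD(3)[OF c] y fim(1) by blast
        have "linked X y f c" by (rule linked_of_embedding[OF f(2) fc y])
        then have "linked X y f a" by (rule linked_trans[OF c.smooth_chart_axioms _ a(2)])
        then show ?thesis using a(1) by blast
      qed
      show "Cr_compatible s y f b" if b: "b \<in> S" for b y
      proof (cases "y \<in> chart_image f")
        case True
        then have "y \<in> chart_image c" using fim(1) by blast
        then show ?thesis
          by (rule Cr_compatible_trans[OF c.Cr_compatible_embedding[OF f(2,5,6)] compatible_chartsD(4)[OF c b]])
      qed (auto intro: Cr_compatible_vacuous)
    qed
    moreover have "x \<in> chart_image f" using f(3,4) unfolding chart_image_def by blast
    ultimately show ?thesis using fc fd fim by blast
  qed
  have "orbifold_atlas X ?C"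
    unfolding orbifold_atlas_def
  proof (intro conjI ballI)
    show "orbifold_chart X c" if "c \<in> ?C" for c using compatible_chartsD(1)[OF that] .
    then have 1: "(\<Union>c\<in>?C. chart_image c) \<subseteq> topspace X" by (intro UN_least chart_image_subset_topspace)
    show "(\<Union>c\<in>?C. chart_image c) = topspace X"
      by (rule equalityI[OF 1 order_trans[OF S(2) UN_mono[OF S(1) order_refl]]])
  qed (rule overlap)
  moreover have "Cr_diffeomorphism s (chart_dom c) (chart_dom c) (chart_action c g)"
    if "c \<in> ?C" "g \<in> carrier (chart_group c)" for c g
    using chart.Cr_action_iff[OF chart.intro[OF compatible_chartsD(1)[OF that(1)]], of s] compatible_chartsD(2)[OF that(1)] that(2) by blast
  moreover have "Cr_embedding s (chart_dom c) (chart_dom d) l"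
    if "c \<in> ?C" "d \<in> ?C" "chart_embedding c d l h" for c d l h
    using smooth_chart.Cr_compatible_imp_Cr_embedding[OF sm[OF that(1)] sm[OF that(2)] that(3) compatC[OF that(1,2)]] .
  ultimately show ?thesis unfolding Cr_atlas_def by blast
qed

lemma atlas_subset_compatible_charts:
  assumes A: "Cr_atlas r X A" "1 \<le> r"
  shows "A \<subseteq> compatible_charts X r A A"
proof
  fix a assume a: "a \<in> A"
  interpret a: smooth_chart X a r by (rule Cr_atlas_smooth_chart[OF A a])
  have "linked X x a a" if "x \<in> chart_image a" for x
    by (rule linked_of_embedding[OF a.orbifold_chart embeds_into_refl[OF a.orbifold_chart] that])
  then show "a \<in> compatible_charts X r A A"
    unfolding compatible_charts_def using a.orbifold_chart a.smooth_action a Cr_atlas_compat[OF A a] by blast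
qed

lemma maximal_atlas_eq_compatible_charts:
  assumes A: "differential_structure r X \<O> A" "1 \<le> r"
  shows "compatible_charts X r A A = A"
proof -
  have a: "Cr_atlas r X A" using A(1) by (simp add: differential_structure_def)
  have sub: "A \<subseteq> compatible_charts X r A A" by (rule atlas_subset_compatible_charts[OF a A(2)])
  have "topspace X \<subseteq> (\<Union>c\<in>A. chart_image c)" using a by (simp add: Cr_atlas_def orbifold_atlas_def)
  then have "Cr_atlas r X (compatible_charts X r A A)"
    by (rule compatible_charts_Cr_atlas[OF a A(2,2) sub])
  then show ?thesis using A(1) sub unfolding differential_structure_def by blast
qed

text \<open>
  The charts that embed both into a common refinement of a reference atlas with \<open>A\<close> and into \<open>B\<close> form
  the common refinement of the reference atlas with \<open>B\<close>. Any two of them are linked through charts of \<open>A\<close>.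
\<close>

lemma compatible_structure_in_class:
  fixes A :: "(real^'n, 'x) orbifold_chart set"
  assumes O: "\<O> \<in> {A. orbifold_atlas X A} // atlas_equivalence X"
    and A: "A \<in> \<O>" "Cr_atlas r X A" "1 \<le> r" and B: "orbifold_atlas X B" "B \<subseteq> A"
  shows "B \<in> \<O>"
proof -
  obtain A0 where A0: "orbifold_atlas X A0" "\<O> = atlas_equivalence X `` {A0}"
    using O by (auto simp: quotient_def)
  then obtain C where C: "orbifold_atlas X C" "refines C A0" "refines C A"
    using A(1) unfolding atlas_equivalence_def by auto
  have aA: "orbifold_atlas X A" using A(2) by (simp add: Cr_atlas_def)
  have sm: "smooth_chart X a r" if "a \<in> A" for a by (rule Cr_atlas_smooth_chart[OF A(2,3) that])
  have Cc: "orbifold_chart X c" if "c \<in> C" for c using C(1) that unfolding orbifold_atlas_def by blast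
  define C' where "C' = {c. orbifold_chart X c \<and> (\<exists>d\<in>C. embeds_into c d) \<and> (\<exists>b\<in>B. embeds_into c b)}"
  have "orbifold_atlas X C'"
    unfolding orbifold_atlas_def
  proof (intro conjI ballI)
    show "orbifold_chart X c" if "c \<in> C'" for c using that by (simp add: C'_def)
    then have 1: "(\<Union>c\<in>C'. chart_image c) \<subseteq> topspace X" by (intro UN_least chart_image_subset_topspace)
    have 2: "x \<in> (\<Union>c\<in>C'. chart_image c)" if x: "x \<in> topspace X" for x
    proof -
      obtain c where c: "c \<in> C" "x \<in> chart_image c" using C(1) x unfolding orbifold_atlas_def by blast
      obtain a where a: "a \<in> A" "embeds_into c a" using C(3) c(1) unfolding refines_def by blast
      obtain b where b: "b \<in> B" "x \<in> chart_image b" using B(1) x unfolding orbifold_atlas_def by blast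
      have bA: "b \<in> A" using b(1) B(2) by blast
      have xa: "x \<in> chart_image a" using embeds_into_image[OF a(2) Cc[OF c(1)]] c(2) by blast
      have "linked X x c b"
        by (rule linked_trans[OF sm[OF a(1)] linked_of_embedding[OF Cc[OF c(1)] a(2) c(2)]
              orbifold_atlas_linked[OF aA a(1) bA xa b(2)]])
      then show ?thesis unfolding linked_def using c(1) b(1) by (auto simp: C'_def)
    qed
    show "(\<Union>c\<in>C'. chart_image c) = topspace X" by (rule equalityI[OF 1 subsetI[OF 2]])
    show "\<exists>e\<in>C'. x \<in> chart_image e \<and> chart_image e \<subseteq> chart_image c \<inter> chart_image d \<and> embeds_into e c \<and> embeds_into e d"
      if c: "c \<in> C'" and d: "d \<in> C'" and x: "x \<in> chart_image c \<inter> chart_image d" for c d x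
    proof -
      obtain b c' where b: "orbifold_chart X c" "b \<in> B" "embeds_into c b" "c' \<in> C" "embeds_into c c'"
        using c by (auto simp: C'_def)
      obtain b' where b': "orbifold_chart X d" "b' \<in> B" "embeds_into d b'" using d by (auto simp: C'_def)
      have bA: "b \<in> A" "b' \<in> A" using b b' B(2) by auto
      have xb: "x \<in> chart_image b" "x \<in> chart_image b'"
        using embeds_into_image[OF b(3,1)] embeds_into_image[OF b'(3,1)] x by auto
      have "linked X x c b'"
        by (rule linked_trans[OF sm[OF bA(1)] linked_of_embedding[OF b(1,3)] orbifold_atlas_linked[OF aA bA xb]])
          (use x in blast)
      then have "linked X x c d"
        by (rule linked_trans[OF sm[OF bA(2)] _ linked_sym[OF linked_of_embedding[OF b'(1,3)]]]) (use x in blast)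
      then obtain e where e: "orbifold_chart X e" "x \<in> chart_image e" "embeds_into e c" "embeds_into e d"
        unfolding linked_def by blast
      have "e \<in> C'" unfolding C'_def
        using e(1) b(2,4) embeds_into_trans[OF e(3) b(3) e(1) b(1)] embeds_into_trans[OF e(3) b(5) e(1) b(1)] by blast
      then show ?thesis
        using e embeds_into_image[OF e(3,1)] embeds_into_image[OF e(4,1)] by blast
    qed
  qed
  moreover have "refines C' A0"
    unfolding refines_def
  proof
    fix c assume "c \<in> C'"
    then obtain d where d: "orbifold_chart X c" "d \<in> C" "embeds_into c d" by (auto simp: C'_def)
    then obtain a where "a \<in> A0" "embeds_into d a" using C(2) unfolding refines_def by blast
    then show "\<exists>a\<in>A0. embeds_into c a" using embeds_into_trans[OF d(3) _ d(1) Cc[OF d(2)]] by blast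
  qed
  moreover have "refines C' B" unfolding refines_def by (auto simp: C'_def)
  ultimately show ?thesis using A0 B(1) unfolding atlas_equivalence_def by blast
qed

text \<open>
  The structure consists of all charts compatible with \<open>B\<close>. It is maximal because the charts of a
  larger C^s-atlas are compatible with \<open>B\<close>, and it lies in \<open>A\<close> because \<open>A\<close>, being maximal, contains
  every chart that is C^r-compatible with it.
\<close>

theorem compatible_structure_from_cover:
  fixes A :: "(real^'n, 'x) orbifold_chart set"
  assumes O: "orbifold X \<O>" and A: "differential_structure r X \<O> A" "1 \<le> r" "r \<le> s"
    and B: "B \<subseteq> A" "topspace X \<subseteq> (\<Union>b\<in>B. chart_image b)" "\<And>b. b \<in> B \<Longrightarrow> Cr_action s b"
      "\<And>b b' x. b \<in> B \<Longrightarrow> b' \<in> B \<Longrightarrow> Cr_compatible s x b b'"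
  shows "\<exists>\<beta>. differential_structure s X \<O> \<beta> \<and> \<beta> \<subseteq> A"
proof -
  have s: "1 \<le> s" using A(2,3) by (rule order_trans)
  have a: "Cr_atlas r X A" "A \<in> \<O>" using A(1) by (auto simp: differential_structure_def)
  have ac: "compatible_charts X r A A = A" by (rule maximal_atlas_eq_compatible_charts[OF A(1,2)])
  let ?C = "compatible_charts X s A B"
  have sub: "B \<subseteq> ?C"
  proof
    fix b assume b: "b \<in> B"
    then have "b \<in> compatible_charts X r A A" using B(1) ac by blast
    note 1 = compatible_chartsD(1,3)[OF this]
    show "b \<in> ?C" unfolding compatible_charts_def
      by (intro CollectI conjI ballI allI 1 B(3)[OF b] B(4)[OF b])
  qed
  have C: "Cr_atlas s X ?C" by (rule compatible_charts_Cr_atlas[OF a(1) A(2) s sub B(2)])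
  have CA: "?C \<subseteq> A"
  proof
    fix c assume c: "c \<in> ?C"
    have "Cr_compatible r x c d" if d: "d \<in> A" for d x
    proof (cases "x \<in> chart_image c")
      case True
      then obtain b where b: "b \<in> B" "x \<in> chart_image b"
        using B(2) chart_image_subset_topspace[OF compatible_chartsD(1)[OF c]] by blast
      have bA: "b \<in> A" using b(1) B(1) by blast
      show ?thesis
        by (rule Cr_compatible_trans[OF Cr_compatible_mono[OF compatible_chartsD(4)[OF c b(1)] A(3)] Cr_atlas_compat[OF a(1) A(2) bA d] b(2)])
    qed (auto intro: Cr_compatible_vacuous)
    moreover have "Cr_action r c" by (rule Cr_action_mono[OF compatible_chartsD(2)[OF c] A(3)])
    ultimately have "c \<in> compatible_charts X r A A"
      unfolding compatible_charts_def by (intro CollectI conjI ballI allI compatible_chartsD(1,3)[OF c])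
    then show "c \<in> A" using ac by simp
  qed
  have "?C \<in> \<O>"
    by (rule compatible_structure_in_class[OF _ a(2,1) A(2) _ CA]) (use O C in \<open>auto simp: orbifold_def Cr_atlas_def\<close>)
  moreover have "G = ?C" if G: "Cr_atlas s X G" "?C \<subseteq> G" for G
  proof -
    have "c \<in> ?C" if c: "c \<in> G" for c
    proof -
      interpret c: smooth_chart X c s by (rule Cr_atlas_smooth_chart[OF G(1) s c])
      have "\<exists>a\<in>A. linked X x c a" if x: "x \<in> chart_image c" for x
      proof -
        obtain b where b: "b \<in> B" "x \<in> chart_image b"
          using B(2) chart_image_subset_topspace[OF c.orbifold_chart] x by blast
        have "linked X x c b"
          using G b sub c x unfolding Cr_atlas_def by (intro orbifold_atlas_linked[of X G]) auto
        then show ?thesis using b(1) B(1) by blast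
      qed
      moreover have "Cr_compatible s x c d" if "d \<in> B" for d x
        using Cr_atlas_compat[OF G(1) s c] that sub G(2) by blast
      ultimately show ?thesis
        unfolding compatible_charts_def by (intro CollectI conjI ballI allI c.orbifold_chart c.smooth_action)
    qed
    then show ?thesis using G(2) by blast
  qed
  ultimately have "differential_structure s X \<O> ?C" unfolding differential_structure_def using C by blast
  then show ?thesis using CA by blast
qed

section \<open>Extending a smooth structure over a chart\<close>

text \<open>
  The condition \<open>max\<close> is maximality in its usable form: every chart compatible with \<open>A\<close> belongs to \<open>A\<close>.
\<close>

locale maximal_structure =
  fixes X :: "'x topology" and A :: "(real^'n, 'x) orbifold_chart set" and r s :: enat
  assumes hausdorff: "Hausdorff_space X" and atlas: "Cr_atlas r X A" and max: "compatible_charts X r A A = A"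
    and r: "1 \<le> r" and rs: "r \<le> s"
begin

lemma s: "1 \<le> s" using r rs by (rule order_trans)

lemma mem_chart: "c \<in> A \<Longrightarrow> orbifold_chart X c"
  using atlas unfolding Cr_atlas_def orbifold_atlas_def by blast

lemma Cr_compatible_mem: "c \<in> A \<Longrightarrow> d \<in> A \<Longrightarrow> Cr_compatible r x c d"
  by (rule Cr_atlas_compat[OF atlas r])

lemma embedded_chart_mem:
  assumes e: "orbifold_chart X e" "Cr_action r e" and c: "c \<in> A"
    and l: "chart_embedding e c l h" "Cr_embedding r (chart_dom e) (chart_dom c) l"
  shows "e \<in> A"
proof -
  interpret c: smooth_chart X c r by (rule Cr_atlas_smooth_chart[OF atlas r c])
  have ec: "embeds_into e c" using l(1) unfolding embeds_into_def by blast
  have "Cr_compatible r x e d" if d: "d \<in> A" for d x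
  proof (cases "x \<in> chart_image e")
    case True
    then have "x \<in> chart_image c" using embeds_into_image[OF ec e(1)] by blast
    then show ?thesis by (rule Cr_compatible_trans[OF c.Cr_compatible_embedding[OF e(1) l] Cr_compatible_mem[OF c d]])
  qed (auto intro: Cr_compatible_vacuous)
  moreover have "\<exists>a\<in>A. linked X x e a" if "x \<in> chart_image e" for x
    using linked_of_embedding[OF e(1) ec that] c by blast
  ultimately have "e \<in> compatible_charts X r A A"
    unfolding compatible_charts_def by (intro CollectI conjI ballI allI e)
  then show ?thesis by (simp add: max)
qed

lemma small_chart:
  assumes c: "c \<in> A" "Cr_action s c" and x: "x \<in> chart_image c" and U: "openin X U" "x \<in> U"
  obtains e where "e \<in> A" "linear_chart e" "x = chart_map e 0" "0 \<in> chart_dom e" "x \<in> chart_image e" "chart_image e \<subseteq> U"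
    "chart_image e \<subseteq> chart_image c" "\<And>y. Cr_compatible s y e c"
proof -
  interpret c: smooth_chart X c s by (rule smooth_chartI[OF mem_chart[OF c(1)] c(2) s])
  obtain p where p: "p \<in> c.Dom" "c.\<phi> p = x" using x by (auto simp: chart_image_def)
  let ?W = "{z \<in> c.Dom. c.\<phi> z \<in> U}"
  have W: "open ?W" "p \<in> ?W" using c.open_map_vimage[OF U(1)] p U(2) by auto
  obtain e l where e: "linear_chart e" "orbifold_chart X e" "0 \<in> chart_dom e" "l 0 = p"
    "chart_embedding e c l id" "Cr_embedding s (chart_dom e) c.Dom l" "l ` chart_dom e \<subseteq> ?W"
    by (rule c.linear_chart_at[OF p(1) W]) blast
  have eo: "open (chart_dom e)" using e(2) by (simp add: orbifold_chart_def)
  note E = chart_embeddingD(8)[OF e(5) eo]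
  show ?thesis
  proof (rule that[of e])
    show "e \<in> A"
      by (rule embedded_chart_mem[OF e(2) linear_chart_smooth_action[OF e(1)] c(1) e(5) Cr_embedding_mono[OF e(6) rs]])
    show x0: "x = chart_map e 0" using E[OF e(3)] e(4) p by simp
    then show "x \<in> chart_image e" using e(3) by (auto simp: chart_image_def)
    show "chart_image e \<subseteq> U"
    proof
      fix y assume "y \<in> chart_image e"
      then obtain z where z: "z \<in> chart_dom e" "y = chart_map e z" by (auto simp: chart_image_def)
      then show "y \<in> U" using E[OF z(1)] e(7) by auto
    qed
    show "chart_image e \<subseteq> chart_image c" by (rule embedding_image_subset[OF e(5) eo])
    show "Cr_compatible s y e c" for y by (rule c.Cr_compatible_embedding[OF e(2,5,6)])
  qed (use e in auto)
qed

text \<open>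
  A C^s structure on the open set covered by the charts.
\<close>

definition partial_structure :: "(real^'n, 'x) orbifold_chart set \<Rightarrow> bool" where
  "partial_structure S \<longleftrightarrow> S \<subseteq> A \<and> (\<forall>c\<in>S. Cr_action s c) \<and> (\<forall>c\<in>S. \<forall>d\<in>S. \<forall>x. Cr_compatible s x c d)"

abbreviation support :: "(real^'n, 'x) orbifold_chart set \<Rightarrow> 'x set" where
  "support S \<equiv> \<Union>c\<in>S. chart_image c"

lemma open_support: "partial_structure S \<Longrightarrow> openin X (support S)"
  unfolding partial_structure_def using mem_chart by (auto simp: orbifold_chart_def intro!: openin_clauses)

lemma partial_smooth_chart: "partial_structure S \<Longrightarrow> c \<in> S \<Longrightarrow> smooth_chart X c s"
  unfolding partial_structure_def using mem_chart s by (intro smooth_chartI) auto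

text \<open>
  The germs of coordinate changes from charts of the partial structure into the domain of \<open>c\<close>. They
  present the partial structure as a C^s structure on an open subset of Euclidean space.
\<close>

definition parametrizations ::
    "(real^'n, 'x) orbifold_chart set \<Rightarrow> (real^'n, 'x) orbifold_chart \<Rightarrow> ((real^'n) set \<times> (real^'n \<Rightarrow> real^'n)) set" where
  "parametrizations S c = {(D, l). \<exists>d\<in>S. open D \<and> D \<subseteq> chart_dom d \<and> Cr_embedding r D (chart_dom c) l \<and>
     (\<forall>z\<in>D. chart_map c (l z) = chart_map d z)}"

lemma parametrizations_patches:
  assumes S: "partial_structure S" and c: "c \<in> A"
  shows "smooth_patches r s {z \<in> chart_dom c. chart_map c z \<in> support S} (parametrizations S c)"
proof
  let ?N = "{z \<in> chart_dom c. chart_map c z \<in> support S}"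
  interpret c: chart X c by (rule chart.intro[OF mem_chart[OF c]])
  have SA: "d \<in> A" if "d \<in> S" for d using S that by (auto simp: partial_structure_def)
  show "1 \<le> r" by (rule r)
  show "open D \<and> Cr_embedding r D ?N l" if Dl: "(D, l) \<in> parametrizations S c" for D l
  proof -
    obtain d where d: "d \<in> S" "open D" "D \<subseteq> chart_dom d" "Cr_embedding r D c.Dom l"
      "\<And>z. z \<in> D \<Longrightarrow> c.\<phi> (l z) = chart_map d z"
      using Dl by (auto simp: parametrizations_def)
    note l = d(4)[unfolded Cr_embedding_iff[OF d(2)]]
    have "l z \<in> ?N" if "z \<in> D" for z
      using l d(1,3,5) that by (auto simp: chart_image_def)
    then show ?thesis using d(2) l unfolding Cr_embedding_iff[OF d(2)] by blast
  qed
  show "Cr_on s (\<lambda>x. inv_into D' l' (l x)) (D \<inter> l -` (l' ` D'))"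
    if Dl: "(D, l) \<in> parametrizations S c" and Dl': "(D', l') \<in> parametrizations S c" for D l D' l'
  proof -
    obtain d where d: "d \<in> S" "open D" "D \<subseteq> chart_dom d" "Cr_embedding r D c.Dom l"
      "\<And>z. z \<in> D \<Longrightarrow> c.\<phi> (l z) = chart_map d z"
      using Dl by (auto simp: parametrizations_def)
    obtain d' where d': "d' \<in> S" "open D'" "D' \<subseteq> chart_dom d'" "Cr_embedding r D' c.Dom l'"
      "\<And>z. z \<in> D' \<Longrightarrow> c.\<phi> (l' z) = chart_map d' z"
      using Dl' by (auto simp: parametrizations_def)
    note l = d(4)[unfolded Cr_embedding_iff[OF d(2)]] and l' = d'(4)[unfolded Cr_embedding_iff[OF d'(2)]]
    let ?P = "D \<inter> l -` (l' ` D')" and ?f = "\<lambda>x. inv_into D' l' (l x)"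
    have lc: "continuous_on D l" using l Cr_on_continuous by blast
    have lc': "continuous_on (l' ` D') (inv_into D' l')" using l' Cr_on_continuous by blast
    have f: "?f x \<in> D'" "l' (?f x) = l x" if "x \<in> ?P" for x
      using that by (auto simp: inv_into_into f_inv_into_f)
    have "lift_on d d' ?P ?f"
      unfolding lift_on_def
    proof (intro conjI ballI)
      show "open ?P" using continuous_open_preimage[OF lc d(2)] l' by blast
      show "?P \<subseteq> chart_dom d" using d(3) by blast
      show "continuous_on ?P ?f"
        by (rule continuous_on_compose2[OF lc' continuous_on_subset[OF lc]]) auto
      show "inj_on ?f ?P"
      proof (rule inj_onI)
        fix x y assume xy: "x \<in> ?P" "y \<in> ?P" "?f x = ?f y"
        have "l x = l' (?f x)" by (rule f(2)[OF xy(1), symmetric])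
        also have "\<dots> = l' (?f y)" by (simp only: xy(3))
        also have "\<dots> = l y" by (rule f(2)[OF xy(2)])
        finally have eq: "l x = l y" .
        have "inj_on l D" using l by blast
        from inj_onD[OF this, of x y] show "x = y" using eq xy(1,2) by blast
      qed
      show "?f ` ?P \<subseteq> chart_dom d'" using f(1) d'(3) by blast
      show "chart_map d' (?f x) = chart_map d x" if "x \<in> ?P" for x
        using d'(5)[OF f(1)[OF that]] d(5)[of x] f(2)[OF that] that by simp
    qed
    then show ?thesis
      by (rule smooth_chart.lift_on_smooth[OF partial_smooth_chart[OF S d(1)] partial_smooth_chart[OF S d'(1)]])
        (use S d(1) d'(1) in \<open>simp add: partial_structure_def\<close>)
  qed
  show "?N \<subseteq> (\<Union>(D, l)\<in>parametrizations S c. l ` D)"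
  proof
    fix z assume z: "z \<in> ?N"
    then obtain d p where d: "d \<in> S" "p \<in> chart_dom d" "c.\<phi> z = chart_map d p" by (auto simp: chart_image_def)
    have "smooth_lift r d c p z" by (rule Cr_compatibleD[OF Cr_compatible_mem[OF SA[OF d(1)] c] d(2) _ _ d(3)]) (use z in auto)
    then obtain P f where P: "open P" "p \<in> P" "P \<subseteq> chart_dom d" "f p = z" "Cr_embedding r P c.Dom f"
      "\<forall>z\<in>P. c.\<phi> (f z) = chart_map d z"
      unfolding smooth_lift_def by blast
    then have "(P, f) \<in> parametrizations S c" using d(1) unfolding parametrizations_def by blast
    then show "z \<in> (\<Union>(D, l)\<in>parametrizations S c. l ` D)" using P(2,4) by blast
  qed
qed

lemma parametrization_linear_image:
  assumes Dl: "(D, l) \<in> parametrizations S c" and c: "chart X c"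
    and T: "linear T" "linear T'" "\<And>z. T' (T z) = z" "\<And>z. T (T' z) = z"
    and inv: "\<And>z. z \<in> chart_dom c \<Longrightarrow> T z \<in> chart_dom c \<and> chart_map c (T z) = chart_map c z"
  shows "(D, T \<circ> l) \<in> parametrizations S c"
proof -
  obtain d where d: "d \<in> S" "open D" "D \<subseteq> chart_dom d" "Cr_embedding r D (chart_dom c) l"
    "\<And>z. z \<in> D \<Longrightarrow> chart_map c (l z) = chart_map d z"
    using Dl by (auto simp: parametrizations_def)
  note l = d(4)[unfolded Cr_embedding_iff[OF d(2)]]
  have lD: "l z \<in> chart_dom c" if "z \<in> D" for z using l that by blast
  have im: "(\<lambda>z. T (l z)) ` D = T' -` (l ` D)"
  proof (rule equalityI; rule subsetI)
    fix y assume "y \<in> T' -` (l ` D)"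
    then obtain z where "z \<in> D" "T' y = l z" by auto
    then show "y \<in> (\<lambda>z. T (l z)) ` D" using T(4)[of y] by (intro image_eqI[of _ _ z]) auto
  qed (use T(3) in auto)
  have o: "open (T' -` (l ` D))"
    using l T(2) by (intro open_vimage) (auto simp: linear_continuous_on linear_conv_bounded_linear)
  have "Cr_embedding r D (chart_dom c) (\<lambda>z. T (l z))"
  proof (rule Cr_embeddingI[of _ _ _ _ "\<lambda>y. inv_into D l (T' y)"])
    show "Cr_on r (\<lambda>z. T (l z)) D" using l by (intro Cr_on_linear_comp[OF T(1) d(2)]) blast
    show "(\<lambda>z. T (l z)) ` D \<subseteq> chart_dom c" using inv lD by blast
    show "open ((\<lambda>z. T (l z)) ` D)" unfolding im by (rule o)
    show "Cr_on r (\<lambda>y. inv_into D l (T' y)) ((\<lambda>z. T (l z)) ` D)"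
      unfolding im by (rule Cr_on_compose[OF Cr_on_linear[OF T(2) o], of r "inv_into D l" "l ` D"]) (use l o in auto)
    show "inv_into D l (T' (T (l z))) = z" if "z \<in> D" for z using l that T(3) by simp
  qed (rule d(2))
  moreover have "chart_map c (T (l z)) = chart_map d z" if "z \<in> D" for z using inv[OF lD[OF that]] d(5)[OF that] by simp
  ultimately show ?thesis unfolding parametrizations_def comp_def using d(1-3) by blast
qed

end

context maximal_structure begin

text \<open>
  The chart map of \<open>c\<close> is composed with the inverse of an equivariant diffeomorphism that is C^s for
  the partial structure near the compact set; the new coordinates are then C^s-compatible with \<open>S\<close>
  there, and the chart stays in \<open>A\<close> because only a C^r change of coordinates was made.
\<close>

lemma straighten_chart:
  assumes S: "partial_structure S" and c: "c \<in> A" "linear_chart c"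
    and K: "compactin X K" "K \<subseteq> support S" and V: "compact V" "V \<subseteq> chart_dom c"
      "\<forall>g\<in>carrier (chart_group c). \<forall>z\<in>V. chart_action c g z \<in> V"
  obtains c' W where "c' \<in> A" "linear_chart c'" "chart_image c' = chart_image c"
    "open W" "W \<subseteq> chart_dom c" "{z \<in> V. chart_map c z \<in> K} \<subseteq> W" "chart_map c ` W \<subseteq> support S"
    "\<And>x d. x \<in> chart_map c ` W \<Longrightarrow> d \<in> S \<Longrightarrow> Cr_compatible s x d c'"
proof -
  interpret c: smooth_chart X c r by (rule Cr_atlas_smooth_chart[OF atlas r c(1)])
  obtain T \<rho> where T: "finite_linear_group (T ` carrier c.Grp)" "\<rho> > 0"
    and dom: "c.Dom = finite_linear_group.polyball (T ` carrier c.Grp) \<rho>"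
    and actT: "\<And>g z. g \<in> carrier c.Grp \<Longrightarrow> z \<in> c.Dom \<Longrightarrow> c.act g z = T g z"
    using c(2) unfolding linear_chart_def by blast
  interpret T: finite_linear_group "T ` carrier c.Grp" by (rule T(1))
  have SA: "d \<in> A" if "d \<in> S" for d using S that by (auto simp: partial_structure_def)
  let ?N = "{z \<in> c.Dom. c.\<phi> z \<in> support S}"
  let ?K = "{z \<in> V. c.\<phi> z \<in> K}"
  have TD: "T g z \<in> c.Dom" "c.\<phi> (T g z) = c.\<phi> z" if "g \<in> carrier c.Grp" "z \<in> c.Dom" for g z
    using c.act_closed[OF that] c.map_act[OF that] actT[OF that] by auto
  have Kt: "K \<subseteq> topspace X" using K(1) by (rule compactin_subset_topspace)
  have "openin X (topspace X - K)"
    using compactin_imp_closedin[OF hausdorff K(1)] by (simp add: closedin_def)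
  then have "open {z \<in> c.Dom. c.\<phi> z \<in> topspace X - K}" by (rule c.open_map_vimage)
  then have "compact (V - {z \<in> c.Dom. c.\<phi> z \<in> topspace X - K})" by (rule compact_diff[OF V(1)])
  moreover have "V - {z \<in> c.Dom. c.\<phi> z \<in> topspace X - K} = ?K"
    using V(2) chart_image_subset_topspace[OF c.orbifold_chart] Kt by (auto simp: chart_image_def)
  ultimately have cK: "compact ?K" by simp
  have KN: "?K \<subseteq> ?N" using V(2) K(2) by blast
  have \<Lambda>T: "(D, R \<circ> l) \<in> parametrizations S c" if Dl: "(D, l) \<in> parametrizations S c" and R: "R \<in> T ` carrier c.Grp" for D l R
  proof -
    obtain R' where R': "R' \<in> T ` carrier c.Grp" "R' \<circ> R = id" "R \<circ> R' = id" using T.inverse_ex[OF R] by blast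
    show ?thesis
      by (rule parametrization_linear_image[OF Dl c.chart_axioms T.lin[OF R] T.lin[OF R'(1)]])
        (use R' R TD in \<open>auto simp: fun_eq_iff\<close>)
  qed
  have TN: "R ` ?N \<subseteq> ?N" if "R \<in> T ` carrier c.Grp" for R using that TD by auto
  have TK: "R ` ?K \<subseteq> ?K" if "R \<in> T ` carrier c.Grp" for R
    using that TD V(2) V(3) actT by (auto simp: subset_eq)
  obtain \<theta> \<theta>' L W where \<theta>: "Cr_on r \<theta> UNIV" "Cr_on r \<theta>' UNIV" "\<And>x. \<theta>' (\<theta> x) = x" "\<And>x. \<theta> (\<theta>' x) = x"
    and L: "compact L" "L \<subseteq> ?N" "\<And>x. x \<notin> L \<Longrightarrow> \<theta> x = x"
    and eq: "\<And>R x. R \<in> T ` carrier c.Grp \<Longrightarrow> \<theta> (R x) = R (\<theta> x)"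
    and W: "open W" "?K \<subseteq> W" "\<And>R. R \<in> T ` carrier c.Grp \<Longrightarrow> R ` W \<subseteq> W"
    and sm: "\<And>D l. (D, l) \<in> parametrizations S c \<Longrightarrow> Cr_on s (\<lambda>x. \<theta> (l x)) (D \<inter> l -` W)"
  proof (rule equivariant_smoothing[OF parametrizations_patches[OF S c(1)] T.finite_linear_group_axioms _ _ cK KN], goal_cases)
    case (4 \<theta> \<theta>' L W)
    show thesis by (rule 4(1)) (fact 4)+
  qed (assumption | rule \<Lambda>T TN TK)+
  have \<theta>D: "\<theta> x \<in> c.Dom" if x: "x \<in> c.Dom" for x
  proof (cases "\<theta> x \<in> L")
    case False
    then have "\<theta> x = x" using L(3)[of "\<theta> x"] \<theta>(3)[of "\<theta> x"] \<theta>(3)[of x] by simp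
    then show ?thesis using x by simp
  qed (use L(2) in blast)
  have \<theta>'D: "\<theta>' x \<in> c.Dom" if x: "x \<in> c.Dom" for x
  proof (cases "\<theta>' x \<in> L")
    case False
    then have "\<theta>' x = x" using L(3)[of "\<theta>' x"] \<theta>(4)[of x] by simp
    then show ?thesis using x by simp
  qed (use L(2) in blast)
  have eq': "\<theta>' (R x) = R (\<theta>' x)" if "R \<in> T ` carrier c.Grp" for R x
    using eq[OF that, of "\<theta>' x"] \<theta>(3,4) by metis
  have im: "\<theta>' ` c.Dom = c.Dom" using \<theta>D \<theta>'D \<theta>(3) by (metis image_subsetI subsetI subset_antisym imageI)
  have \<theta>c: "continuous_on c.Dom \<theta>'" using Cr_on_continuous[OF \<theta>(2)] continuous_on_subset by blast
  have inj: "inj_on \<theta>' c.Dom" using \<theta>(4) by (rule inj_on_inverseI)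
  define c' where "c' = subchart c (carrier c.Grp) c.Dom c.act \<theta>'"
  have c'D: "chart_dom c' = c.Dom" "chart_group c' = c.Grp" "chart_action c' = c.act" "chart_map c' = (\<lambda>z. c.\<phi> (\<theta>' z))"
    by (simp_all add: c'_def subchart_def)
  have 0: "c.Dom \<noteq> {}" unfolding dom using T.zero_in_polyball[OF T(2)] by blast
  have act': "c.act h z \<in> c.Dom \<and> \<theta>' (c.act h z) = c.act h (\<theta>' z)" if "h \<in> carrier c.Grp" "z \<in> c.Dom" for h z
    using c.act_closed[OF that] actT[OF that] actT[OF that(1) \<theta>'D[OF that(2)]] eq'[OF imageI[OF that(1)]] by simp
  have ext: "c.act h \<in> extensional c.Dom" if "h \<in> carrier c.Grp" for h
    using c.bij_prop0[OF that] by (simp add: Bij_def)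
  have oc': "orbifold_chart X c'" unfolding c'_def
    by (rule c.subchart_orbifold_chart[OF c.open_Dom c.connected_Dom \<theta>c inj _ c.subgroup_self ext act']) (use im in auto)
  have emb: "chart_embedding c' c \<theta>' id" unfolding c'_def
    by (rule c.subchart_embedding[OF c.open_Dom 0 \<theta>c inj _ c.subgroup_self act']) (use im in auto)
  have lc': "linear_chart c'"
    unfolding linear_chart_def c'D using T T.finite_linear_group_axioms dom actT by (intro exI[of _ T] exI[of _ \<rho>]) simp
  have Ce: "Cr_embedding r (chart_dom c') c.Dom \<theta>'"
    unfolding c'D
    by (rule Cr_embeddingI[of _ _ _ _ \<theta>])
      (use c.open_Dom im \<theta>(4) Cr_on_subset[OF \<theta>(1)] Cr_on_subset[OF \<theta>(2)] in auto)
  have c'A: "c' \<in> A" by (rule embedded_chart_mem[OF oc' linear_chart_smooth_action[OF lc'] c(1) emb Ce])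
  let ?W = "W \<inter> ?N"
  have oN: "open ?N" by (rule c.open_map_vimage[OF open_support[OF S]])
  have key: "Cr_compatible s x d c'" if x: "x \<in> c.\<phi> ` ?W" and d: "d \<in> S" for x d
    unfolding Cr_compatible_def c'D
  proof (intro ballI impI, elim conjE)
    fix p q assume p: "p \<in> chart_dom d" "chart_map d p = x" and q: "q \<in> c.Dom" "c.\<phi> (\<theta>' q) = x"
    obtain w where w: "w \<in> W" "w \<in> c.Dom" "x = c.\<phi> w" using x by blast
    obtain g where g: "g \<in> carrier c.Grp" "\<theta>' q = c.act g w"
      using c.map_eq_iff[OF w(2) \<theta>'D[OF q(1)]] q(2) w(3) by auto
    have qW: "\<theta>' q \<in> W" using g actT[OF g(1) w(2)] W(3)[OF imageI[OF g(1)]] w(1) by auto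
    have "smooth_lift r d c p (\<theta>' q)"
      by (rule Cr_compatibleD[OF Cr_compatible_mem[OF SA[OF d] c(1)] p(1) \<theta>'D[OF q(1)] p(2) q(2)])
    then obtain P f where P: "open P" "p \<in> P" "P \<subseteq> chart_dom d" "f p = \<theta>' q" "Cr_embedding r P c.Dom f"
      "\<And>z. z \<in> P \<Longrightarrow> c.\<phi> (f z) = chart_map d z"
      unfolding smooth_lift_def by blast
    have Pf: "(P, f) \<in> parametrizations S c" using P d unfolding parametrizations_def by blast
    note f = P(5)[unfolded Cr_embedding_iff[OF P(1)]]
    let ?P = "P \<inter> f -` W"
    define k where "k = inv_into P f"
    have fc: "continuous_on P f" using f Cr_on_continuous by blast
    have oP: "open ?P" by (rule continuous_open_preimage[OF fc P(1) W(1)])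
    have fk: "k (f z) = z" if "z \<in> P" for z using f that by (simp add: k_def)
    have fD: "f z \<in> c.Dom" if "z \<in> P" for z using f that by blast
    have im2: "(\<lambda>z. \<theta> (f z)) ` ?P = \<theta>' -` (f ` P \<inter> W)"
    proof (rule equalityI; rule subsetI)
      fix y assume "y \<in> \<theta>' -` (f ` P \<inter> W)"
      then obtain z where "z \<in> P" "f z \<in> W" "\<theta>' y = f z" by auto
      then show "y \<in> (\<lambda>z. \<theta> (f z)) ` ?P" using \<theta>(4)[of y] by (intro image_eqI[of _ _ z]) auto
    qed (use \<theta>(3) in auto)
    have o2: "open (\<theta>' -` (f ` P \<inter> W))"
      using f W(1) Cr_on_continuous[OF \<theta>(2)] by (intro open_vimage open_Int) auto
    have k1: "Cr_on r (\<lambda>y. k (\<theta>' y)) (\<theta>' -` (f ` P \<inter> W))"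
      by (rule Cr_on_compose[OF Cr_on_subset[OF \<theta>(2)], of _ k "f ` P"]) (use f o2 in \<open>auto simp: k_def\<close>)
    have k2: "Cr_on s (\<lambda>y. k (\<theta>' y)) ((\<lambda>z. \<theta> (f z)) ` ?P)"
      by (rule inverse_smooth_upgrade[OF oP sm[OF Pf] s _ _ r]) (use o2 k1 fk \<theta>(3) im2 in auto)
    show "smooth_lift s d c' p q"
    proof (rule smooth_liftI[of ?P _ _ "\<lambda>z. \<theta> (f z)" _ _ _ "\<lambda>y. k (\<theta>' y)"])
      show "p \<in> ?P" "\<theta> (f p) = q" using P(2,4) qW \<theta>(4) by auto
      show "?P \<subseteq> chart_dom d" using P(3) by blast
      show "(\<lambda>z. \<theta> (f z)) ` ?P \<subseteq> chart_dom c'" unfolding c'D using fD \<theta>D by blast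
      show "open ((\<lambda>z. \<theta> (f z)) ` ?P)" unfolding im2 by (rule o2)
      show "k (\<theta>' (\<theta> (f z))) = z" if "z \<in> ?P" for z using that fk \<theta>(3) by simp
      show "chart_map c' (\<theta> (f z)) = chart_map d z" if "z \<in> ?P" for z using that P(6) \<theta>(3) by (simp add: c'D)
    qed (rule oP sm[OF Pf] k2)+
  qed
  show ?thesis
  proof (rule that[OF c'A lc'])
    show "chart_image c' = chart_image c" unfolding chart_image_def c'D using im by (metis image_image)
    show "open ?W" using W(1) oN by blast
    show "?K \<subseteq> ?W" using W(2) KN by blast
    show "Cr_compatible s x d c'" if "x \<in> c.\<phi> ` ?W" "d \<in> S" for x d by (rule key[OF that])
  qed blast+
qed

end

section \<open>Countable exhaustion and the theorem\<close>

text \<open>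
  In a locally finite refinement by relatively compact sets every member meets only finitely many
  others, so chains of overlapping members form countable classes. The unions of the classes are open
  and disjoint, so each component lies in a single one.
\<close>

lemma countable_subcover:
  assumes para: "paracompact_space X" and comp: "countable (connected_components_of X)"
    and U: "\<And>U. U \<in> \<U> \<Longrightarrow> openin X U" "\<And>U. U \<in> \<U> \<Longrightarrow> \<exists>C. compactin X C \<and> U \<subseteq> C" "\<Union>\<U> = topspace X"
  obtains \<V> where "\<V> \<subseteq> \<U>" "countable \<V>" "\<Union>\<V> = topspace X"
proof -
  have "(\<forall>U\<in>\<U>. openin X U) \<and> \<Union>\<U> = topspace X" using U(1,3) by blast
  from mp[OF spec[OF para[unfolded paracompact_space_def]] this]
  obtain \<L>0 where 0: "(\<forall>V\<in>\<L>0. openin X V) \<and> \<Union>\<L>0 = topspace X \<and> (\<forall>V\<in>\<L>0. \<exists>U\<in>\<U>. V \<subseteq> U) \<and>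
    locally_finite_in X \<L>0" by (rule exE)
  then have L0: "\<And>L. L \<in> \<L>0 \<Longrightarrow> openin X L" "\<Union>\<L>0 = topspace X" "\<And>L. L \<in> \<L>0 \<Longrightarrow> \<exists>U\<in>\<U>. L \<subseteq> U"
    "locally_finite_in X \<L>0" by simp_all
  define \<L> where "\<L> = \<L>0 - {{}}"
  have L: "openin X L" "L \<noteq> {}" if "L \<in> \<L>" for L using that L0(1) by (auto simp: \<L>_def)
  have UL: "\<Union>\<L> = topspace X" using L0(2) by (auto simp: \<L>_def)
  have fin: "finite {L \<in> \<L>. L \<inter> C \<noteq> {}}" if C: "compactin X C" for C
  proof -
    have "\<exists>W. openin X W \<and> x \<in> W \<and> finite {L \<in> \<L>0. L \<inter> W \<noteq> {}}" if "x \<in> C" for x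
      using L0(4) compactin_subset_topspace[OF C] that unfolding locally_finite_in_def by blast
    then obtain W where W: "\<And>x. x \<in> C \<Longrightarrow> openin X (W x) \<and> x \<in> W x \<and> finite {L \<in> \<L>0. L \<inter> W x \<noteq> {}}" by metis
    have "(\<forall>U\<in>W ` C. openin X U) \<and> C \<subseteq> \<Union>(W ` C)" using W by auto
    then obtain F where F: "finite F" "F \<subseteq> W ` C" "C \<subseteq> \<Union>F" using C unfolding compactin_def by meson
    then obtain D where D: "finite D" "D \<subseteq> C" "F = W ` D" by (meson finite_subset_image)
    have "{L \<in> \<L>. L \<inter> C \<noteq> {}} \<subseteq> (\<Union>x\<in>D. {L \<in> \<L>0. L \<inter> W x \<noteq> {}})" using F(3) D(3) by (auto simp: \<L>_def)
    moreover have "finite (\<Union>x\<in>D. {L \<in> \<L>0. L \<inter> W x \<noteq> {}})" using D W by auto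
    ultimately show ?thesis by (rule finite_subset)
  qed
  define R where "R = {(L, L'). L \<in> \<L> \<and> L' \<in> \<L> \<and> L \<inter> L' \<noteq> {}}"
  have "countable (R `` {L})" for L
  proof (cases "L \<in> \<L>")
    case True
    then obtain U where "U \<in> \<U>" "L \<subseteq> U" using L0(3) by (auto simp: \<L>_def)
    then obtain C where C: "compactin X C" "L \<subseteq> C" using U(2) by (meson order_trans)
    have "R `` {L} \<subseteq> {L' \<in> \<L>. L' \<inter> C \<noteq> {}}" using C(2) by (auto simp: R_def)
    then show ?thesis using fin[OF C(1)] by (meson countable_finite finite_subset)
  next
    case False
    then have "R `` {L} = {}" by (auto simp: R_def)
    then show ?thesis by simp
  qed
  then have "countable (R `` Y)" if "countable Y" for Y
    using that by (subst Image_eq_UN) (rule countable_UN)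
  then have cls: "countable (R\<^sup>* `` {L})" for L by (intro countable_rtrancl) auto
  have "\<exists>L\<in>\<L>. L \<inter> C \<noteq> {}" if "C \<in> connected_components_of X" for C
  proof -
    have "C \<noteq> {}" "C \<subseteq> topspace X"
      using that nonempty_connected_components_of connected_components_of_subset by blast+
    then show ?thesis using UL by blast
  qed
  then obtain M where M: "\<And>C. C \<in> connected_components_of X \<Longrightarrow> M C \<in> \<L> \<and> M C \<inter> C \<noteq> {}" by metis
  have cl: "L \<in> R\<^sup>* `` {M C}" if C: "C \<in> connected_components_of X" and L': "L \<in> \<L>" "L \<inter> C \<noteq> {}" for C L
  proof (rule ccontr)
    assume nL: "L \<notin> R\<^sup>* `` {M C}"
    let ?K = "R\<^sup>* `` {M C}"
    have KL: "?K \<subseteq> \<L>"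
    proof
      fix L' assume "L' \<in> ?K"
      then have "(M C, L') \<in> R\<^sup>*" by simp
      then show "L' \<in> \<L>" using M[OF C] by (induction rule: rtrancl_induct) (auto simp: R_def)
    qed
    have "openin X (\<Union>?K)" using KL L(1) by (intro openin_Union) blast
    moreover have "openin X (\<Union>(\<L> - ?K))" using L(1) by (intro openin_Union) blast
    moreover have "C \<subseteq> \<Union>?K \<union> \<Union>(\<L> - ?K)" using connected_components_of_subset[OF C] UL by blast
    moreover have "\<Union>?K \<inter> \<Union>(\<L> - ?K) \<inter> C = {}"
    proof -
      have "P \<inter> Q = {}" if "P \<in> ?K" "Q \<in> \<L> - ?K" for P Q
      proof (rule ccontr)
        assume "P \<inter> Q \<noteq> {}"
        then have "(P, Q) \<in> R" using that KL by (auto simp: R_def)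
        then have "Q \<in> ?K" using that(1) by (auto intro: rtrancl_into_rtrancl)
        then show False using that(2) by blast
      qed
      then show ?thesis by blast
    qed
    moreover have "\<Union>?K \<inter> C \<noteq> {}" using M[OF C] by blast
    moreover have "\<Union>(\<L> - ?K) \<inter> C \<noteq> {}" using L' nL by blast
    moreover have "connectedin X C" using connectedin_connected_components_of[OF C] .
    ultimately show False unfolding connectedin by blast
  qed
  have ex: "\<exists>C\<in>connected_components_of X. L \<inter> C \<noteq> {}" if "L \<in> \<L>" for L
  proof -
    have "L \<subseteq> \<Union>(connected_components_of X)"
      using openin_subset[OF L(1)[OF that]] by (simp add: Union_connected_components_of)
    then show ?thesis using L(2)[OF that] by blast
  qed
  have "\<L> \<subseteq> (\<Union>C\<in>connected_components_of X. R\<^sup>* `` {M C})"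
  proof
    fix L assume "L \<in> \<L>"
    with ex cl show "L \<in> (\<Union>C\<in>connected_components_of X. R\<^sup>* `` {M C})" by (meson UN_I)
  qed
  moreover have "countable (\<Union>C\<in>connected_components_of X. R\<^sup>* `` {M C})" using comp cls by (intro countable_UN) auto
  ultimately have cL: "countable \<L>" by (rule countable_subset)
  obtain u where u: "\<And>L. L \<in> \<L> \<Longrightarrow> u L \<in> \<U> \<and> L \<subseteq> u L" using L0(3) unfolding \<L>_def by (metis Diff_iff)
  show ?thesis
  proof (rule that[of "u ` \<L>"])
    show "u ` \<L> \<subseteq> \<U>" using u by blast
    show "countable (u ` \<L>)" using cL by simp
    have 1: "\<Union>(u ` \<L>) \<subseteq> topspace X" unfolding U(3)[symmetric] using u by (intro Union_mono) auto
    have 2: "\<Union>\<L> \<subseteq> \<Union>(u ` \<L>)" using u by blast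
    show "\<Union>(u ` \<L>) = topspace X" by (rule equalityI[OF 1]) (use 2 UL in simp)
  qed
qed

lemma (in chart) compact_map_image:
  assumes "compact V" "V \<subseteq> Dom" shows "compactin X (\<phi> ` V)"
proof (rule image_compactin)
  show "compactin (top_of_set Dom) V" using assms by (simp add: compactin_subtopology)
  have "\<phi> ` Dom \<subseteq> topspace X" using openin_subset[OF open_image] by (simp add: chart_image_def)
  then show "continuous_map (top_of_set Dom) X \<phi>"
    using open_map_vimage by (auto simp: continuous_map_def openin_open_eq[OF open_Dom])
qed

context maximal_structure begin

text \<open>
  The old structure is kept on \<open>N1\<close>, the complement of a compact neighbourhood of the new piece
  together with the region \<open>W\<close> where the straightened chart is compatible with it. The new chart is
  used over an open set inside the compact neighbourhood, so it meets \<open>N1\<close> only in that region.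
\<close>

lemma extend_partial_structure:
  assumes S: "partial_structure S" and c: "c \<in> A" "linear_chart c"
    and K: "compactin X K" "K \<subseteq> support S" and V0: "compact V0" "V0 \<subseteq> chart_dom c"
  obtains S' where "partial_structure S'" "K \<union> chart_map c ` V0 \<subseteq> support S'"
    "\<And>x d e. x \<in> K \<Longrightarrow> d \<in> S \<Longrightarrow> e \<in> S' \<Longrightarrow> Cr_compatible s x d e"
proof -
  interpret c: chart X c by (rule chart.intro[OF mem_chart[OF c(1)]])
  obtain \<zeta> :: "real^'n \<Rightarrow> real" and O1 P where O1: "open O1" "V0 \<subseteq> O1" "O1 \<subseteq> P" "compact P" "P \<subseteq> c.Dom"
    by (rule smooth_bump[OF V0(1) c.open_Dom V0(2)]) blast
  define V where "V = (\<Union>g\<in>carrier c.Grp. c.act g ` P)"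
  have V: "compact V" "V \<subseteq> c.Dom" "P \<subseteq> V"
  proof -
    show "compact V" unfolding V_def using c.finite_Grp O1(4,5) continuous_on_subset[OF c.continuous_act]
      by (intro compact_UN compact_continuous_image) auto
    show "V \<subseteq> c.Dom" unfolding V_def using c.act_closed O1(5) by blast
    show "P \<subseteq> V"
    proof
      fix z assume z: "z \<in> P"
      then have "z = c.act \<one>\<^bsub>c.Grp\<^esub> z" using c.act_one O1(5) by auto
      then show "z \<in> V" unfolding V_def using z c.one_closed by blast
    qed
  qed
  have Vinv: "\<forall>h\<in>carrier c.Grp. \<forall>z\<in>V. c.act h z \<in> V"
  proof (intro ballI)
    fix h z assume h: "h \<in> carrier c.Grp" and z: "z \<in> V"
    obtain g w where g: "g \<in> carrier c.Grp" "w \<in> P" "z = c.act g w" using z unfolding V_def by blast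
    then have "c.act h z = c.act (h \<otimes>\<^bsub>c.Grp\<^esub> g) w" using c.composition_rule h O1(5) by auto
    then show "c.act h z \<in> V" unfolding V_def using g h c.m_closed by blast
  qed
  obtain c' W where c': "c' \<in> A" "linear_chart c'" "chart_image c' = chart_image c"
    and W: "open W" "W \<subseteq> c.Dom" "{z \<in> V. c.\<phi> z \<in> K} \<subseteq> W" "c.\<phi> ` W \<subseteq> support S"
    and key: "\<And>x d. x \<in> c.\<phi> ` W \<Longrightarrow> d \<in> S \<Longrightarrow> Cr_compatible s x d c'"
  proof (rule straighten_chart[OF S c K V(1,2) Vinv], goal_cases)
    case (1 c' W)
    show thesis by (rule 1(1)) (fact 1)+
  qed
  define N1 where "N1 = (support S - c.\<phi> ` V) \<union> c.\<phi> ` W"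
  have SA: "d \<in> A" "Cr_action s d" if "d \<in> S" for d using S that by (auto simp: partial_structure_def)
  have compS: "Cr_compatible s x d d'" if "d \<in> S" "d' \<in> S" for x d d' using S that by (auto simp: partial_structure_def)
  have "closedin X (c.\<phi> ` V)" by (rule compactin_imp_closedin[OF hausdorff c.compact_map_image[OF V(1,2)]])
  then have oN: "openin X N1"
    unfolding N1_def by (intro openin_Un openin_diff open_support[OF S] c.open_map_image W(1,2))
  have N1S: "N1 \<subseteq> support S" using W(4) unfolding N1_def by blast
  have KN: "K \<subseteq> N1"
  proof
    fix x assume x: "x \<in> K"
    show "x \<in> N1"
    proof (cases "x \<in> c.\<phi> ` V")
      case True
      then show ?thesis using W(3) x unfolding N1_def by blast
    next
      case False
      then show ?thesis using K(2) x unfolding N1_def by blast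
    qed
  qed
  have oO: "openin X (c.\<phi> ` O1)" using O1 by (intro c.open_map_image) auto
  have OC: "c.\<phi> ` O1 \<subseteq> chart_image c'" and WC: "c.\<phi> ` W \<subseteq> chart_image c'"
    unfolding c'(3) unfolding chart_image_def using O1(3,5) W(2) by (auto intro!: image_mono)
  define S1 where "S1 = {e \<in> A. Cr_action s e \<and> chart_image e \<subseteq> N1 \<and> (\<forall>d\<in>S. \<forall>x. Cr_compatible s x e d)}"
  define S2 where "S2 = {e \<in> A. Cr_action s e \<and> chart_image e \<subseteq> c.\<phi> ` O1 \<and> (\<forall>x. Cr_compatible s x e c')}"
  have 11: "Cr_compatible s x e e'" if e: "e \<in> S1" "e' \<in> S1" for x e e'
  proof (cases "x \<in> chart_image e")
    case True
    then obtain d where d: "d \<in> S" "x \<in> chart_image d" using e(1) N1S unfolding S1_def by blast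
    show ?thesis by (rule Cr_compatible_trans[OF _ Cr_compatible_sym d(2)]) (use e d(1) in \<open>auto simp: S1_def\<close>)
  qed (auto intro: Cr_compatible_vacuous)
  have 22: "Cr_compatible s x e e'" if e: "e \<in> S2" "e' \<in> S2" for x e e'
  proof (cases "x \<in> chart_image e")
    case True
    then have x: "x \<in> chart_image c'" using e(1) OC unfolding S2_def by blast
    have "Cr_compatible s x e c'" "Cr_compatible s x e' c'" using e by (auto simp: S2_def)
    then show ?thesis using Cr_compatible_trans[OF _ Cr_compatible_sym x] by blast
  qed (auto intro: Cr_compatible_vacuous)
  have S2c': "Cr_compatible s x d e" if x: "x \<in> c.\<phi> ` W" and d: "d \<in> S" and e: "e \<in> S2" for x d e
  proof -
    have xc: "x \<in> chart_image c'" using x WC by blast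
    have "Cr_compatible s x e c'" using e by (simp add: S2_def)
    then show ?thesis by (rule Cr_compatible_trans[OF key[OF x d] Cr_compatible_sym xc])
  qed
  have 12: "Cr_compatible s x e e'" if e: "e \<in> S1" "e' \<in> S2" for x e e'
  proof (cases "x \<in> chart_image e \<and> x \<in> chart_image e'")
    case True
    then have x: "x \<in> N1" "x \<in> c.\<phi> ` O1" using e unfolding S1_def S2_def by blast+
    then have xW: "x \<in> c.\<phi> ` W" using O1(3) V(3) unfolding N1_def by blast
    obtain d where d: "d \<in> S" "x \<in> chart_image d" using x(1) N1S by blast
    have "Cr_compatible s x e d" using e(1) d(1) by (simp add: S1_def)
    then show ?thesis by (rule Cr_compatible_trans[OF _ S2c'[OF xW d(1) e(2)] d(2)])
  qed (auto intro: Cr_compatible_vacuous)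
  have part: "partial_structure (S1 \<union> S2)"
    unfolding partial_structure_def
  proof (intro conjI ballI allI)
    show "S1 \<union> S2 \<subseteq> A" by (auto simp: S1_def S2_def)
    show "Cr_action s e" if "e \<in> S1 \<union> S2" for e using that by (auto simp: S1_def S2_def)
    show "Cr_compatible s x e e'" if "e \<in> S1 \<union> S2" "e' \<in> S1 \<union> S2" for x e e'
      using that 11 22 12 Cr_compatible_sym[OF 12] by blast
  qed
  have cov1: "x \<in> support (S1 \<union> S2)" if x: "x \<in> N1" for x
  proof -
    obtain d where d: "d \<in> S" "x \<in> chart_image d" using x N1S by blast
    obtain e where e: "e \<in> A" "linear_chart e" "x \<in> chart_image e" "chart_image e \<subseteq> N1"
      "chart_image e \<subseteq> chart_image d" "\<And>y. Cr_compatible s y e d"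
      by (rule small_chart[OF SA[OF d(1)] d(2) oN x]) blast
    have "Cr_compatible s y e d'" if d': "d' \<in> S" for d' y
    proof (cases "y \<in> chart_image e")
      case True
      then have "y \<in> chart_image d" using e(5) by blast
      then show ?thesis by (rule Cr_compatible_trans[OF e(6) compS[OF d(1) d']])
    qed (auto intro: Cr_compatible_vacuous)
    then have "e \<in> S1" unfolding S1_def using e linear_chart_smooth_action by blast
    then show ?thesis using e(3) by blast
  qed
  have cov2: "x \<in> support (S1 \<union> S2)" if x: "x \<in> c.\<phi> ` O1" for x
  proof -
    have xc: "x \<in> chart_image c'" using x OC by blast
    obtain e where e: "e \<in> A" "linear_chart e" "x \<in> chart_image e" "chart_image e \<subseteq> c.\<phi> ` O1" "\<And>y. Cr_compatible s y e c'"
      by (rule small_chart[OF c'(1) linear_chart_smooth_action[OF c'(2)] xc oO x]) blast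
    then have "e \<in> S2" unfolding S2_def using linear_chart_smooth_action by blast
    then show ?thesis using e(3) by blast
  qed
  have near_K: "Cr_compatible s x d e" if x: "x \<in> K" and d: "d \<in> S" and e: "e \<in> S1 \<union> S2" for x d e
  proof (cases "e \<in> S1")
    case True
    then have "Cr_compatible s x e d" using d by (simp add: S1_def)
    then show ?thesis by (rule Cr_compatible_sym)
  next
    case False
    then have e2: "e \<in> S2" using e by blast
    show ?thesis
    proof (cases "x \<in> chart_image e")
      case True
      then have "x \<in> c.\<phi> ` O1" using e2 unfolding S2_def by blast
      then have "x \<in> c.\<phi> ` W" using W(3) O1(3) V(3) x by blast
      then show ?thesis by (rule S2c'[OF _ d e2])
    qed (auto intro: Cr_compatible_vacuous)
  qed
  show ?thesis
  proof (rule that[OF part])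
    show "K \<union> c.\<phi> ` V0 \<subseteq> support (S1 \<union> S2)"
    proof
      fix x assume "x \<in> K \<union> c.\<phi> ` V0"
      then have "x \<in> N1 \<or> x \<in> c.\<phi> ` O1" using KN O1(2) by blast
      then show "x \<in> support (S1 \<union> S2)" using cov1 cov2 by blast
    qed
  qed (rule near_K)
qed

text \<open>
  The structures \<open>S i\<close> live on neighbourhoods of an increasing sequence of compact sets \<open>K i\<close>, and
  later ones agree with \<open>S i\<close> over \<open>K i\<close>. The charts compatible with \<open>S i\<close> inside the interior \<open>G i\<close>
  therefore fit together for all \<open>i\<close>.
\<close>

lemma exists_compatible_cover:
  assumes para: "paracompact_space X" and comp: "countable (connected_components_of X)"
  obtains B where "partial_structure B" "topspace X \<subseteq> support B"
proof (cases "topspace X = {}")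
  case True
  show ?thesis by (rule that[of "{}"]) (use True in \<open>auto simp: partial_structure_def\<close>)
next
  case False
  \<comment> \<open>the charts of the countable cover need only be of class C^r\<close>
  interpret r: maximal_structure X A r r
    using hausdorff atlas max r by unfold_locales auto
  define good where "good c V O' \<longleftrightarrow> c \<in> A \<and> linear_chart c \<and> compact V \<and> V \<subseteq> chart_dom c \<and> open O' \<and> O' \<subseteq> V"
    for c :: "(real^'n, 'x) orbifold_chart" and V O'
  define \<U> where "\<U> = {U. \<exists>c V O'. good c V O' \<and> U = chart_map c ` O'}"
  have oU: "openin X U" and cU: "\<exists>C. compactin X C \<and> U \<subseteq> C" if U: "U \<in> \<U>" for U
  proof -
    obtain c V O' where g: "good c V O'" "U = chart_map c ` O'" using U unfolding \<U>_def by blast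
    interpret c: chart X c using g(1) mem_chart by (intro chart.intro) (auto simp: good_def)
    have V: "compact V" "V \<subseteq> c.Dom" "open O'" "O' \<subseteq> V" using g(1) by (auto simp: good_def)
    then show "openin X U" unfolding g(2) by (intro c.open_map_image) auto
    show "\<exists>C. compactin X C \<and> U \<subseteq> C"
      using c.compact_map_image[OF V(1,2)] V(4) unfolding g(2) by blast
  qed
  have "x \<in> \<Union>\<U>" if x: "x \<in> topspace X" for x
  proof -
    obtain c where c: "c \<in> A" "x \<in> chart_image c" using atlas x unfolding Cr_atlas_def orbifold_atlas_def by blast
    have "Cr_action r c" using Cr_atlas_smooth_chart[OF atlas r c(1)] by (simp add: smooth_chart_def smooth_chart_axioms_def)
    then obtain e where e: "e \<in> A" "linear_chart e" "x = chart_map e 0" "0 \<in> chart_dom e"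
      using r.small_chart[OF c(1) _ c(2) openin_topspace x] by metis
    have "open (chart_dom e)" using mem_chart[OF e(1)] by (simp add: orbifold_chart_def)
    then obtain q where q: "q > 0" "cball 0 q \<subseteq> chart_dom e" using e(4) open_contains_cball by blast
    then have "good e (cball 0 q) (ball 0 q)" using e by (auto simp: good_def)
    then have "chart_map e ` ball 0 q \<in> \<U>" unfolding \<U>_def by blast
    moreover have "x \<in> chart_map e ` ball 0 q" using e(3) q(1) by auto
    ultimately show ?thesis by blast
  qed
  then have "\<Union>\<U> = topspace X" using oU openin_subset by blast
  then obtain \<V> where \<V>: "\<V> \<subseteq> \<U>" "countable \<V>" "\<Union>\<V> = topspace X"
    using countable_subcover[OF para comp oU cU] by blast
  have Vne: "\<V> \<noteq> {}" using \<V>(3) False by blast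
  define u where "u = from_nat_into \<V>"
  have u: "range u = \<V>" unfolding u_def using \<V>(2) Vne by (simp add: range_from_nat_into)
  have "\<exists>c V O'. good c V O' \<and> u i = chart_map c ` O'" for i
    using \<V>(1) u unfolding \<U>_def by blast
  then obtain c V O' where g: "\<And>i. good (c i) (V i) (O' i)" "\<And>i. u i = chart_map (c i) ` O' i" by metis
  define K where "K i = (\<Union>j<i. chart_map (c j) ` V j)" for i :: nat
  define G where "G i = (\<Union>j<i. chart_map (c j) ` O' j)" for i :: nat
  have cK: "compactin X (K i)" for i
  proof -
    have "compactin X (chart_map (c j) ` V j)" for j
      using chart.compact_map_image[OF chart.intro[OF mem_chart]] g(1)[of j] by (auto simp: good_def)
    then show ?thesis unfolding K_def by (intro compactin_Union) auto
  qed
  have oG: "openin X (G i)" for i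
    unfolding G_def g(2)[symmetric] using oU u \<V>(1) by (intro openin_Union) blast
  have GK: "G i \<subseteq> K i" for i
    unfolding G_def K_def by (intro UN_mono image_mono) (use g(1) in \<open>auto simp: good_def\<close>)
  have Kmono: "K i \<subseteq> K j" if "i \<le> j" for i j using that unfolding K_def by (intro UN_mono) auto
  have "\<exists>S. \<forall>i. (partial_structure (S i) \<and> K i \<subseteq> support (S i)) \<and>
    (\<forall>x\<in>K i. \<forall>d\<in>S i. \<forall>e\<in>S (Suc i). Cr_compatible s x d e)"
  proof (rule dependent_nat_choice)
    show "\<exists>S. partial_structure S \<and> K 0 \<subseteq> support S"
      by (rule exI[of _ "{}"]) (simp add: partial_structure_def K_def)
  next
    fix S i assume S: "partial_structure S \<and> K i \<subseteq> support S"
    have ci: "c i \<in> A" "linear_chart (c i)" "compact (V i)" "V i \<subseteq> chart_dom (c i)" using g(1)[of i] by (auto simp: good_def)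
    obtain S' where S': "partial_structure S'" "K i \<union> chart_map (c i) ` V i \<subseteq> support S'"
      "\<And>x d e. x \<in> K i \<Longrightarrow> d \<in> S \<Longrightarrow> e \<in> S' \<Longrightarrow> Cr_compatible s x d e"
      by (rule extend_partial_structure[OF conjunct1[OF S] ci(1,2) cK conjunct2[OF S] ci(3,4)]) blast
    moreover have "K (Suc i) = K i \<union> chart_map (c i) ` V i" by (simp add: K_def lessThan_Suc Un_commute)
    ultimately show "\<exists>S'. (partial_structure S' \<and> K (Suc i) \<subseteq> support S') \<and>
      (\<forall>x\<in>K i. \<forall>d\<in>S. \<forall>e\<in>S'. Cr_compatible s x d e)" by (intro exI[of _ S']) simp
  qed
  then obtain S where S: "\<And>i. partial_structure (S i)" "\<And>i. K i \<subseteq> support (S i)"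
    "\<And>i x d e. x \<in> K i \<Longrightarrow> d \<in> S i \<Longrightarrow> e \<in> S (Suc i) \<Longrightarrow> Cr_compatible s x d e" by blast
  have compS: "Cr_compatible s x d e" if "x \<in> K i" "d \<in> S i" "e \<in> S (i + n)" for i n x d e
    using that(3)
  proof (induction n arbitrary: e)
    case 0
    then show ?case using S(1)[of i] that(2) by (simp add: partial_structure_def)
  next
    case (Suc n)
    have xK: "x \<in> K (i + n)" using Kmono[of i "i + n"] that(1) by auto
    then obtain b where b: "b \<in> S (i + n)" "x \<in> chart_image b" using S(2)[of "i + n"] by blast
    have "Cr_compatible s x b e" by (rule S(3)[OF xK b(1)]) (use Suc.prems in simp)
    then show ?case by (rule Cr_compatible_trans[OF Suc.IH[OF b(1)] _ b(2)])
  qed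
  define B where "B i = {e \<in> A. Cr_action s e \<and> chart_image e \<subseteq> G i \<and> (\<forall>d\<in>S i. \<forall>x. Cr_compatible s x e d)}" for i
  have le: "Cr_compatible s x e e'" if e: "e \<in> B i" and e': "e' \<in> B (i + n)" for i n x e e'
  proof (cases "x \<in> chart_image e")
    case True
    then have xK: "x \<in> K i" "x \<in> K (i + n)" using e GK Kmono[of i "i + n"] unfolding B_def by auto
    obtain d where d: "d \<in> S i" "x \<in> chart_image d" using xK(1) S(2) by blast
    obtain d' where d': "d' \<in> S (i + n)" "x \<in> chart_image d'" using xK(2) S(2) by blast
    have "Cr_compatible s x e d" "Cr_compatible s x e' d'" using e e' d(1) d'(1) by (auto simp: B_def)
    then show ?thesis
      using Cr_compatible_trans[OF Cr_compatible_trans[OF _ compS[OF xK(1) d(1) d'(1)] d(2)] Cr_compatible_sym d'(2)] by blast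
  qed (auto intro: Cr_compatible_vacuous)
  show ?thesis
  proof (rule that[of "\<Union>i. B i"])
    have "Cr_compatible s x e e'" if e: "e \<in> B i" "e' \<in> B j" for i j x e e'
    proof (cases "i \<le> j")
      case True
      then show ?thesis using le[of e i e' "j - i" x] e by simp
    next
      case False
      then show ?thesis using Cr_compatible_sym[OF le[of e' j e "i - j" x]] e by simp
    qed
    then show "partial_structure (\<Union>i. B i)" unfolding partial_structure_def by (auto simp: B_def)
    show "topspace X \<subseteq> support (\<Union>i. B i)"
    proof
      fix x assume "x \<in> topspace X"
      then obtain j where "x \<in> u j" using \<V>(3) u by blast
      then have xG: "x \<in> G (Suc j)" unfolding g(2) G_def by blast
      then obtain d where d: "d \<in> S (Suc j)" "x \<in> chart_image d" using GK S(2) by blast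
      have dA: "d \<in> A" "Cr_action s d" using S(1)[of "Suc j"] d(1) unfolding partial_structure_def by blast+
      obtain e where e: "e \<in> A" "linear_chart e" "x \<in> chart_image e" "chart_image e \<subseteq> G (Suc j)"
        "chart_image e \<subseteq> chart_image d" "\<And>y. Cr_compatible s y e d"
        by (rule small_chart[OF dA d(2) oG xG]) blast
      have "Cr_compatible s y e d'" if d': "d' \<in> S (Suc j)" for d' y
      proof (cases "y \<in> chart_image e")
        case True
        then have "y \<in> chart_image d" using e(5) by blast
        moreover have "Cr_compatible s y d d'" using S(1)[of "Suc j"] d(1) d' unfolding partial_structure_def by blast
        ultimately show ?thesis by (intro Cr_compatible_trans[OF e(6)])
      qed (auto intro: Cr_compatible_vacuous)
      then have "e \<in> B (Suc j)" unfolding B_def using e linear_chart_smooth_action by blast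
      then show "x \<in> support (\<Union>i. B i)" using e(3) by blast
    qed
  qed
qed

end

theorem theorem7p4:
  fixes X :: "'x topology"
    and \<O> :: "(real ^ 'n, 'x) orbifold_chart set set"
    and \<alpha> :: "(real ^ 'n, 'x) orbifold_chart set"
    and r s :: enat
  assumes "orbifold X \<O>"
    and "1 \<le> r" and "r < \<infinity>"
    and "differential_structure r X \<O> \<alpha>"
    and "r < s" and "s \<le> \<infinity>"
  shows "\<exists>\<beta>. differential_structure s X \<O> \<beta> \<and> \<beta> \<subseteq> \<alpha>"
proof -
  have rs: "r \<le> s" using assms(5) by simp
  interpret maximal_structure X \<alpha> r s
  proof
    show "Hausdorff_space X" using assms(1) by (simp add: orbifold_def)
    show "Cr_atlas r X \<alpha>" using assms(4) by (simp add: differential_structure_def)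
    show "compatible_charts X r \<alpha> \<alpha> = \<alpha>" by (rule maximal_atlas_eq_compatible_charts[OF assms(4,2)])
  qed (use assms(2) rs in auto)
  obtain B where B: "partial_structure B" "topspace X \<subseteq> support B"
    by (rule exists_compatible_cover) (use assms(1) in \<open>auto simp: orbifold_def\<close>)
  show ?thesis
    by (rule compatible_structure_from_cover[OF assms(1,4,2) rs _ B(2)])
      (use B(1) in \<open>auto simp: partial_structure_def\<close>)
qed

end
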